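(* Let the tenor structure, the process $H$, the volatilities $\lambda(\cdot,T_i)$, the initial rates $L(0,T_i)$, the drift functionals $b(\cdot,T_i;\cdot)$ and the perturbed processes $X^{\epsilon}(\cdot,T_i)$, $\epsilon\in\mathbb{R}$, be as described in the context. Let $i\in\{1,\dots,N\}$ and $t\in[0,T_i]$. The first-order strong Taylor approximation $\mathbf{T}=\mathbf{T}^1$ of the random variable $X^{\epsilon}(t,T_i)$ is given by $$\mathbf{T}\big(X^{\epsilon}(t,T_i)\big)=\log L(0,T_i)+\epsilon\,\frac{\partial}{\partial\epsilon}\Big|_{\epsilon=0}X^{\epsilon}(t,T_i),$$ where the first variation process $Y(\cdot,T_i):=\frac{\partial}{\partial\epsilon}\big|_{\epsilon=0}X^{\epsilon}(\cdot,T_i)$ is a time-inhomogeneous Lévy process with local characteristics $(b^{Y_i},c^{Y_i},F^{Y_i})$ given by $$b^{Y_i}_s=b(s,T_i;X(0)),\qquad c^{Y_i}_s=\lambda^2(s,T_i)\,c_s,$$ $$\int 1_A(x)\,F^{Y_i}_s(\mathrm{d}x)=\int 1_A\big(\lambda(s,T_i)x\big)\,F^{T_*}_s(\mathrm{d}x),\qquad A\in\mathcal{B}(\mathbb{R}\setminus\{0\}),$$ where $X(0)=(\log L(0,T_l))_{1\le l\le N}$ denotes the vector of deterministic initial values.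
   Context: **Time-inhomogeneous Lévy processes.** Let $T_*>0$ be a finite time horizon and $(\Omega,\mathcal{F},\mathbf{F}=(\mathcal{F}_t)_{0\le t\le T_*},\mathbb{P}_{T_*})$ a complete stochastic basis satisfying the usual conditions, with $\mathcal{F}=\mathcal{F}_{T_*}$. All expectations $\mathbb{E}$ are under $\mathbb{P}_{T_*}$. A time-inhomogeneous Lévy process with local characteristics $(b_s,c_s,F_s)$ is an adapted, càdlàg, real-valued process $G$ with independent increments, $G_0=0$, and $$\mathbb{E}\big[e^{iuG_t}\big]=\exp\Big(\int_0^t\Big[iub_s-\frac{c_s}{2}u^2+\int_{\mathbb{R}}(e^{iux}-1-iux)F_s(\mathrm{d}x)\Big]\mathrm{d}s\Big),\quad u\in\mathbb{R},$$ where $b_s\in\mathbb{R}$, $c_s\ge 0$ are deterministic and $F_s$ is a Lévy measure (i.e. $F_s(\{0\})=0$, $\int(1\wedge|x|^2)F_s(\mathrm{d}x)<\infty$) for each $s$. (The truncation function is thus the identity.) If $G$ is defined only on $[0,T_i]$, the same definition is used for times in $[0,T_i]$. **Driving process.** $H=(H_t)_{0\le t\le T_*}$ is a time-inhomogeneous Lévy process under $\mathbb{P}_{T_*}$ with local characteristics $(0,c,F^{T_*})$ satisfying: - $\int_0^{T_*}\big(c_t+\int_{\mathbb{R}}(1\wedge|x|^2)F_t^{T_*}(\mathrm{d}x)\big)\mathrm{d}t<\infty$; - there exist constants $M,\varepsilon>0$ such that for every $u\in[-(1+\varepsilon)M,(1+\varepsilon)M]$: $\int_0^{T_*}\int_{\{|x|>1\}}e^{ux}F_t^{T_*}(\mathrm{d}x)\,\mathrm{d}t<\infty$,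 and moreover $\int_{\{|x|>1\}}e^{ux}F_t^{T_*}(\mathrm{d}x)<\infty$ for all $t\in[0,T_*]$. Hence $H=\int_0^\cdot\sqrt{c_s}\,\mathrm{d}W_s+\int_0^\cdot\int_{\mathbb{R}}x(\mu^H-\nu)(\mathrm{d}s,\mathrm{d}x)$, with $W$ a $\mathbb{P}_{T_*}$-Brownian motion, $\mu^H$ the jump measure of $H$ and $\nu(\mathrm{d}s,\mathrm{d}x)=F_s^{T_*}(\mathrm{d}x)\,\mathrm{d}s$ its $\mathbb{P}_{T_*}$-compensator. **LIBOR data.** $0=T_0<T_1<\dots<T_N<T_{N+1}=T_*$ is a tenor structure and $\delta_i=T_{i+1}-T_i$. For each $i\in\{1,\dots,N\}$, $\lambda(\cdot,T_i):[0,T_i]\to\mathbb{R}$ is a bounded, continuous, deterministic function, extended by $\lambda(s,T_i)=0$ for $s>T_i$, and $\sum_{i=1}^N|\lambda(s,T_i)|\le M$ for all $s\in[0,T_*]$, with $M$ the constant above. The initial bond prices $B(0,T_i)$, $1\le i\le N+1$, are strictly positive and strictly decreasing in $i$, and $L(0,T_i)=\frac{1}{\delta_i}\Big(\frac{B(0,T_i)}{B(0,T_{i+1})}-1\Big)>0$ for $1\le i\le N$. **Drift functional.** For $x=(x_1,\dots,x_N)\in\mathbb{R}^N$ put $$\beta(s,y,T_l;x)=\frac{\delta_l e^{x_l}}{1+\delta_l e^{x_l}}\big(e^{\lambda(s,T_l)y}-1\big)+1,$$ $$b(s,T_i;x)=-\tfrac12\lambda^2(s,T_i)c_s-c_s\lambda(s,T_i)\sum_{l=i+1}^N\frac{\delta_l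 e^{x_l}}{1+\delta_l e^{x_l}}\lambda(s,T_l)-\int_{\mathbb{R}}\Big(\big(e^{\lambda(s,T_i)y}-1\big)\prod_{l=i+1}^N\beta(s,y,T_l;x)-\lambda(s,T_i)y\Big)F_s^{T_*}(\mathrm{d}y),$$ where for $i=N$ the empty sum is $0$ and the empty product is $1$. Note that $b(s,T_i;x)$ depends only on $x_{i+1},\dots,x_N$. When a stochastic process is inserted for $x$, its left limits at time $s$ are used. **Perturbed processes.** For each $\epsilon\in\mathbb{R}$ and $i\in\{1,\dots,N\}$, $X^\epsilon(\cdot,T_i)=(X^\epsilon(t,T_i))_{0\le t\le T_i}$ is the solution of $$\mathrm{d}X^\epsilon(t,T_i)=\epsilon\Big(b(t,T_i;X^\epsilon(t))\,\mathrm{d}t+\lambda(t,T_i)\,\mathrm{d}H_t\Big),\qquad X^\epsilon(0,T_i)=\log L(0,T_i),$$ where the drift $b(t,T_i;X^\epsilon(t))$ depends on the subsequent perturbed processes $X^\epsilon(\cdot,T_{i+1}),\dots,X^\epsilon(\cdot,T_N)$ with the same $\epsilon$. **Strong Taylor approximation.** For a smooth curve $\epsilon\mapsto W_\epsilon\in L^2(\Omega;\mathbb{R})$, $\epsilon\in\mathbb{R}$, a strong Taylor approximation of order $n\ge0$ is the truncated power series $\mathbf{T}^n(W_\epsilon):=\sum_{k=0}^n\frac{\epsilon^k}{k!}\frac{\partial^k}{\partial\epsilon^k}\big|_{\epsilon=0}W_\epsilon$ such that $\mathbb{E}\big[|W_\epsilon-\mathbf{T}^n(W_\epsilon)|\big]=o(\epsilon^n)$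 as $\epsilon\to0$. One writes $\mathbf{T}=\mathbf{T}^1$. *)

theory Defs
  imports "HOL-Probability.Probability" "HOL-Library.Landau_Symbols"
begin

section \<open>Stochastic basis\<close>

text \<open>
  The basis lives on the time interval \<open>[0,T]\<close>. The filtration is indexed by all reals only
  because of the type; nothing is required of it outside \<open>[0,T]\<close> beyond monotonicity.
\<close>

locale stochastic_basis = prob_space P + filtration "space P" F
  for P :: "'a measure" and F :: "real \<Rightarrow> 'a measure" +
  fixes T :: real
  assumes horizon_pos: "0 < T"
    and terminal_sigma_algebra: "sets (F T) = sets P"
    and complete_basis: "\<And>A N. N \<in> null_sets P \<Longrightarrow> A \<subseteq> N \<Longrightarrow> A \<in> sets (F 0)"
    and right_continuous_filtration:
      "\<And>t. 0 \<le> t \<Longrightarrow> t < T \<Longrightarrow> sets (F t) = (\<Inter>s\<in>{t<..T}. sets (F s))"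

definition adapted_on :: "(real \<Rightarrow> 'a measure) \<Rightarrow> real \<Rightarrow> (real \<Rightarrow> 'a \<Rightarrow> real) \<Rightarrow> bool" where
  "adapted_on F T G \<longleftrightarrow> (\<forall>t\<in>{0..T}. G t \<in> borel_measurable (F t))"

definition cadlag_on :: "real \<Rightarrow> (real \<Rightarrow> real) \<Rightarrow> bool" where
  "cadlag_on T f \<longleftrightarrow>
     (\<forall>t\<in>{0..<T}. (f \<longlongrightarrow> f t) (at_right t)) \<and>
     (\<forall>t\<in>{0<..T}. \<exists>l. (f \<longlongrightarrow> l) (at_left t))"


section \<open>Time-inhomogeneous Levy processes\<close>

definition levy_measure :: "real measure \<Rightarrow> bool" where
  "levy_measure \<nu> \<longleftrightarrow>
     sets \<nu> = sets borel \<and> emeasure \<nu> {0} = 0 \<and> (\<integral>\<^sup>+x. ennreal (min 1 (x\<^sup>2)) \<partial>\<nu>) < \<infinity>"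

text \<open>The truncation function is the identity.\<close>

definition levy_exponent :: "real \<Rightarrow> real \<Rightarrow> real measure \<Rightarrow> real \<Rightarrow> complex" where
  "levy_exponent b c \<nu> u =
     \<i> * of_real (u * b) - of_real (c / 2 * u\<^sup>2)
     + (CLINT x|\<nu>. iexp (u * x) - 1 - \<i> * of_real (u * x))"

text \<open>
  Independence of increments is with respect to the filtration. Since the Bochner
  integral of a non-integrable function is \<open>0\<close>, the definition includes what the formula for
  the characteristic function needs in order to make sense: measurability of the characteristics in
  the time variable and existence of the two integrals in the exponent.
\<close>

definition time_inhom_levy ::
  "'a measure \<Rightarrow> (real \<Rightarrow> 'a measure) \<Rightarrow> real \<Rightarrow> (real \<Rightarrow> real) \<Rightarrow> (real \<Rightarrow> real) \<Rightarrow>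
   (real \<Rightarrow> real measure) \<Rightarrow> (real \<Rightarrow> 'a \<Rightarrow> real) \<Rightarrow> bool" where
  "time_inhom_levy P F T b c \<nu> G \<longleftrightarrow>
     b \<in> borel_measurable (restrict_space borel {0..T}) \<and>
     c \<in> borel_measurable (restrict_space borel {0..T}) \<and>
     (\<forall>A\<in>sets borel. (\<lambda>s. emeasure (\<nu> s) A) \<in> borel_measurable (restrict_space borel {0..T})) \<and>
     (\<forall>s\<in>{0..T}. 0 \<le> c s \<and> levy_measure (\<nu> s)) \<and>
     (\<forall>u. \<forall>s\<in>{0..T}. integrable (\<nu> s) (\<lambda>x. iexp (u * x) - 1 - \<i> * of_real (u * x))) \<and>
     (\<forall>u. set_integrable lborel {0..T} (\<lambda>s. levy_exponent (b s) (c s) (\<nu> s) u)) \<and>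
     adapted_on F T G \<and>
     (\<forall>\<omega>\<in>space P. cadlag_on T (\<lambda>t. G t \<omega>)) \<and>
     (\<forall>\<omega>\<in>space P. G 0 \<omega> = 0) \<and>
     (\<forall>s t. 0 \<le> s \<and> s < t \<and> t \<le> T \<longrightarrow>
        prob_space.indep_set P (sets (F s))
          (sets (vimage_algebra (space P) (\<lambda>\<omega>. G t \<omega> - G s \<omega>) borel))) \<and>
     (\<forall>t\<in>{0..T}. \<forall>u.
        (CLINT \<omega>|P. iexp (u * G t \<omega>)) =
        exp (CLINT s:{0..t}|lborel. levy_exponent (b s) (c s) (\<nu> s) u))"


section \<open>Stochastic integrals\<close>

text \<open>
  The elementary process \<open>(Z, [(r\<^sub>1,s\<^sub>1,\<xi>\<^sub>1),\<dots>])\<close> is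
  \<open>Z 1\<^bsub>{0}\<^esub> + \<Sum>\<^sub>k \<xi>\<^sub>k 1\<^bsub>(r\<^sub>k,s\<^sub>k]\<^esub>\<close>
  with bounded \<open>F\<^sub>0\<close>- and \<open>F\<^bsub>r\<^sub>k\<^esub>\<close>-measurable
  coefficients; the time \<open>0\<close> part does not contribute to the integral.
\<close>

type_synonym 'a elementary = "('a \<Rightarrow> real) \<times> (real \<times> real \<times> ('a \<Rightarrow> real)) list"

definition elementary_process ::
  "'a measure \<Rightarrow> (real \<Rightarrow> 'a measure) \<Rightarrow> real \<Rightarrow> 'a elementary \<Rightarrow> bool" where
  "elementary_process P F T E \<longleftrightarrow>
     fst E \<in> borel_measurable (F 0) \<and> (\<exists>C. \<forall>\<omega>\<in>space P. \<bar>fst E \<omega>\<bar> \<le> C) \<and>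
     (\<forall>(r, s, \<xi>)\<in>set (snd E). 0 \<le> r \<and> r \<le> s \<and> s \<le> T \<and>
        \<xi> \<in> borel_measurable (F r) \<and> (\<exists>C. \<forall>\<omega>\<in>space P. \<bar>\<xi> \<omega>\<bar> \<le> C))"

definition elementary_value :: "'a elementary \<Rightarrow> real \<Rightarrow> 'a \<Rightarrow> real" where
  "elementary_value E t \<omega> =
     fst E \<omega> * indicator {0} t + (\<Sum>(r, s, \<xi>)\<leftarrow>snd E. \<xi> \<omega> * indicator {r<..s} t)"

definition elementary_integral ::
  "(real \<Rightarrow> 'a \<Rightarrow> real) \<Rightarrow> 'a elementary \<Rightarrow> real \<Rightarrow> 'a \<Rightarrow> real" where
  "elementary_integral H E t \<omega> = (\<Sum>(r, s, \<xi>)\<leftarrow>snd E. \<xi> \<omega> * (H (min s t) \<omega> - H (min r t) \<omega>))"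

definition ucp_tendsto ::
  "'a measure \<Rightarrow> real \<Rightarrow> (nat \<Rightarrow> real \<Rightarrow> 'a \<Rightarrow> real) \<Rightarrow> (real \<Rightarrow> 'a \<Rightarrow> real) \<Rightarrow> bool" where
  "ucp_tendsto P T J J' \<longleftrightarrow>
     (\<forall>\<eta>>0. (\<lambda>n. measure P {\<omega>\<in>space P. \<exists>t\<in>{0..T}. \<eta> < \<bar>J n t \<omega> - J' t \<omega>\<bar>}) \<longlonglongrightarrow> 0)"

text \<open>
  \<open>J\<close> is the integral of \<open>K\<close> against the semimartingale \<open>H\<close> on \<open>[0,T]\<close>: the extension of the
  elementary integral that is continuous under bounded pointwise convergence. Only bounded adapted
  left-continuous integrands are admitted. Each of them is a bounded pointwise limit of
  elementary processes (sample it along dyadic partitions), so \<open>J\<close> is determined up to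
  indistinguishability.
\<close>

definition stochastic_integral ::
  "'a measure \<Rightarrow> (real \<Rightarrow> 'a measure) \<Rightarrow> real \<Rightarrow> (real \<Rightarrow> 'a \<Rightarrow> real) \<Rightarrow> (real \<Rightarrow> 'a \<Rightarrow> real) \<Rightarrow>
   (real \<Rightarrow> 'a \<Rightarrow> real) \<Rightarrow> bool" where
  "stochastic_integral P F T K H J \<longleftrightarrow>
     adapted_on F T K \<and>
     (\<forall>\<omega>\<in>space P. \<forall>t\<in>{0<..T}. ((\<lambda>s. K s \<omega>) \<longlongrightarrow> K t \<omega>) (at_left t)) \<and>
     (\<exists>C. \<forall>\<omega>\<in>space P. \<forall>t\<in>{0..T}. \<bar>K t \<omega>\<bar> \<le> C) \<and>
     adapted_on F T J \<and>
     (\<forall>\<omega>\<in>space P. cadlag_on T (\<lambda>t. J t \<omega>)) \<and>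
     (\<forall>E C. (\<forall>n. elementary_process P F T (E n)) \<and>
            (\<forall>n. \<forall>t\<in>{0..T}. \<forall>\<omega>\<in>space P. \<bar>elementary_value (E n) t \<omega>\<bar> \<le> C) \<and>
            (\<forall>t\<in>{0..T}. \<forall>\<omega>\<in>space P. (\<lambda>n. elementary_value (E n) t \<omega>) \<longlonglongrightarrow> K t \<omega>) \<longrightarrow>
            ucp_tendsto P T (\<lambda>n. elementary_integral H (E n)) J)"


section \<open>The LIBOR model\<close>

text \<open>
  \<open>T k\<close> is the tenor date \<open>T\<^sub>k\<close>, \<open>B i\<close> the bond price \<open>B(0,T\<^sub>i)\<close>, \<open>lam s i\<close> the volatility
  \<open>\<lambda>(s,T\<^sub>i)\<close>, and vectors of \<open>\<real>\<^sup>N\<close> are functions on the indices \<open>1,\<dots>,N\<close>.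
\<close>

definition accrual :: "(nat \<Rightarrow> real) \<Rightarrow> nat \<Rightarrow> real" where
  "accrual T i = T (Suc i) - T i"

definition libor0 :: "(nat \<Rightarrow> real) \<Rightarrow> (nat \<Rightarrow> real) \<Rightarrow> nat \<Rightarrow> real" where
  "libor0 T B i = 1 / accrual T i * (B i / B (Suc i) - 1)"

definition weight :: "(nat \<Rightarrow> real) \<Rightarrow> nat \<Rightarrow> (nat \<Rightarrow> real) \<Rightarrow> real" where
  "weight T l x = accrual T l * exp (x l) / (1 + accrual T l * exp (x l))"

definition drift_beta ::
  "(nat \<Rightarrow> real) \<Rightarrow> (real \<Rightarrow> nat \<Rightarrow> real) \<Rightarrow> real \<Rightarrow> real \<Rightarrow> nat \<Rightarrow> (nat \<Rightarrow> real) \<Rightarrow> real" where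
  "drift_beta T lam s y l x = weight T l x * (exp (lam s l * y) - 1) + 1"

definition drift ::
  "nat \<Rightarrow> (nat \<Rightarrow> real) \<Rightarrow> (real \<Rightarrow> nat \<Rightarrow> real) \<Rightarrow> (real \<Rightarrow> real) \<Rightarrow> (real \<Rightarrow> real measure) \<Rightarrow>
   real \<Rightarrow> nat \<Rightarrow> (nat \<Rightarrow> real) \<Rightarrow> real" where
  "drift N T lam c \<nu> s i x =
     - 1 / 2 * (lam s i)\<^sup>2 * c s
     - c s * lam s i * (\<Sum>l\<in>{i+1..N}. weight T l x * lam s l)
     - (LINT y|\<nu> s. (exp (lam s i * y) - 1) * (\<Prod>l\<in>{i+1..N}. drift_beta T lam s y l x) - lam s i * y)"

locale levy_libor = stochastic_basis P F "T (Suc N)"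
  for P :: "'a measure" and F :: "real \<Rightarrow> 'a measure" and T :: "nat \<Rightarrow> real" and N :: nat +
  fixes H :: "real \<Rightarrow> 'a \<Rightarrow> real" and c :: "real \<Rightarrow> real" and \<nu> :: "real \<Rightarrow> real measure"
    and M e :: real and lam :: "real \<Rightarrow> nat \<Rightarrow> real" and B :: "nat \<Rightarrow> real"
  assumes driver: "time_inhom_levy P F (T (Suc N)) (\<lambda>s. 0) c \<nu> H"
    and characteristics_integrable:
      "(\<integral>\<^sup>+t\<in>{0..T (Suc N)}. (ennreal (c t) + (\<integral>\<^sup>+x. ennreal (min 1 (x\<^sup>2)) \<partial>\<nu> t)) \<partial>lborel) < \<infinity>"
    and M_pos: "0 < M" and e_pos: "0 < e"
    and exponential_moments:
      "\<And>u. u \<in> {- (1 + e) * M..(1 + e) * M} \<Longrightarrow>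
         (\<integral>\<^sup>+t\<in>{0..T (Suc N)}. (\<integral>\<^sup>+x\<in>{x. 1 < \<bar>x\<bar>}. ennreal (exp (u * x)) \<partial>\<nu> t) \<partial>lborel) < \<infinity>"
    and exponential_moments_pointwise:
      "\<And>u t. u \<in> {- (1 + e) * M..(1 + e) * M} \<Longrightarrow> t \<in> {0..T (Suc N)} \<Longrightarrow>
         (\<integral>\<^sup>+x\<in>{x. 1 < \<bar>x\<bar>}. ennreal (exp (u * x)) \<partial>\<nu> t) < \<infinity>"
    and tenor_start: "T 0 = 0"
    and tenor_increasing: "\<And>k. k \<le> N \<Longrightarrow> T k < T (Suc k)"
    and vol_bounded: "\<And>i. i \<in> {1..N} \<Longrightarrow> bounded ((\<lambda>s. lam s i) ` {0..T i})"
    and vol_continuous: "\<And>i. i \<in> {1..N} \<Longrightarrow> continuous_on {0..T i} (\<lambda>s. lam s i)"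
    and vol_extension: "\<And>i s. i \<in> {1..N} \<Longrightarrow> T i < s \<Longrightarrow> lam s i = 0"
    and vol_sum: "\<And>s. s \<in> {0..T (Suc N)} \<Longrightarrow> (\<Sum>i\<in>{1..N}. \<bar>lam s i\<bar>) \<le> M"
    and bond_pos: "\<And>i. i \<in> {1..Suc N} \<Longrightarrow> 0 < B i"
    and bond_decreasing: "\<And>i. i \<in> {1..N} \<Longrightarrow> B (Suc i) < B i"
    and libor0_pos: "\<And>i. i \<in> {1..N} \<Longrightarrow> 0 < libor0 T B i"

text \<open>
  \<open>X i t\<close> is \<open>X\<^sup>\<epsilon>(t,T\<^sub>i)\<close> for one fixed \<open>\<epsilon>\<close>. The drift at time \<open>s\<close> is evaluated at the
  left limits \<open>X(s-)\<close>.
\<close>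

definition perturbed_solution ::
  "'a measure \<Rightarrow> (real \<Rightarrow> 'a measure) \<Rightarrow> (nat \<Rightarrow> real) \<Rightarrow> nat \<Rightarrow> (real \<Rightarrow> 'a \<Rightarrow> real) \<Rightarrow>
   (real \<Rightarrow> real) \<Rightarrow> (real \<Rightarrow> real measure) \<Rightarrow> (real \<Rightarrow> nat \<Rightarrow> real) \<Rightarrow> (nat \<Rightarrow> real) \<Rightarrow>
   real \<Rightarrow> (nat \<Rightarrow> real \<Rightarrow> 'a \<Rightarrow> real) \<Rightarrow> bool" where
  "perturbed_solution P F T N H c \<nu> lam B \<epsilon> X \<longleftrightarrow>
     (\<forall>i\<in>{1..N}.
        adapted_on F (T i) (X i) \<and>
        (\<forall>\<omega>\<in>space P. cadlag_on (T i) (\<lambda>t. X i t \<omega>)) \<and>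
        (\<exists>J. stochastic_integral P F (T i) (\<lambda>s \<omega>. lam s i) H J \<and>
          (AE \<omega> in P.
             set_integrable lborel {0..T i}
               (\<lambda>s. drift N T lam c \<nu> s i (\<lambda>l. Lim (at_left s) (\<lambda>r. X l r \<omega>))) \<and>
             (\<forall>t\<in>{0..T i}. X i t \<omega> = ln (libor0 T B i) +
                \<epsilon> * ((LINT s:{0..t}|lborel.
                        drift N T lam c \<nu> s i (\<lambda>l. Lim (at_left s) (\<lambda>r. X l r \<omega>)))
                     + J t \<omega>)))))"


section \<open>Strong Taylor approximation\<close>

definition square_integrable :: "'a measure \<Rightarrow> ('a \<Rightarrow> real) \<Rightarrow> bool" where
  "square_integrable P Z \<longleftrightarrow> Z \<in> borel_measurable P \<and> integrable P (\<lambda>\<omega>. (Z \<omega>)\<^sup>2)"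

definition has_L2_derivative ::
  "'a measure \<Rightarrow> (real \<Rightarrow> 'a \<Rightarrow> real) \<Rightarrow> ('a \<Rightarrow> real) \<Rightarrow> real \<Rightarrow> bool" where
  "has_L2_derivative P W Z \<epsilon> \<longleftrightarrow>
     (\<forall>\<eta>. square_integrable P (W \<eta>)) \<and> square_integrable P Z \<and>
     ((\<lambda>h. LINT \<omega>|P. ((W (\<epsilon> + h) \<omega> - W \<epsilon> \<omega>) / h - Z \<omega>)\<^sup>2) \<longlongrightarrow> 0) (at 0)"

text \<open>
  \<open>D k \<epsilon>\<close> is the \<open>k\<close>-th derivative at \<open>\<epsilon>\<close> of the smooth curve \<open>W\<close> in \<open>L\<^sup>2\<close>.
  Elements of \<open>L\<^sup>2\<close> are represented by random variables, hence the truncated series is identified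
  only almost everywhere.
\<close>

definition smooth_L2_curve ::
  "'a measure \<Rightarrow> (real \<Rightarrow> 'a \<Rightarrow> real) \<Rightarrow> (nat \<Rightarrow> real \<Rightarrow> 'a \<Rightarrow> real) \<Rightarrow> bool" where
  "smooth_L2_curve P W D \<longleftrightarrow> D 0 = W \<and> (\<forall>k \<epsilon>. has_L2_derivative P (D k) (D (Suc k) \<epsilon>) \<epsilon>)"

definition strong_Taylor_approximation ::
  "'a measure \<Rightarrow> nat \<Rightarrow> (real \<Rightarrow> 'a \<Rightarrow> real) \<Rightarrow> (real \<Rightarrow> 'a \<Rightarrow> real) \<Rightarrow> bool" where
  "strong_Taylor_approximation P n W A \<longleftrightarrow>
     (\<exists>D. smooth_L2_curve P W D \<and>
        (\<forall>\<epsilon>. AE \<omega> in P. A \<epsilon> \<omega> = (\<Sum>k\<le>n. \<epsilon> ^ k / fact k * D k 0 \<omega>))) \<and>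
     (\<forall>\<epsilon>. A \<epsilon> \<in> borel_measurable P) \<and>
     (\<lambda>\<epsilon>. LINT \<omega>|P. \<bar>W \<epsilon> \<omega> - A \<epsilon> \<omega>\<bar>) \<in> o[at 0](\<lambda>\<epsilon>. \<epsilon> ^ n)"

end

theory Submission
  imports Defs "HOL-Complex_Analysis.Cauchy_Integral_Formula"
begin

text \<open>
  The drift of \<open>X\<^sup>\<epsilon>(\<cdot>,T\<^sub>i)\<close> sees only the rates with later maturities, so the solutions are
  controlled by downward induction over the maturities (\<open>representation\<close>). At \<open>\<epsilon> = 0\<close> all rates stay at their initial values;
  the derivative there is \<open>Y\<^sub>t = \<integral>\<^sub>0\<^sup>t b(s,T\<^sub>i;X(0)) ds + \<integral>\<^sub>0\<^sup>t \<lambda>(s,T\<^sub>i) dH\<^sub>s\<close>, a deterministic drift plus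
  the integral of a deterministic function.

  That \<open>Y\<close> is a time-inhomogeneous Levy process comes from its Riemann sums. By independence of
  the increments of \<open>H\<close> their characteristic functions are exponentials of
  \<open>\<integral> \<psi>\<^sub>s(u \<lambda>\<^sub>n(s)) ds\<close> with step functions \<open>\<lambda>\<^sub>n\<close> (\<open>H_chain_char\<close>), also on events of the past.
  In the limit (\<open>vol_integral_increment_char\<close>) the exponent is \<open>\<psi>\<^sub>s(u \<lambda>(s))\<close>, and putting
  \<open>u \<lambda>(s)\<close> in place of \<open>u\<close> amounts to scaling \<open>c\<^sub>s\<close> by \<open>\<lambda>(s)\<^sup>2\<close> and transporting the jump measure by
  \<open>x \<mapsto> \<lambda>(s) x\<close>.

  The Taylor approximation requires \<open>\<epsilon> \<mapsto> X\<^sup>\<epsilon>(t,T\<^sub>i)\<close> to be a smooth curve in \<open>L\<^sup>2\<close>, with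
  derivatives of all orders at all \<open>\<epsilon>\<close>. Multiplying out the product in the drift shows that the drift
  is a polynomial in the weights \<open>\<delta>\<^sub>l exp x\<^sub>l / (1 + \<delta>\<^sub>l exp x\<^sub>l)\<close>, with coefficients that are integrable in
  time (\<open>drift_expansion\<close>). The weights are logistic functions, which satisfy \<open>w' = w (1 - w)\<close>.
  Hence the derivatives in \<open>\<epsilon>\<close>, taken for each outcome separately, are again built from sums, products
  and time integrals of weights and of the processes \<open>\<integral> \<lambda>(s,T\<^sub>l) dH\<^sub>s\<close>. The predicate
  \<open>smooth_upto\<close> is closed under these operations, and its members are dominated by processes with
  moments of all orders, so dominated convergence turns the derivatives of the paths into
  derivatives in \<open>L\<^sup>2\<close> (\<open>has_L2_derivative_pathwise\<close>).

  This needs moments of all orders of \<open>\<integral> \<lambda>(s,T\<^sub>l) dH\<^sub>s\<close>, uniformly in time, and only the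
  characteristic function is known. The exponential moments of the jump measures give cumulants of all
  orders, so the characteristic function agrees up to \<open>O(u\<^sup>2\<^sup>k)\<close> with an entire function whose bound is
  uniform in time. Its symmetric difference of order \<open>2k\<close> with step \<open>h\<close> is the
  expectation of \<open>|exp(ihJ) - 1|\<^sup>2\<^sup>k\<close> and is therefore \<open>O(h\<^sup>2\<^sup>k)\<close>; Fatou's lemma bounds the moment
  (\<open>moment_le_of_char_approx\<close>).
\<close>

section \<open>Differentiation under the integral\<close>

lemma tendsto_integral_dominated_at:
  fixes f :: "real \<Rightarrow> 'b \<Rightarrow> real"
  assumes f: "\<And>h. f h \<in> borel_measurable M" and g: "g \<in> borel_measurable M"
    and w: "integrable M w"
    and bound: "\<forall>\<^sub>F h in at a. \<forall>x\<in>space M. \<bar>f h x\<bar> \<le> w x"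
    and lim: "\<And>x. x \<in> space M \<Longrightarrow> ((\<lambda>h. f h x) \<longlongrightarrow> g x) (at a)"
  shows "((\<lambda>h. integral\<^sup>L M (f h)) \<longlongrightarrow> integral\<^sup>L M g) (at a)"
  unfolding tendsto_at_iff_sequentially comp_def
proof (intro allI impI)
  fix S :: "nat \<Rightarrow> real"
  assume S: "\<forall>i. S i \<in> UNIV - {a}" "S \<longlonglongrightarrow> a"
  have filt: "filterlim S (at a) sequentially"
    using S by (auto simp: filterlim_at)
  have "\<forall>\<^sub>F n in sequentially. \<forall>x\<in>space M. \<bar>f (S n) x\<bar> \<le> w x"
    using filterlim_iff[THEN iffD1, rule_format, OF filt bound] .
  then obtain n0 where n0: "\<And>n x. n \<ge> n0 \<Longrightarrow> x \<in> space M \<Longrightarrow> \<bar>f (S n) x\<bar> \<le> w x"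
    by (auto simp: eventually_sequentially)
  have "(\<lambda>n. integral\<^sup>L M (f (S (n + n0)))) \<longlonglongrightarrow> integral\<^sup>L M g"
  proof (rule integral_dominated_convergence[OF g _ w])
    show "AE x in M. (\<lambda>n. f (S (n + n0)) x) \<longlonglongrightarrow> g x"
    proof (rule AE_I2)
      fix x assume "x \<in> space M"
      from filterlim_compose[OF lim[OF this] filt]
      show "(\<lambda>n. f (S (n + n0)) x) \<longlonglongrightarrow> g x" by (rule LIMSEQ_ignore_initial_segment)
    qed
  qed (use f n0 in auto)
  then show "(\<lambda>n. integral\<^sup>L M (f (S n))) \<longlonglongrightarrow> integral\<^sup>L M g"
    by (rule LIMSEQ_offset)
qed

lemma difference_quotient_le:
  fixes f :: "real \<Rightarrow> real"
  assumes deriv: "\<And>y. (f has_real_derivative f' y) (at y)"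
    and bound: "\<And>y. \<bar>y\<bar> \<le> R \<Longrightarrow> \<bar>f' y\<bar> \<le> C"
    and "h \<noteq> 0" "\<bar>x\<bar> + \<bar>h\<bar> \<le> R"
  shows "\<bar>(f (x + h) - f x) / h\<bar> \<le> C"
proof -
  have "norm (f (x + h) - f x) \<le> C * norm ((x + h) - x)"
  proof (rule field_differentiable_bound[of "{-R..R}" f f' C "x + h" x])
    show "norm (f' z) \<le> C" if "z \<in> {-R..R}" for z using that bound[of z] by (simp add: abs_le_iff)
    show "x + h \<in> {-R..R}" "x \<in> {-R..R}" using assms(4) by (auto simp: abs_le_iff)
  qed (auto intro: deriv has_field_derivative_at_within)
  then show ?thesis using \<open>h \<noteq> 0\<close> by (simp add: abs_divide divide_le_eq)
qed

lemma eventually_difference_quotient_le: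
  fixes f :: "'b \<Rightarrow> real \<Rightarrow> real"
  assumes deriv: "\<And>y x. x \<in> A \<Longrightarrow> (f x has_real_derivative f' x y) (at y)"
    and bound: "\<And>y x. \<bar>y\<bar> \<le> \<bar>y0\<bar> + 1 \<Longrightarrow> x \<in> A \<Longrightarrow> \<bar>f' x y\<bar> \<le> C x"
  shows "\<forall>\<^sub>F h in at 0. \<forall>x\<in>A. \<bar>(f x (y0 + h) - f x y0) / h\<bar> \<le> C x"
proof -
  have "\<forall>\<^sub>F h in at (0::real). \<bar>h\<bar> < 1"
    by (auto simp: eventually_at intro!: exI[of _ 1])
  moreover have "\<forall>\<^sub>F h in at (0::real). h \<noteq> 0" by (simp add: eventually_at_filter)
  ultimately show ?thesis
  proof eventually_elim
    case (elim h)
    show ?case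
    proof
      fix x assume "x \<in> A"
      then show "\<bar>(f x (y0 + h) - f x y0) / h\<bar> \<le> C x"
        using difference_quotient_le[of "f x" "f' x" "\<bar>y0\<bar> + 1" "C x" h y0] deriv bound elim by auto
    qed
  qed
qed

lemma has_real_derivative_integral:
  fixes f :: "'b \<Rightarrow> real \<Rightarrow> real"
  assumes f: "\<And>y. integrable M (\<lambda>x. f x y)" and f': "\<And>y. (\<lambda>x. f' x y) \<in> borel_measurable M"
    and deriv: "\<And>x y. x \<in> space M \<Longrightarrow> (f x has_real_derivative f' x y) (at y)"
    and w: "integrable M w"
    and bound: "\<And>x y. \<bar>y\<bar> \<le> \<bar>y0\<bar> + 1 \<Longrightarrow> x \<in> space M \<Longrightarrow> \<bar>f' x y\<bar> \<le> w x"
  shows "((\<lambda>y. LINT x|M. f x y) has_real_derivative (LINT x|M. f' x y0)) (at y0)"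
proof -
  have "((\<lambda>h. LINT x|M. (f x (y0 + h) - f x y0) / h) \<longlongrightarrow> (LINT x|M. f' x y0)) (at 0)"
  proof (rule tendsto_integral_dominated_at[OF _ f' w])
    show "\<forall>\<^sub>F h in at 0. \<forall>x\<in>space M. \<bar>(f x (y0 + h) - f x y0) / h\<bar> \<le> w x"
      by (rule eventually_difference_quotient_le[OF deriv bound])
    show "(\<lambda>x. (f x (y0 + h) - f x y0) / h) \<in> borel_measurable M" for h
      using f[THEN borel_measurable_integrable] by measurable
  qed (use deriv in \<open>auto simp: DERIV_def\<close>)
  also have "(\<lambda>h. LINT x|M. (f x (y0 + h) - f x y0) / h) =
      (\<lambda>h. ((LINT x|M. f x (y0 + h)) - (LINT x|M. f x y0)) / h)"
    by (simp add: Bochner_Integration.integral_diff f)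
  finally show ?thesis by (simp add: DERIV_def)
qed

section \<open>Processes with moments of all orders\<close>

lemma power_Suc_tangent_le:
  fixes x m :: real
  assumes "0 \<le> x" "0 \<le> m"
  shows "m ^ Suc n + real (Suc n) * m ^ n * (x - m) \<le> x ^ Suc n"
proof (induction n)
  case (Suc n)
  have "0 \<le> real (Suc n) * m ^ n * (x - m)\<^sup>2" using assms by simp
  then have "m ^ Suc (Suc n) + real (Suc (Suc n)) * m ^ Suc n * (x - m)
      \<le> x * (m ^ Suc n + real (Suc n) * m ^ n * (x - m))"
    by (simp add: algebra_simps power2_eq_square)
  also have "\<dots> \<le> x * x ^ Suc n" using Suc assms by (intro mult_left_mono) auto
  finally show ?case by simp
qed simp

text \<open>
  Jensen's inequality for a power and the finite measure with density \<open>a\<close>: integrate the tangent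
  inequality at the mean value of \<open>g\<close>.
\<close>

lemma power_integral_le:
  fixes a g :: "'b \<Rightarrow> real"
  assumes a: "integrable M a" "\<And>x. x \<in> space M \<Longrightarrow> 0 \<le> a x"
    and g: "integrable M (\<lambda>x. a x * g x)" "\<And>x. x \<in> space M \<Longrightarrow> 0 \<le> g x"
    and gk: "integrable M (\<lambda>x. a x * g x ^ Suc n)"
  shows "(LINT x|M. a x * g x) ^ Suc n \<le> (LINT x|M. a x) ^ n * (LINT x|M. a x * g x ^ Suc n)"
proof -
  let ?A = "LINT x|M. a x" and ?I = "LINT x|M. a x * g x"
  have A: "0 \<le> ?A" using a(2) by (intro Bochner_Integration.integral_nonneg) auto
  show ?thesis
  proof (cases "?A = 0")
    case True
    have "AE x in M. a x = 0" using True integral_nonneg_eq_0_iff_AE[OF a(1)] a(2) by auto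
    then have "AE x in M. a x * g x = 0" "AE x in M. a x * g x ^ Suc n = 0" by auto
    then have "?I = 0" "(LINT x|M. a x * g x ^ Suc n) = 0"
      by (auto intro: integral_eq_zero_AE simp del: power_Suc)
    then show ?thesis by simp
  next
    case False
    then have pos: "0 < ?A" using A by simp
    \<comment> \<open>the mean value of \<open>g\<close>\<close>
    define m where "m = ?I / ?A"
    have I: "?I = m * ?A" using False by (simp add: m_def)
    have m: "0 \<le> m" unfolding m_def using A a(2) g(2)
      by (intro divide_nonneg_nonneg Bochner_Integration.integral_nonneg) auto
    have "(LINT x|M. m ^ Suc n * a x + real (Suc n) * m ^ n * (a x * g x - m * a x))
        \<le> (LINT x|M. a x * g x ^ Suc n)"
    proof (rule integral_mono)
      fix x assume x: "x \<in> space M"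
      have "a x * (m ^ Suc n + real (Suc n) * m ^ n * (g x - m)) \<le> a x * g x ^ Suc n"
        using x a(2) g(2) m by (intro mult_left_mono power_Suc_tangent_le) auto
      then show "m ^ Suc n * a x + real (Suc n) * m ^ n * (a x * g x - m * a x) \<le> a x * g x ^ Suc n"
        by (simp add: algebra_simps)
    qed (use a g gk in \<open>auto intro!: Bochner_Integration.integrable_add integrable_mult_right
        Bochner_Integration.integrable_diff\<close>)
    also have "(LINT x|M. m ^ Suc n * a x + real (Suc n) * m ^ n * (a x * g x - m * a x))
        = m ^ Suc n * ?A"
      using a g I by simp
    finally have "?A ^ n * (m ^ Suc n * ?A) \<le> ?A ^ n * (LINT x|M. a x * g x ^ Suc n)"
      using A by (intro mult_left_mono) auto
    then show ?thesis unfolding I by (simp add: power_mult_distrib mult_ac)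
  qed
qed

text \<open>
  Bounded paths make each path integrable against an integrable weight, so that time integrals can be
  differentiated for every outcome and not just almost surely. Having all moments, rather than one
  fixed exponent, makes the class closed under products. The time axis is the whole line so that
  no horizon has to be carried along; processes are set to \<open>0\<close> outside their horizon.
\<close>

definition moment_process :: "'a measure \<Rightarrow> (real \<Rightarrow> 'a \<Rightarrow> real) \<Rightarrow> bool" where
  "moment_process P G \<longleftrightarrow>
     case_prod G \<in> borel_measurable (borel \<Otimes>\<^sub>M P) \<and>
     (\<forall>\<omega>\<in>space P. \<exists>C. \<forall>s. \<bar>G s \<omega>\<bar> \<le> C) \<and>
     (\<forall>k::nat. \<exists>C::real. \<forall>s. (\<integral>\<^sup>+\<omega>. ennreal (\<bar>G s \<omega>\<bar> ^ k) \<partial>P) \<le> ennreal C)"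

lemma moment_processD:
  assumes "moment_process P G"
  shows "case_prod G \<in> borel_measurable (borel \<Otimes>\<^sub>M P)"
    and "\<omega> \<in> space P \<Longrightarrow> \<exists>C. \<forall>s. \<bar>G s \<omega>\<bar> \<le> C"
    and "\<exists>C::real. \<forall>s. (\<integral>\<^sup>+\<omega>. ennreal (\<bar>G s \<omega>\<bar> ^ k) \<partial>P) \<le> ennreal C"
  using assms by (auto simp: moment_process_def)

lemma moment_process_measurable_section:
  assumes "moment_process P G"
  shows "G s \<in> borel_measurable P"
  using measurable_Pair2[OF moment_processD(1)[OF assms], of s] by simp

lemma measurable_path:
  assumes "case_prod G \<in> borel_measurable (borel \<Otimes>\<^sub>M P)" "\<omega> \<in> space P"
  shows "(\<lambda>s. G s \<omega>) \<in> borel_measurable borel"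
  using measurable_Pair1[OF assms] by simp

lemma moment_process_dominated:
  assumes G: "moment_process P G"
    and U: "case_prod U \<in> borel_measurable (borel \<Otimes>\<^sub>M P)"
    and le: "\<And>s \<omega>. \<omega> \<in> space P \<Longrightarrow> \<bar>U s \<omega>\<bar> \<le> G s \<omega>"
  shows "moment_process P U"
  unfolding moment_process_def
proof (intro conjI ballI allI)
  fix \<omega> assume w: "\<omega> \<in> space P"
  obtain C where "\<And>s. \<bar>G s \<omega>\<bar> \<le> C" using moment_processD(2)[OF G w] by auto
  then have "\<forall>s. \<bar>U s \<omega>\<bar> \<le> C" using le[OF w] by (meson abs_ge_self order_trans)
  then show "\<exists>C. \<forall>s. \<bar>U s \<omega>\<bar> \<le> C" ..
next
  fix k :: nat
  obtain C :: real where C: "\<And>s. (\<integral>\<^sup>+\<omega>. ennreal (\<bar>G s \<omega>\<bar> ^ k) \<partial>P) \<le> ennreal C"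
    using moment_processD(3)[OF G] by blast
  have "(\<integral>\<^sup>+\<omega>. ennreal (\<bar>U s \<omega>\<bar> ^ k) \<partial>P) \<le> ennreal C" for s
  proof -
    have "(\<integral>\<^sup>+\<omega>. ennreal (\<bar>U s \<omega>\<bar> ^ k) \<partial>P) \<le> (\<integral>\<^sup>+\<omega>. ennreal (\<bar>G s \<omega>\<bar> ^ k) \<partial>P)"
      using le by (intro nn_integral_mono ennreal_leI power_mono) (auto intro: order_trans[OF _ abs_ge_self])
    then show ?thesis using C by (rule order_trans)
  qed
  then show "\<exists>C::real. \<forall>s. (\<integral>\<^sup>+\<omega>. ennreal (\<bar>U s \<omega>\<bar> ^ k) \<partial>P) \<le> ennreal C" by blast
qed (rule U)

lemma moment_process_by_moments:
  assumes "case_prod U \<in> borel_measurable (borel \<Otimes>\<^sub>M P)"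
    and "\<And>\<omega>. \<omega> \<in> space P \<Longrightarrow> \<exists>C. \<forall>s. \<bar>U s \<omega>\<bar> \<le> C"
    and "\<And>k. \<exists>C::real. \<forall>s. (\<integral>\<^sup>+\<omega>. ennreal (\<bar>U s \<omega>\<bar> ^ k) \<partial>P) \<le> ennreal C"
  shows "moment_process P U"
  using assms by (auto simp: moment_process_def)

lemma (in prob_space) moment_process_const: "moment_process M (\<lambda>s \<omega>. C)"
proof (rule moment_process_by_moments)
  show "\<exists>K::real. \<forall>s::real. (\<integral>\<^sup>+\<omega>. ennreal (\<bar>C\<bar> ^ k) \<partial>M) \<le> ennreal K" for k
    by (intro exI[of _ "\<bar>C\<bar> ^ k"]) (simp add: emeasure_space_1)
qed auto

lemma moment_process_add:
  assumes G: "moment_process P G" and K: "moment_process P K"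
  shows "moment_process P (\<lambda>s \<omega>. G s \<omega> + K s \<omega>)"
proof (rule moment_process_by_moments)
  note [measurable] = moment_processD(1)[OF G] moment_processD(1)[OF K]
    moment_process_measurable_section[OF G] moment_process_measurable_section[OF K]
  show "(\<lambda>(s, \<omega>). G s \<omega> + K s \<omega>) \<in> borel_measurable (borel \<Otimes>\<^sub>M P)" by measurable
  show "\<exists>C. \<forall>s. \<bar>G s \<omega> + K s \<omega>\<bar> \<le> C" if w: "\<omega> \<in> space P" for \<omega>
  proof -
    obtain C D where "\<And>s. \<bar>G s \<omega>\<bar> \<le> C" "\<And>s. \<bar>K s \<omega>\<bar> \<le> D"
      using moment_processD(2)[OF G w] moment_processD(2)[OF K w] by auto
    then have "\<forall>s. \<bar>G s \<omega> + K s \<omega>\<bar> \<le> C + D" by (meson abs_triangle_ineq add_mono order_trans)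
    then show ?thesis ..
  qed
  fix k
  obtain C D :: real where C: "\<And>s. (\<integral>\<^sup>+\<omega>. ennreal (\<bar>G s \<omega>\<bar> ^ k) \<partial>P) \<le> ennreal C"
    and D: "\<And>s. (\<integral>\<^sup>+\<omega>. ennreal (\<bar>K s \<omega>\<bar> ^ k) \<partial>P) \<le> ennreal D"
    using moment_processD(3)[OF G] moment_processD(3)[OF K] by metis
  have pw: "\<bar>x + y\<bar> ^ k \<le> 2 ^ k * (\<bar>x\<bar> ^ k + \<bar>y\<bar> ^ k)" for x y :: real
  proof -
    have "\<bar>x + y\<bar> ^ k \<le> (2 * max \<bar>x\<bar> \<bar>y\<bar>) ^ k" by (intro power_mono) auto
    also have "\<dots> = 2 ^ k * max \<bar>x\<bar> \<bar>y\<bar> ^ k" by (simp add: power_mult_distrib)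
    also have "\<dots> \<le> 2 ^ k * (\<bar>x\<bar> ^ k + \<bar>y\<bar> ^ k)"
      by (intro mult_left_mono) (auto simp: max_def)
    finally show ?thesis .
  qed
  have "(\<integral>\<^sup>+\<omega>. ennreal (\<bar>G s \<omega> + K s \<omega>\<bar> ^ k) \<partial>P) \<le> ennreal (2 ^ k * (max 0 C + max 0 D))" for s
  proof -
    have "(\<integral>\<^sup>+\<omega>. ennreal (\<bar>G s \<omega> + K s \<omega>\<bar> ^ k) \<partial>P)
        \<le> (\<integral>\<^sup>+\<omega>. ennreal (2 ^ k) * (ennreal (\<bar>G s \<omega>\<bar> ^ k) + ennreal (\<bar>K s \<omega>\<bar> ^ k)) \<partial>P)"
      using pw by (intro nn_integral_mono)
        (auto simp: ennreal_plus[symmetric] ennreal_mult[symmetric] simp del: ennreal_plus)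
    also have "\<dots> = ennreal (2 ^ k) * ((\<integral>\<^sup>+\<omega>. ennreal (\<bar>G s \<omega>\<bar> ^ k) \<partial>P) + (\<integral>\<^sup>+\<omega>. ennreal (\<bar>K s \<omega>\<bar> ^ k) \<partial>P))"
      by (simp add: nn_integral_cmult nn_integral_add)
    also have "\<dots> \<le> ennreal (2 ^ k) * (ennreal (max 0 C) + ennreal (max 0 D))"
      using C[of s] D[of s] by (intro mult_left_mono add_mono) (auto simp: ennreal_max_0)
    also have "\<dots> = ennreal (2 ^ k * (max 0 C + max 0 D))"
      by (simp add: ennreal_mult)
    finally show ?thesis .
  qed
  then show "\<exists>C::real. \<forall>s. (\<integral>\<^sup>+\<omega>. ennreal (\<bar>G s \<omega> + K s \<omega>\<bar> ^ k) \<partial>P) \<le> ennreal C" by blast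
qed

lemma moment_process_mult:
  assumes G: "moment_process P G" and K: "moment_process P K"
  shows "moment_process P (\<lambda>s \<omega>. G s \<omega> * K s \<omega>)"
proof (rule moment_process_by_moments)
  note [measurable] = moment_processD(1)[OF G] moment_processD(1)[OF K]
    moment_process_measurable_section[OF G] moment_process_measurable_section[OF K]
  show "(\<lambda>(s, \<omega>). G s \<omega> * K s \<omega>) \<in> borel_measurable (borel \<Otimes>\<^sub>M P)" by measurable
  show "\<exists>C. \<forall>s. \<bar>G s \<omega> * K s \<omega>\<bar> \<le> C" if w: "\<omega> \<in> space P" for \<omega>
  proof -
    obtain C D where CD: "\<And>s. \<bar>G s \<omega>\<bar> \<le> C" "\<And>s. \<bar>K s \<omega>\<bar> \<le> D"
      using moment_processD(2)[OF G w] moment_processD(2)[OF K w] by auto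
    have "0 \<le> C" using CD(1)[of 0] by linarith
    then have "\<forall>s. \<bar>G s \<omega> * K s \<omega>\<bar> \<le> C * D" using CD by (auto simp: abs_mult intro!: mult_mono)
    then show ?thesis ..
  qed
  fix k
  obtain C D :: real where C: "\<And>s. (\<integral>\<^sup>+\<omega>. ennreal (\<bar>G s \<omega>\<bar> ^ (k * 2)) \<partial>P) \<le> ennreal C"
    and D: "\<And>s. (\<integral>\<^sup>+\<omega>. ennreal (\<bar>K s \<omega>\<bar> ^ (k * 2)) \<partial>P) \<le> ennreal D"
    using moment_processD(3)[OF G] moment_processD(3)[OF K] by metis
  have pw: "\<bar>x * y\<bar> ^ k \<le> \<bar>x\<bar> ^ (k * 2) + \<bar>y\<bar> ^ (k * 2)" for x y :: real
  proof -
    have "2 * (\<bar>x\<bar> ^ k * \<bar>y\<bar> ^ k) \<le> (\<bar>x\<bar> ^ k)\<^sup>2 + (\<bar>y\<bar> ^ k)\<^sup>2"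
      using sum_squares_bound[of "\<bar>x\<bar> ^ k" "\<bar>y\<bar> ^ k"] by simp
    moreover have "0 \<le> \<bar>x\<bar> ^ k * \<bar>y\<bar> ^ k" by simp
    ultimately show ?thesis unfolding abs_mult power_mult_distrib power_mult by linarith
  qed
  have "(\<integral>\<^sup>+\<omega>. ennreal (\<bar>G s \<omega> * K s \<omega>\<bar> ^ k) \<partial>P) \<le> ennreal (max 0 C + max 0 D)" for s
  proof -
    have "(\<integral>\<^sup>+\<omega>. ennreal (\<bar>G s \<omega> * K s \<omega>\<bar> ^ k) \<partial>P)
        \<le> (\<integral>\<^sup>+\<omega>. ennreal (\<bar>G s \<omega>\<bar> ^ (k * 2)) + ennreal (\<bar>K s \<omega>\<bar> ^ (k * 2)) \<partial>P)"
      using pw by (intro nn_integral_mono) (auto simp: ennreal_plus[symmetric] simp del: ennreal_plus)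
    also have "\<dots> = (\<integral>\<^sup>+\<omega>. ennreal (\<bar>G s \<omega>\<bar> ^ (k * 2)) \<partial>P) + (\<integral>\<^sup>+\<omega>. ennreal (\<bar>K s \<omega>\<bar> ^ (k * 2)) \<partial>P)"
      by (simp add: nn_integral_add)
    also have "\<dots> \<le> ennreal (max 0 C) + ennreal (max 0 D)"
      using C[of s] D[of s] by (intro add_mono) (auto simp: ennreal_max_0)
    also have "\<dots> = ennreal (max 0 C + max 0 D)" by simp
    finally show ?thesis .
  qed
  then show "\<exists>C::real. \<forall>s. (\<integral>\<^sup>+\<omega>. ennreal (\<bar>G s \<omega> * K s \<omega>\<bar> ^ k) \<partial>P) \<le> ennreal C" by blast
qed

lemma moment_process_abs:
  assumes G: "moment_process P G"
  shows "moment_process P (\<lambda>s \<omega>. \<bar>G s \<omega>\<bar>)"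
proof -
  note [measurable] = moment_processD(1)[OF G]
  have "(\<lambda>(s, \<omega>). \<bar>G s \<omega>\<bar>) \<in> borel_measurable (borel \<Otimes>\<^sub>M P)" by measurable
  then show ?thesis using G by (auto simp: moment_process_def)
qed

text \<open>
  By Jensen's inequality the power of the time integral is at most a multiple of the time integral of
  the power, and Tonelli's theorem brings in the moments of \<open>G\<close> at fixed times.
\<close>

lemma (in prob_space) moment_process_time_integral:
  fixes a :: "real \<Rightarrow> real"
  assumes a: "integrable lborel a" and G: "moment_process M G"
  shows "moment_process M (\<lambda>s \<omega>. LINT r|lborel. \<bar>a r\<bar> * \<bar>G r \<omega>\<bar>)"
proof (rule moment_process_by_moments)
  interpret pair_sigma_finite lborel M ..
  note [measurable] = moment_processD(1)[OF G] borel_measurable_integrable[OF a, simplified]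
  show "(\<lambda>(s::real, \<omega>). LINT r|lborel. \<bar>a r\<bar> * \<bar>G r \<omega>\<bar>) \<in> borel_measurable (borel \<Otimes>\<^sub>M M)"
    by measurable
  have meas: "(\<lambda>\<omega>. LINT r|lborel. \<bar>a r\<bar> * \<bar>G r \<omega>\<bar>) \<in> borel_measurable M" by measurable
  show "\<exists>C. \<forall>s::real. \<bar>LINT r|lborel. \<bar>a r\<bar> * \<bar>G r \<omega>\<bar>\<bar> \<le> C" for \<omega> by blast
  have int: "integrable lborel (\<lambda>r. \<bar>a r\<bar> * \<bar>G r \<omega>\<bar> ^ k)" if w: "\<omega> \<in> space M" for \<omega> k
  proof -
    obtain C where C: "\<And>s. \<bar>G s \<omega>\<bar> \<le> C" using moment_processD(2)[OF G w] by auto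
    have [measurable]: "(\<lambda>s. G s \<omega>) \<in> borel_measurable borel"
      using measurable_path[OF moment_processD(1)[OF G] w] .
    show ?thesis
    proof (rule Bochner_Integration.integrable_bound[of _ "\<lambda>r. \<bar>a r\<bar> * C ^ k"])
      show "integrable lborel (\<lambda>r. \<bar>a r\<bar> * C ^ k)" using a by auto
      have "\<bar>G r \<omega>\<bar> ^ k \<le> C ^ k" for r using C[of r] by (intro power_mono) auto
      moreover have "0 \<le> C" using C[of 0] by linarith
      ultimately show "AE r in lborel. norm (\<bar>a r\<bar> * \<bar>G r \<omega>\<bar> ^ k) \<le> norm (\<bar>a r\<bar> * C ^ k)"
        by (intro AE_I2) (auto simp: abs_mult power_abs intro!: mult_left_mono)
    qed measurable
  qed
  fix k
  show "\<exists>C::real. \<forall>s::real. (\<integral>\<^sup>+\<omega>. ennreal (\<bar>LINT r|lborel. \<bar>a r\<bar> * \<bar>G r \<omega>\<bar>\<bar> ^ k) \<partial>M) \<le> ennreal C"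
  proof (cases k)
    case 0
    then show ?thesis by (intro exI[of _ 1]) (simp add: emeasure_space_1)
  next
    case (Suc n)
    let ?A = "LINT r|lborel. \<bar>a r\<bar>"
    have A: "0 \<le> ?A" by simp
    obtain C :: real where C: "\<And>s. (\<integral>\<^sup>+\<omega>. ennreal (\<bar>G s \<omega>\<bar> ^ k) \<partial>M) \<le> ennreal C"
      using moment_processD(3)[OF G] by blast
    have "(\<integral>\<^sup>+\<omega>. ennreal (\<bar>LINT r|lborel. \<bar>a r\<bar> * \<bar>G r \<omega>\<bar>\<bar> ^ k) \<partial>M)
        \<le> (\<integral>\<^sup>+\<omega>. ennreal (?A ^ n) * (\<integral>\<^sup>+r. ennreal \<bar>a r\<bar> * ennreal (\<bar>G r \<omega>\<bar> ^ k) \<partial>lborel) \<partial>M)"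
    proof (rule nn_integral_mono)
      fix \<omega> assume w: "\<omega> \<in> space M"
      have le: "(LINT r|lborel. \<bar>a r\<bar> * \<bar>G r \<omega>\<bar>) ^ k \<le> ?A ^ n * (LINT r|lborel. \<bar>a r\<bar> * \<bar>G r \<omega>\<bar> ^ k)"
        unfolding Suc using a int[OF w, of 1] int[OF w, of k] Suc by (intro power_integral_le) auto
      have "ennreal (\<bar>LINT r|lborel. \<bar>a r\<bar> * \<bar>G r \<omega>\<bar>\<bar> ^ k)
          = ennreal ((LINT r|lborel. \<bar>a r\<bar> * \<bar>G r \<omega>\<bar>) ^ k)" by simp
      also have "\<dots> \<le> ennreal (?A ^ n * (LINT r|lborel. \<bar>a r\<bar> * \<bar>G r \<omega>\<bar> ^ k))"
        by (rule ennreal_leI[OF le])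
      also have "\<dots> = ennreal (?A ^ n) * ennreal (LINT r|lborel. \<bar>a r\<bar> * \<bar>G r \<omega>\<bar> ^ k)"
        by (rule ennreal_mult') (rule zero_le_power[OF A])
      also have "ennreal (LINT r|lborel. \<bar>a r\<bar> * \<bar>G r \<omega>\<bar> ^ k)
          = (\<integral>\<^sup>+r. ennreal \<bar>a r\<bar> * ennreal (\<bar>G r \<omega>\<bar> ^ k) \<partial>lborel)"
        using int[OF w, of k] by (subst nn_integral_eq_integral[symmetric]) (auto simp: ennreal_mult)
      finally show "ennreal (\<bar>LINT r|lborel. \<bar>a r\<bar> * \<bar>G r \<omega>\<bar>\<bar> ^ k)
          \<le> ennreal (?A ^ n) * (\<integral>\<^sup>+r. ennreal \<bar>a r\<bar> * ennreal (\<bar>G r \<omega>\<bar> ^ k) \<partial>lborel)" .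
    qed
    also have "\<dots> = ennreal (?A ^ n) * (\<integral>\<^sup>+\<omega>. (\<integral>\<^sup>+r. ennreal \<bar>a r\<bar> * ennreal (\<bar>G r \<omega>\<bar> ^ k) \<partial>lborel) \<partial>M)"
      by (intro nn_integral_cmult) measurable
    also have "(\<integral>\<^sup>+\<omega>. (\<integral>\<^sup>+r. ennreal \<bar>a r\<bar> * ennreal (\<bar>G r \<omega>\<bar> ^ k) \<partial>lborel) \<partial>M)
        = (\<integral>\<^sup>+r. (\<integral>\<^sup>+\<omega>. ennreal \<bar>a r\<bar> * ennreal (\<bar>G r \<omega>\<bar> ^ k) \<partial>M) \<partial>lborel)"
      by (rule Fubini') measurable
    also have "\<dots> = (\<integral>\<^sup>+r. ennreal \<bar>a r\<bar> * (\<integral>\<^sup>+\<omega>. ennreal (\<bar>G r \<omega>\<bar> ^ k) \<partial>M) \<partial>lborel)"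
      using moment_process_measurable_section[OF G] by (simp add: nn_integral_cmult)
    also have "\<dots> \<le> (\<integral>\<^sup>+r. ennreal \<bar>a r\<bar> * ennreal (max 0 C) \<partial>lborel)"
      using C by (intro nn_integral_mono mult_left_mono) (auto simp: ennreal_max_0)
    also have "\<dots> = ennreal (?A * max 0 C)"
      using a by (simp add: nn_integral_multc nn_integral_eq_integral ennreal_mult)
    finally have "(\<integral>\<^sup>+\<omega>. ennreal (\<bar>LINT r|lborel. \<bar>a r\<bar> * \<bar>G r \<omega>\<bar>\<bar> ^ k) \<partial>M)
        \<le> ennreal (?A ^ n) * ennreal (?A * max 0 C)" by (simp add: mult_left_mono)
    also have "\<dots> = ennreal (?A ^ n * (?A * max 0 C))" using A by (simp add: ennreal_mult)
    finally show ?thesis by blast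
  qed
qed

section \<open>Families of processes that are smooth in a parameter\<close>

text \<open>
  One dominating process serves a whole bounded range of the parameter: this is what dominated
  convergence asks for when difference quotients in the parameter are taken.
\<close>

definition locally_dominated :: "'a measure \<Rightarrow> (real \<Rightarrow> real \<Rightarrow> 'a \<Rightarrow> real) \<Rightarrow> bool" where
  "locally_dominated P U \<longleftrightarrow>
     (\<forall>\<epsilon>. case_prod (U \<epsilon>) \<in> borel_measurable (borel \<Otimes>\<^sub>M P)) \<and>
     (\<forall>R. \<exists>G. moment_process P G \<and>
        (\<forall>\<epsilon> s. \<forall>\<omega>\<in>space P. \<bar>\<epsilon>\<bar> \<le> R \<longrightarrow> \<bar>U \<epsilon> s \<omega>\<bar> \<le> G s \<omega>))"

text \<open>
  Recursion through a derivative that is again in the class, instead of conditions on iterated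
  derivatives: every closure property becomes an induction over the order in which the derivative is
  taken only once.
\<close>

primrec smooth_upto :: "'a measure \<Rightarrow> nat \<Rightarrow> (real \<Rightarrow> real \<Rightarrow> 'a \<Rightarrow> real) \<Rightarrow> bool" where
  "smooth_upto P 0 U = locally_dominated P U"
| "smooth_upto P (Suc n) U =
     (locally_dominated P U \<and>
      (\<exists>V. (\<forall>\<epsilon> s. \<forall>\<omega>\<in>space P. ((\<lambda>\<epsilon>. U \<epsilon> s \<omega>) has_real_derivative V \<epsilon> s \<omega>) (at \<epsilon>)) \<and>
           smooth_upto P n V))"

lemma smooth_upto_locally_dominated: "smooth_upto P n U \<Longrightarrow> locally_dominated P U"
  by (cases n) auto

lemma smooth_upto_SucD: "smooth_upto P (Suc n) U \<Longrightarrow> smooth_upto P n U"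
proof (induction n arbitrary: U)
  case (Suc n)
  obtain V where "\<forall>\<epsilon> s. \<forall>\<omega>\<in>space P. ((\<lambda>\<epsilon>. U \<epsilon> s \<omega>) has_real_derivative V \<epsilon> s \<omega>) (at \<epsilon>)"
    and "smooth_upto P (Suc n) V"
    using Suc.prems by (subst (asm) smooth_upto.simps(2)) blast
  with Suc.IH[of V] Suc.prems show ?case by auto
qed simp

lemma locally_dominatedD:
  assumes "locally_dominated P U"
  shows "case_prod (U \<epsilon>) \<in> borel_measurable (borel \<Otimes>\<^sub>M P)"
    and "\<exists>G. moment_process P G \<and> (\<forall>\<epsilon> s. \<forall>\<omega>\<in>space P. \<bar>\<epsilon>\<bar> \<le> R \<longrightarrow> \<bar>U \<epsilon> s \<omega>\<bar> \<le> G s \<omega>)"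
  using assms by (auto simp: locally_dominated_def)

lemma locally_dominated_cong:
  assumes U: "locally_dominated P U"
    and eq: "\<And>\<epsilon> s \<omega>. \<omega> \<in> space P \<Longrightarrow> U \<epsilon> s \<omega> = U' \<epsilon> s \<omega>"
  shows "locally_dominated P U'"
proof -
  have "case_prod (U' \<epsilon>) \<in> borel_measurable (borel \<Otimes>\<^sub>M P)" for \<epsilon>
    using locally_dominatedD(1)[OF U, of \<epsilon>]
    by (rule measurable_cong[THEN iffD1, rotated]) (auto simp: space_pair_measure eq)
  with U show ?thesis unfolding locally_dominated_def by (auto simp: eq[symmetric])
qed

lemma smooth_upto_cong:
  assumes "smooth_upto P n U" and "\<And>\<epsilon> s \<omega>. \<omega> \<in> space P \<Longrightarrow> U \<epsilon> s \<omega> = U' \<epsilon> s \<omega>"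
  shows "smooth_upto P n U'"
  using assms(1)
proof (cases n)
  case 0
  with assms locally_dominated_cong show ?thesis by (metis smooth_upto.simps(1))
next
  case (Suc m)
  have fn: "(\<lambda>\<epsilon>. U \<epsilon> s \<omega>) = (\<lambda>\<epsilon>. U' \<epsilon> s \<omega>)" if "\<omega> \<in> space P" for s \<omega>
    using assms(2)[OF that] by auto
  from assms(1) Suc show ?thesis
    by (auto simp: fn intro: locally_dominated_cong[OF _ assms(2)])
qed

lemma smooth_uptoI:
  assumes "locally_dominated P U"
    and "\<And>m. n = Suc m \<Longrightarrow> \<exists>V. (\<forall>\<epsilon> s. \<forall>\<omega>\<in>space P. ((\<lambda>\<epsilon>. U \<epsilon> s \<omega>) has_real_derivative V \<epsilon> s \<omega>) (at \<epsilon>)) \<and>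
           smooth_upto P m V"
  shows "smooth_upto P n U"
  using assms by (cases n) auto

context prob_space
begin

lemma smooth_upto_moment_process:
  "moment_process M G \<Longrightarrow> smooth_upto M n (\<lambda>\<epsilon>. G)"
proof (induction n arbitrary: G)
  have ld: "locally_dominated M (\<lambda>\<epsilon>. G)" if "moment_process M G" for G
    unfolding locally_dominated_def
    using moment_process_abs[OF that] moment_processD(1)[OF that] by (blast intro: order_refl)
  {
    case 0
    then show ?case using ld by simp
  next
    case (Suc n)
    have "smooth_upto M n (\<lambda>\<epsilon> s \<omega>. 0)"
      using Suc.IH[OF moment_process_const[of 0]] .
    then show ?case using ld[OF Suc.prems] by (auto intro!: exI[of _ "\<lambda>_ _ _. 0"])
  }
qed

lemma smooth_upto_const: "smooth_upto M n (\<lambda>\<epsilon> s \<omega>. C)"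
  by (rule smooth_upto_moment_process[OF moment_process_const])

lemma smooth_upto_parameter: "smooth_upto M n (\<lambda>\<epsilon> s \<omega>. \<epsilon>)"
proof (rule smooth_uptoI)
  have "\<exists>G. moment_process M G \<and> (\<forall>\<epsilon> s. \<forall>\<omega>\<in>space M. \<bar>\<epsilon>\<bar> \<le> R \<longrightarrow> \<bar>\<epsilon>\<bar> \<le> G s \<omega>)" for R
    by (rule exI[of _ "\<lambda>_ _. R"]) (auto intro: moment_process_const)
  then show "locally_dominated M (\<lambda>\<epsilon> s \<omega>. \<epsilon>)" by (auto simp: locally_dominated_def)
  show "\<exists>V. (\<forall>\<epsilon> s::real. \<forall>\<omega>\<in>space M. ((\<lambda>\<epsilon>. \<epsilon>) has_real_derivative V \<epsilon> s \<omega>) (at \<epsilon>)) \<and>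
           smooth_upto M m V" for m
    by (intro exI[of _ "\<lambda>_ _ _. 1"]) (auto intro: smooth_upto_const)
qed

lemma locally_dominated_add:
  assumes U: "locally_dominated M U" and V: "locally_dominated M V"
  shows "locally_dominated M (\<lambda>\<epsilon> s \<omega>. U \<epsilon> s \<omega> + V \<epsilon> s \<omega>)"
  unfolding locally_dominated_def
proof (intro conjI allI)
  note [measurable] = locally_dominatedD(1)[OF U] locally_dominatedD(1)[OF V]
  show "(\<lambda>(s, \<omega>). U \<epsilon> s \<omega> + V \<epsilon> s \<omega>) \<in> borel_measurable (borel \<Otimes>\<^sub>M M)" for \<epsilon> by measurable
  fix R
  obtain G K where G: "moment_process M G" "\<forall>\<epsilon> s. \<forall>\<omega>\<in>space M. \<bar>\<epsilon>\<bar> \<le> R \<longrightarrow> \<bar>U \<epsilon> s \<omega>\<bar> \<le> G s \<omega>"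
    and K: "moment_process M K" "\<forall>\<epsilon> s. \<forall>\<omega>\<in>space M. \<bar>\<epsilon>\<bar> \<le> R \<longrightarrow> \<bar>V \<epsilon> s \<omega>\<bar> \<le> K s \<omega>"
    using locally_dominatedD(2)[OF U] locally_dominatedD(2)[OF V] by metis
  show "\<exists>G. moment_process M G \<and>
      (\<forall>\<epsilon> s. \<forall>\<omega>\<in>space M. \<bar>\<epsilon>\<bar> \<le> R \<longrightarrow> \<bar>U \<epsilon> s \<omega> + V \<epsilon> s \<omega>\<bar> \<le> G s \<omega>)"
  proof (intro exI[of _ "\<lambda>s \<omega>. G s \<omega> + K s \<omega>"] conjI allI ballI impI)
    show "moment_process M (\<lambda>s \<omega>. G s \<omega> + K s \<omega>)" by (rule moment_process_add[OF G(1) K(1)])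
    show "\<bar>U \<epsilon> s \<omega> + V \<epsilon> s \<omega>\<bar> \<le> G s \<omega> + K s \<omega>" if "\<omega> \<in> space M" "\<bar>\<epsilon>\<bar> \<le> R" for \<epsilon> s \<omega>
      using G(2) K(2) that by (meson abs_triangle_ineq add_mono order_trans)
  qed
qed

lemma locally_dominated_mult:
  assumes U: "locally_dominated M U" and V: "locally_dominated M V"
  shows "locally_dominated M (\<lambda>\<epsilon> s \<omega>. U \<epsilon> s \<omega> * V \<epsilon> s \<omega>)"
  unfolding locally_dominated_def
proof (intro conjI allI)
  note [measurable] = locally_dominatedD(1)[OF U] locally_dominatedD(1)[OF V]
  show "(\<lambda>(s, \<omega>). U \<epsilon> s \<omega> * V \<epsilon> s \<omega>) \<in> borel_measurable (borel \<Otimes>\<^sub>M M)" for \<epsilon> by measurable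
  fix R
  obtain G K where G: "moment_process M G" "\<forall>\<epsilon> s. \<forall>\<omega>\<in>space M. \<bar>\<epsilon>\<bar> \<le> R \<longrightarrow> \<bar>U \<epsilon> s \<omega>\<bar> \<le> G s \<omega>"
    and K: "moment_process M K" "\<forall>\<epsilon> s. \<forall>\<omega>\<in>space M. \<bar>\<epsilon>\<bar> \<le> R \<longrightarrow> \<bar>V \<epsilon> s \<omega>\<bar> \<le> K s \<omega>"
    using locally_dominatedD(2)[OF U] locally_dominatedD(2)[OF V] by metis
  show "\<exists>G. moment_process M G \<and>
      (\<forall>\<epsilon> s. \<forall>\<omega>\<in>space M. \<bar>\<epsilon>\<bar> \<le> R \<longrightarrow> \<bar>U \<epsilon> s \<omega> * V \<epsilon> s \<omega>\<bar> \<le> G s \<omega>)"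
  proof (intro exI[of _ "\<lambda>s \<omega>. G s \<omega> * K s \<omega>"] conjI allI ballI impI)
    show "moment_process M (\<lambda>s \<omega>. G s \<omega> * K s \<omega>)" by (rule moment_process_mult[OF G(1) K(1)])
    show "\<bar>U \<epsilon> s \<omega> * V \<epsilon> s \<omega>\<bar> \<le> G s \<omega> * K s \<omega>" if "\<omega> \<in> space M" "\<bar>\<epsilon>\<bar> \<le> R" for \<epsilon> s \<omega>
    proof -
      have "\<bar>U \<epsilon> s \<omega>\<bar> \<le> G s \<omega>" "\<bar>V \<epsilon> s \<omega>\<bar> \<le> K s \<omega>" using G(2) K(2) that by auto
      then show ?thesis unfolding abs_mult by (intro mult_mono) auto
    qed
  qed
qed

lemma smooth_upto_add:
  "smooth_upto M n U \<Longrightarrow> smooth_upto M n V \<Longrightarrow> smooth_upto M n (\<lambda>\<epsilon> s \<omega>. U \<epsilon> s \<omega> + V \<epsilon> s \<omega>)"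
proof (induction n arbitrary: U V)
  case (Suc n)
  obtain U' where d1: "\<forall>\<epsilon> s. \<forall>\<omega>\<in>space M. ((\<lambda>\<epsilon>. U \<epsilon> s \<omega>) has_real_derivative U' \<epsilon> s \<omega>) (at \<epsilon>)"
    and U': "smooth_upto M n U'" using Suc.prems(1) unfolding smooth_upto.simps by blast
  obtain V' where d2: "\<forall>\<epsilon> s. \<forall>\<omega>\<in>space M. ((\<lambda>\<epsilon>. V \<epsilon> s \<omega>) has_real_derivative V' \<epsilon> s \<omega>) (at \<epsilon>)"
    and V': "smooth_upto M n V'" using Suc.prems(2) unfolding smooth_upto.simps by blast
  note d = d1[rule_format] d2[rule_format] and s = U' V'
  show ?case unfolding smooth_upto.simps
  proof (intro conjI exI[of _ "\<lambda>\<epsilon> s \<omega>. U' \<epsilon> s \<omega> + V' \<epsilon> s \<omega>"] allI ballI)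
    show "smooth_upto M n (\<lambda>\<epsilon> s \<omega>. U' \<epsilon> s \<omega> + V' \<epsilon> s \<omega>)" by (rule Suc.IH[OF s])
  qed (use d Suc.prems smooth_upto_locally_dominated in \<open>auto intro!: DERIV_add locally_dominated_add\<close>)
qed (simp add: locally_dominated_add)

lemma smooth_upto_mult:
  "smooth_upto M n U \<Longrightarrow> smooth_upto M n V \<Longrightarrow> smooth_upto M n (\<lambda>\<epsilon> s \<omega>. U \<epsilon> s \<omega> * V \<epsilon> s \<omega>)"
proof (induction n arbitrary: U V)
  case (Suc n)
  obtain U' where d1: "\<forall>\<epsilon> s. \<forall>\<omega>\<in>space M. ((\<lambda>\<epsilon>. U \<epsilon> s \<omega>) has_real_derivative U' \<epsilon> s \<omega>) (at \<epsilon>)"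
    and U': "smooth_upto M n U'" using Suc.prems(1) unfolding smooth_upto.simps by blast
  obtain V' where d2: "\<forall>\<epsilon> s. \<forall>\<omega>\<in>space M. ((\<lambda>\<epsilon>. V \<epsilon> s \<omega>) has_real_derivative V' \<epsilon> s \<omega>) (at \<epsilon>)"
    and V': "smooth_upto M n V'" using Suc.prems(2) unfolding smooth_upto.simps by blast
  note d = d1[rule_format] d2[rule_format] and s = U' V'
  show ?case unfolding smooth_upto.simps
  proof (intro conjI exI[of _ "\<lambda>\<epsilon> s \<omega>. U' \<epsilon> s \<omega> * V \<epsilon> s \<omega> + V' \<epsilon> s \<omega> * U \<epsilon> s \<omega>"] allI ballI)
    show "smooth_upto M n (\<lambda>\<epsilon> s \<omega>. U' \<epsilon> s \<omega> * V \<epsilon> s \<omega> + V' \<epsilon> s \<omega> * U \<epsilon> s \<omega>)"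
      using Suc s by (intro smooth_upto_add Suc.IH) (auto dest!: smooth_upto_SucD simp del: smooth_upto.simps)
  qed (use d Suc.prems smooth_upto_locally_dominated in \<open>auto intro!: DERIV_mult locally_dominated_mult\<close>)
qed (simp add: locally_dominated_mult)

lemma smooth_upto_sum:
  assumes "\<And>x. x \<in> A \<Longrightarrow> smooth_upto M n (U x)"
  shows "smooth_upto M n (\<lambda>\<epsilon> s \<omega>. \<Sum>x\<in>A. U x \<epsilon> s \<omega>)"
proof (cases "finite A")
  case True
  then show ?thesis using assms
    by (induction A) (auto intro!: smooth_upto_add smooth_upto_const simp del: smooth_upto.simps)
qed (simp add: smooth_upto_const)

lemma smooth_upto_prod:
  assumes "\<And>x. x \<in> A \<Longrightarrow> smooth_upto M n (U x)"
  shows "smooth_upto M n (\<lambda>\<epsilon> s \<omega>. \<Prod>x\<in>A. U x \<epsilon> s \<omega>)"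
proof (cases "finite A")
  case True
  then show ?thesis using assms
    by (induction A) (auto intro!: smooth_upto_mult smooth_upto_const simp del: smooth_upto.simps)
qed (simp add: smooth_upto_const)

text \<open>
  Since \<open>w' = w (1 - w)\<close> for the logistic function, the derivative of \<open>w \<circ> U\<close> is a product of \<open>w \<circ> U\<close>,
  \<open>1 - w \<circ> U\<close> and \<open>U'\<close>, each of which is smooth to the lower order by induction. No formula for the
  higher derivatives of a composition is involved.
\<close>

lemma smooth_upto_logistic:
  assumes a: "0 < a"
  shows "smooth_upto M n U \<Longrightarrow>
    smooth_upto M n (\<lambda>\<epsilon> s \<omega>. a * exp (U \<epsilon> s \<omega>) / (1 + a * exp (U \<epsilon> s \<omega>)))"
proof (induction n)
  have pos: "1 + a * exp x \<noteq> 0" for x using a by (smt (verit) exp_gt_zero mult_pos_pos)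
  have ld: "locally_dominated M (\<lambda>\<epsilon> s \<omega>. a * exp (U \<epsilon> s \<omega>) / (1 + a * exp (U \<epsilon> s \<omega>)))"
    if U: "locally_dominated M U"
    unfolding locally_dominated_def
  proof (intro conjI allI)
    note [measurable] = locally_dominatedD(1)[OF U]
    show "(\<lambda>(s, \<omega>). a * exp (U \<epsilon> s \<omega>) / (1 + a * exp (U \<epsilon> s \<omega>))) \<in> borel_measurable (borel \<Otimes>\<^sub>M M)" for \<epsilon>
      by measurable
    have "\<bar>a * exp x / (1 + a * exp x)\<bar> \<le> 1" for x
      using a by (simp add: abs_div pos field_simps add_pos_pos abs_of_pos)
    then show "\<exists>G. moment_process M G \<and> (\<forall>\<epsilon> s. \<forall>\<omega>\<in>space M. \<bar>\<epsilon>\<bar> \<le> R \<longrightarrow>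
        \<bar>a * exp (U \<epsilon> s \<omega>) / (1 + a * exp (U \<epsilon> s \<omega>))\<bar> \<le> G s \<omega>)" for R
      by (intro exI[of _ "\<lambda>_ _. 1"]) (auto intro: moment_process_const)
  qed
  {
    case 0
    then show ?case using ld by simp
  next
    case (Suc n)
    let ?w = "\<lambda>\<epsilon> s \<omega>. a * exp (U \<epsilon> s \<omega>) / (1 + a * exp (U \<epsilon> s \<omega>))"
    obtain U' where d: "\<And>\<epsilon> s \<omega>. \<omega> \<in> space M \<Longrightarrow> ((\<lambda>\<epsilon>. U \<epsilon> s \<omega>) has_real_derivative U' \<epsilon> s \<omega>) (at \<epsilon>)"
      and U': "smooth_upto M n U'"
      using Suc.prems by auto
    have w: "smooth_upto M n ?w" using Suc.IH smooth_upto_SucD[OF Suc.prems] by simp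
    show ?case unfolding smooth_upto.simps
    proof (intro conjI exI[of _ "\<lambda>\<epsilon> s \<omega>. ?w \<epsilon> s \<omega> * (1 + (- 1) * ?w \<epsilon> s \<omega>) * U' \<epsilon> s \<omega>"] allI ballI)
      show "smooth_upto M n (\<lambda>\<epsilon> s \<omega>. ?w \<epsilon> s \<omega> * (1 + (- 1) * ?w \<epsilon> s \<omega>) * U' \<epsilon> s \<omega>)"
        by (intro smooth_upto_mult smooth_upto_add smooth_upto_const w U')
      show "((\<lambda>\<epsilon>. ?w \<epsilon> s \<omega>) has_real_derivative ?w \<epsilon> s \<omega> * (1 + (- 1) * ?w \<epsilon> s \<omega>) * U' \<epsilon> s \<omega>) (at \<epsilon>)"
        if "\<omega> \<in> space M" for \<epsilon> s \<omega>
        by (rule derivative_eq_intros d[OF that] refl pos)+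
          (simp add: pos field_simps power2_eq_square)
    qed (use ld Suc.prems smooth_upto_locally_dominated in auto)
  }
qed

lemma locally_dominated_path_bound:
  assumes "locally_dominated M U" "\<omega> \<in> space M"
  shows "\<exists>C. \<forall>\<epsilon> s. \<bar>\<epsilon>\<bar> \<le> R \<longrightarrow> \<bar>U \<epsilon> s \<omega>\<bar> \<le> C"
proof -
  obtain G where G: "moment_process M G" "\<forall>\<epsilon> s. \<forall>\<omega>\<in>space M. \<bar>\<epsilon>\<bar> \<le> R \<longrightarrow> \<bar>U \<epsilon> s \<omega>\<bar> \<le> G s \<omega>"
    using locally_dominatedD(2)[OF assms(1)] by metis
  obtain C where "\<And>s. \<bar>G s \<omega>\<bar> \<le> C" using moment_processD(2)[OF G(1) assms(2)] by auto
  then show ?thesis using G(2) assms(2) by (meson abs_ge_self order_trans)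
qed

lemma integrable_weighted_path:
  assumes a: "integrable lborel (a :: real \<Rightarrow> real)" and U: "locally_dominated M U" and w: "\<omega> \<in> space M"
  shows "integrable lborel (\<lambda>r. a r * U \<epsilon> r \<omega>)"
proof -
  obtain C where C: "\<And>s. \<bar>U \<epsilon> s \<omega>\<bar> \<le> C"
    using locally_dominated_path_bound[OF U w, of "\<bar>\<epsilon>\<bar>"] by auto
  have [measurable]: "(\<lambda>s. U \<epsilon> s \<omega>) \<in> borel_measurable borel" "a \<in> borel_measurable borel"
    using measurable_path[OF locally_dominatedD(1)[OF U] w] borel_measurable_integrable[OF a] by auto
  show ?thesis
  proof (rule Bochner_Integration.integrable_bound[of _ "\<lambda>r. a r * C"])
    show "AE r in lborel. norm (a r * U \<epsilon> r \<omega>) \<le> norm (a r * C)"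
      using C by (intro AE_I2) (auto simp: abs_mult intro!: mult_left_mono order_trans[OF C])
  qed (use a in auto)
qed

text \<open>
  For a fixed outcome the derivative of \<open>U\<close> is bounded in time, locally uniformly in \<open>\<epsilon>\<close>, so the
  derivative may be taken under the integral with a multiple of \<open>\<bar>a\<bar>\<close> as dominating function.
\<close>

lemma smooth_upto_time_integral:
  assumes a: "integrable lborel (a :: real \<Rightarrow> real)"
  shows "smooth_upto M n U \<Longrightarrow> smooth_upto M n (\<lambda>\<epsilon> s \<omega>. LINT r:{0..s}|lborel. a r * U \<epsilon> r \<omega>)"
proof (induction n arbitrary: U)
  have [measurable]: "a \<in> borel_measurable borel" using borel_measurable_integrable[OF a] by simp
  have ld: "locally_dominated M (\<lambda>\<epsilon> s \<omega>. LINT r:{0..s}|lborel. a r * U \<epsilon> r \<omega>)"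
    if U: "locally_dominated M U" for U
    unfolding locally_dominated_def
  proof (intro conjI allI)
    note [measurable] = locally_dominatedD(1)[OF U]
    have ind: "indicator {0..s} r = (if 0 \<le> r \<and> r \<le> s then 1 else (0::real))" for s r :: real
      by (auto simp: indicator_def)
    show "(\<lambda>(s, \<omega>). LINT r:{0..s}|lborel. a r * U \<epsilon> r \<omega>) \<in> borel_measurable (borel \<Otimes>\<^sub>M M)" for \<epsilon>
      unfolding set_lebesgue_integral_def ind by measurable
    fix R
    obtain G where G: "moment_process M G" "\<forall>\<epsilon> s. \<forall>\<omega>\<in>space M. \<bar>\<epsilon>\<bar> \<le> R \<longrightarrow> \<bar>U \<epsilon> s \<omega>\<bar> \<le> G s \<omega>"
      using locally_dominatedD(2)[OF U] by metis
    have gld: "locally_dominated M (\<lambda>\<epsilon> s \<omega>. \<bar>G s \<omega>\<bar>)"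
      using smooth_upto_moment_process[OF moment_process_abs[OF G(1)], of 0] by simp
    have "\<bar>LINT r:{0..s}|lborel. a r * U \<epsilon> r \<omega>\<bar> \<le> (LINT r|lborel. \<bar>a r\<bar> * \<bar>G r \<omega>\<bar>)"
      if "\<omega> \<in> space M" "\<bar>\<epsilon>\<bar> \<le> R" for s \<epsilon> \<omega>
    proof -
      have "\<bar>LINT r:{0..s}|lborel. a r * U \<epsilon> r \<omega>\<bar> \<le> (LINT r|lborel. norm (indicator {0..s} r *\<^sub>R (a r * U \<epsilon> r \<omega>)))"
        unfolding set_lebesgue_integral_def real_norm_def[symmetric] by (rule integral_norm_bound)
      also have "\<dots> \<le> (LINT r|lborel. \<bar>a r\<bar> * \<bar>G r \<omega>\<bar>)"
      proof (rule integral_mono)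
        show "integrable lborel (\<lambda>r. norm (indicator {0..s} r *\<^sub>R (a r * U \<epsilon> r \<omega>)))"
          using integrable_weighted_path[OF a U that(1)]
          by (intro integrable_norm integrable_mult_indicator) auto
        show "integrable lborel (\<lambda>r. \<bar>a r\<bar> * \<bar>G r \<omega>\<bar>)"
          using integrable_weighted_path[OF _ gld that(1), of "\<lambda>r. \<bar>a r\<bar>"] a by simp
        show "norm (indicator {0..s} r *\<^sub>R (a r * U \<epsilon> r \<omega>)) \<le> \<bar>a r\<bar> * \<bar>G r \<omega>\<bar>" for r
        proof -
          have "\<bar>U \<epsilon> r \<omega>\<bar> \<le> \<bar>G r \<omega>\<bar>" using G(2) that by (meson abs_ge_self order_trans)
          then show ?thesis by (auto simp: indicator_def abs_mult intro!: mult_left_mono)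
        qed
      qed
      finally show ?thesis .
    qed
    then show "\<exists>K. moment_process M K \<and> (\<forall>\<epsilon> s. \<forall>\<omega>\<in>space M. \<bar>\<epsilon>\<bar> \<le> R \<longrightarrow>
        \<bar>LINT r:{0..s}|lborel. a r * U \<epsilon> r \<omega>\<bar> \<le> K s \<omega>)"
      using moment_process_time_integral[OF a G(1)] by blast
  qed
  {
    case 0
    then show ?case using ld by simp
  next
    case (Suc n)
    obtain V where d: "\<And>\<epsilon> s \<omega>. \<omega> \<in> space M \<Longrightarrow> ((\<lambda>\<epsilon>. U \<epsilon> s \<omega>) has_real_derivative V \<epsilon> s \<omega>) (at \<epsilon>)"
      and V: "smooth_upto M n V"
      using Suc.prems by auto
    have Uld: "locally_dominated M U" and Vld: "locally_dominated M V"
      using Suc.prems V smooth_upto_locally_dominated by blast+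
    have "((\<lambda>\<epsilon>. LINT r:{0..s}|lborel. a r * U \<epsilon> r \<omega>) has_real_derivative
        (LINT r:{0..s}|lborel. a r * V \<epsilon> r \<omega>)) (at \<epsilon>)" if w: "\<omega> \<in> space M" for \<epsilon> s \<omega>
    proof -
      obtain C where C: "\<And>\<eta> r. \<bar>\<eta>\<bar> \<le> \<bar>\<epsilon>\<bar> + 1 \<Longrightarrow> \<bar>V \<eta> r \<omega>\<bar> \<le> C"
        using locally_dominated_path_bound[OF Vld w] by metis
      show ?thesis unfolding set_lebesgue_integral_def
      proof (rule has_real_derivative_integral[where w="\<lambda>r. \<bar>a r\<bar> * C"])
        show "integrable lborel (\<lambda>r. indicator {0..s} r *\<^sub>R (a r * U y r \<omega>))" for y
          using integrable_weighted_path[OF a Uld w] by (intro integrable_mult_indicator) auto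
        show "(\<lambda>r. indicator {0..s} r *\<^sub>R (a r * V y r \<omega>)) \<in> borel_measurable lborel" for y
          using measurable_path[OF locally_dominatedD(1)[OF Vld] w] by measurable
        show "integrable lborel (\<lambda>r. \<bar>a r\<bar> * C)" using a by auto
        show "((\<lambda>y. indicator {0..s} r *\<^sub>R (a r * U y r \<omega>)) has_real_derivative
            indicator {0..s} r *\<^sub>R (a r * V y r \<omega>)) (at y)" for r y
          using d[OF w, of r y] by (auto intro!: derivative_eq_intros simp: mult_ac)
        show "\<bar>indicator {0..s} r *\<^sub>R (a r * V y r \<omega>)\<bar> \<le> \<bar>a r\<bar> * C" if "\<bar>y\<bar> \<le> \<bar>\<epsilon>\<bar> + 1" for r y
        proof -
          have "0 \<le> C" using C[OF that, of 0] by linarith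
          then show ?thesis using C[OF that, of r]
            by (auto simp: indicator_def abs_mult intro!: mult_left_mono)
        qed
      qed
    qed
    then show ?case unfolding smooth_upto.simps
      using ld[OF Uld] Suc.IH[OF V]
      by (intro conjI exI[of _ "\<lambda>\<epsilon> s \<omega>. LINT r:{0..s}|lborel. a r * V \<epsilon> r \<omega>"]) auto
  }
qed

definition smooth_family :: "(real \<Rightarrow> real \<Rightarrow> 'a \<Rightarrow> real) \<Rightarrow> bool" where
  "smooth_family U \<longleftrightarrow> (\<forall>n. smooth_upto M n U)"

text \<open>
  The derivatives provided for the different orders agree on the sample space, because derivatives are
  unique; hence the one for order \<open>0\<close> has all orders.
\<close>

lemma smooth_family_derivative:
  assumes "smooth_family U"
  shows "\<exists>V. (\<forall>\<epsilon> s. \<forall>\<omega>\<in>space M. ((\<lambda>\<epsilon>. U \<epsilon> s \<omega>) has_real_derivative V \<epsilon> s \<omega>) (at \<epsilon>)) \<and> smooth_family V"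
proof -
  have "smooth_upto M (Suc n) U" for n using assms by (simp add: smooth_family_def del: smooth_upto.simps)
  then obtain V where V: "\<And>n \<epsilon> s \<omega>. \<omega> \<in> space M \<Longrightarrow> ((\<lambda>\<epsilon>. U \<epsilon> s \<omega>) has_real_derivative V n \<epsilon> s \<omega>) (at \<epsilon>)"
    "\<And>n. smooth_upto M n (V n)"
    unfolding smooth_upto.simps by metis
  have "smooth_upto M n (V 0)" for n
    using V(2)[of n] by (rule smooth_upto_cong) (metis V(1) DERIV_unique)
  then show ?thesis using V(1) by (intro exI[of _ "V 0"]) (auto simp: smooth_family_def)
qed

lemma smooth_family_iterated_derivatives:
  assumes "smooth_family U"
  shows "\<exists>D. D 0 = U \<and> (\<forall>k. smooth_family (D k)) \<and>
    (\<forall>k \<epsilon> s. \<forall>\<omega>\<in>space M. ((\<lambda>\<epsilon>. D k \<epsilon> s \<omega>) has_real_derivative D (Suc k) \<epsilon> s \<omega>) (at \<epsilon>))"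
  using dependent_nat_choice[of "\<lambda>n V. smooth_family V \<and> (n = 0 \<longrightarrow> V = U)"
      "\<lambda>n V W. \<forall>\<epsilon> s. \<forall>\<omega>\<in>space M. ((\<lambda>\<epsilon>. V \<epsilon> s \<omega>) has_real_derivative W \<epsilon> s \<omega>) (at \<epsilon>)"]
    assms smooth_family_derivative by (metis nat.distinct(1))

section \<open>Derivatives in \<open>L\<^sup>2\<close>\<close>

lemma moment_process_square_integrable:
  assumes "moment_process M G"
  shows "integrable M (\<lambda>\<omega>. (G s \<omega>)\<^sup>2)"
proof (rule integrableI_bounded)
  show "(\<lambda>\<omega>. (G s \<omega>)\<^sup>2) \<in> borel_measurable M"
    using moment_process_measurable_section[OF assms] by measurable
  obtain C where "\<And>s. (\<integral>\<^sup>+\<omega>. ennreal (\<bar>G s \<omega>\<bar> ^ 2) \<partial>M) \<le> ennreal C"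
    using moment_processD(3)[OF assms] by blast
  then show "(\<integral>\<^sup>+\<omega>. ennreal (norm ((G s \<omega>)\<^sup>2)) \<partial>M) < \<infinity>"
    by (simp add: ) (meson ennreal_less_top order_le_less_trans)
qed

lemma locally_dominated_square_integrable:
  assumes "locally_dominated M U"
  shows "square_integrable M (U \<epsilon> s)"
proof -
  obtain G where G: "moment_process M G" "\<forall>\<eta> s. \<forall>\<omega>\<in>space M. \<bar>\<eta>\<bar> \<le> \<bar>\<epsilon>\<bar> \<longrightarrow> \<bar>U \<eta> s \<omega>\<bar> \<le> G s \<omega>"
    using locally_dominatedD(2)[OF assms] by metis
  have "moment_process M (U \<epsilon>)"
    by (rule moment_process_dominated[OF G(1) locally_dominatedD(1)[OF assms]]) (use G(2) in auto)
  then show ?thesis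
    unfolding square_integrable_def
    using moment_process_square_integrable moment_process_measurable_section by blast
qed

text \<open>
  By the mean value theorem the difference quotients are bounded by the process that dominates \<open>V\<close>,
  whose square is integrable.
\<close>

lemma has_L2_derivative_pathwise:
  assumes U: "locally_dominated M U" and V: "locally_dominated M V"
    and d: "\<And>\<epsilon> s \<omega>. \<omega> \<in> space M \<Longrightarrow> ((\<lambda>\<epsilon>. U \<epsilon> s \<omega>) has_real_derivative V \<epsilon> s \<omega>) (at \<epsilon>)"
  shows "has_L2_derivative M (\<lambda>\<epsilon>. U \<epsilon> t) (V \<epsilon> t) \<epsilon>"
  unfolding has_L2_derivative_def
proof (intro conjI allI)
  show "square_integrable M (U \<eta> t)" for \<eta> by (rule locally_dominated_square_integrable[OF U])
  show "square_integrable M (V \<epsilon> t)" by (rule locally_dominated_square_integrable[OF V])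
  have [measurable]: "U \<eta> t \<in> borel_measurable M" "V \<eta> t \<in> borel_measurable M" for \<eta>
    using locally_dominated_square_integrable[OF U] locally_dominated_square_integrable[OF V]
    by (auto simp: square_integrable_def)
  obtain G where G: "moment_process M G" "\<forall>\<eta> s. \<forall>\<omega>\<in>space M. \<bar>\<eta>\<bar> \<le> \<bar>\<epsilon>\<bar> + 1 \<longrightarrow> \<bar>V \<eta> s \<omega>\<bar> \<le> G s \<omega>"
    using locally_dominatedD(2)[OF V] by metis
  have "((\<lambda>h. LINT \<omega>|M. ((U (\<epsilon> + h) t \<omega> - U \<epsilon> t \<omega>) / h - V \<epsilon> t \<omega>)\<^sup>2) \<longlongrightarrow> (LINT \<omega>|M. 0)) (at 0)"
  proof (rule tendsto_integral_dominated_at[where w="\<lambda>\<omega>. 4 * (G t \<omega>)\<^sup>2"])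
    show "integrable M (\<lambda>\<omega>. 4 * (G t \<omega>)\<^sup>2)"
      using moment_process_square_integrable[OF G(1)] by simp
    have "\<forall>\<^sub>F h in at 0. \<forall>\<omega>\<in>space M. \<bar>(U (\<epsilon> + h) t \<omega> - U \<epsilon> t \<omega>) / h\<bar> \<le> G t \<omega>"
      by (rule eventually_difference_quotient_le[OF d]) (use G(2) in auto)
    then show "\<forall>\<^sub>F h in at 0. \<forall>\<omega>\<in>space M.
        \<bar>((U (\<epsilon> + h) t \<omega> - U \<epsilon> t \<omega>) / h - V \<epsilon> t \<omega>)\<^sup>2\<bar> \<le> 4 * (G t \<omega>)\<^sup>2"
    proof eventually_elim
      case (elim h)
      show ?case
      proof
        fix \<omega> assume w: "\<omega> \<in> space M"
        have "\<bar>V \<epsilon> t \<omega>\<bar> \<le> G t \<omega>" using G(2) w by auto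
        with elim w have "\<bar>(U (\<epsilon> + h) t \<omega> - U \<epsilon> t \<omega>) / h - V \<epsilon> t \<omega>\<bar> \<le> \<bar>2 * G t \<omega>\<bar>"
          by (smt (verit, best))
        then have "((U (\<epsilon> + h) t \<omega> - U \<epsilon> t \<omega>) / h - V \<epsilon> t \<omega>)\<^sup>2 \<le> (2 * G t \<omega>)\<^sup>2"
          by (rule abs_le_square_iff[THEN iffD1])
        then show "\<bar>((U (\<epsilon> + h) t \<omega> - U \<epsilon> t \<omega>) / h - V \<epsilon> t \<omega>)\<^sup>2\<bar> \<le> 4 * (G t \<omega>)\<^sup>2"
          by (simp add: power_mult_distrib)
      qed
    qed
    show "((\<lambda>h. ((U (\<epsilon> + h) t \<omega> - U \<epsilon> t \<omega>) / h - V \<epsilon> t \<omega>)\<^sup>2) \<longlongrightarrow> 0) (at 0)" if "\<omega> \<in> space M" for \<omega>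
    proof -
      have "((\<lambda>h. (U (\<epsilon> + h) t \<omega> - U \<epsilon> t \<omega>) / h) \<longlongrightarrow> V \<epsilon> t \<omega>) (at 0)"
        using d[OF that] by (simp add: DERIV_def)
      then have "((\<lambda>h. ((U (\<epsilon> + h) t \<omega> - U \<epsilon> t \<omega>) / h - V \<epsilon> t \<omega>)\<^sup>2) \<longlongrightarrow> (V \<epsilon> t \<omega> - V \<epsilon> t \<omega>)\<^sup>2) (at 0)"
        by (intro tendsto_intros)
      then show ?thesis by simp
    qed
  qed auto
  then show "((\<lambda>h. LINT \<omega>|M. ((U (\<epsilon> + h) t \<omega> - U \<epsilon> t \<omega>) / h - V \<epsilon> t \<omega>)\<^sup>2) \<longlongrightarrow> 0) (at 0)"
    by simp
qed

lemma square_integrable_cong_AE: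
  assumes "square_integrable M Z" "Z' \<in> borel_measurable M" "AE \<omega> in M. Z \<omega> = Z' \<omega>"
  shows "square_integrable M Z'"
proof -
  have [measurable]: "Z \<in> borel_measurable M" "Z' \<in> borel_measurable M"
    using assms by (auto simp: square_integrable_def)
  have "integrable M (\<lambda>\<omega>. (Z \<omega>)\<^sup>2) \<longleftrightarrow> integrable M (\<lambda>\<omega>. (Z' \<omega>)\<^sup>2)"
    by (rule integrable_cong_AE) (use assms(3) in auto)
  then show ?thesis using assms by (auto simp: square_integrable_def)
qed

lemma has_L2_derivative_cong_AE:
  assumes "has_L2_derivative M W Z \<epsilon>"
    and W': "\<And>\<eta>. W' \<eta> \<in> borel_measurable M" "\<And>\<eta>. AE \<omega> in M. W \<eta> \<omega> = W' \<eta> \<omega>"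
    and Z': "Z' \<in> borel_measurable M" "AE \<omega> in M. Z \<omega> = Z' \<omega>"
  shows "has_L2_derivative M W' Z' \<epsilon>"
proof -
  have L: "\<And>\<eta>. square_integrable M (W \<eta>)" "square_integrable M Z"
    "((\<lambda>h. LINT \<omega>|M. ((W (\<epsilon> + h) \<omega> - W \<epsilon> \<omega>) / h - Z \<omega>)\<^sup>2) \<longlongrightarrow> 0) (at 0)"
    using assms(1) by (auto simp: has_L2_derivative_def)
  note [measurable] = W'(1) Z'(1)
  have [measurable]: "W \<eta> \<in> borel_measurable M" "Z \<in> borel_measurable M" for \<eta>
    using L by (auto simp: square_integrable_def)
  have "(LINT \<omega>|M. ((W (\<epsilon> + h) \<omega> - W \<epsilon> \<omega>) / h - Z \<omega>)\<^sup>2) = (LINT \<omega>|M. ((W' (\<epsilon> + h) \<omega> - W' \<epsilon> \<omega>) / h - Z' \<omega>)\<^sup>2)" for h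
    using W'(2)[of "\<epsilon> + h"] W'(2)[of \<epsilon>] Z'(2) by (intro integral_cong_AE) auto
  then show ?thesis
    using L(3) square_integrable_cong_AE[OF L(1) W'] square_integrable_cong_AE[OF L(2) Z']
    unfolding has_L2_derivative_def by simp
qed

lemma L1_le_L2:
  assumes "square_integrable M Z"
  shows "integrable M Z" "(LINT \<omega>|M. \<bar>Z \<omega>\<bar>)\<^sup>2 \<le> (LINT \<omega>|M. (Z \<omega>)\<^sup>2)"
proof -
  have [measurable]: "Z \<in> borel_measurable M" and Z: "integrable M (\<lambda>\<omega>. (Z \<omega>)\<^sup>2)"
    using assms by (auto simp: square_integrable_def)
  show int: "integrable M Z" by (rule square_integrable_imp_integrable) (use Z in auto)
  have "0 \<le> variance (\<lambda>\<omega>. \<bar>Z \<omega>\<bar>)" by (rule variance_positive)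
  also have "\<dots> = expectation (\<lambda>\<omega>. \<bar>Z \<omega>\<bar>\<^sup>2) - (expectation (\<lambda>\<omega>. \<bar>Z \<omega>\<bar>))\<^sup>2"
    by (rule variance_eq) (use int Z in auto)
  finally show "(LINT \<omega>|M. \<bar>Z \<omega>\<bar>)\<^sup>2 \<le> (LINT \<omega>|M. (Z \<omega>)\<^sup>2)" by simp
qed

text \<open>
  Divided by \<open>\<epsilon>\<close>, the remainder is the difference quotient minus \<open>Z\<close>, and its norm in \<open>L\<^sup>1\<close> is at most
  that in \<open>L\<^sup>2\<close>.
\<close>

lemma first_order_remainder_smallo:
  assumes L: "has_L2_derivative M W Z 0"
  shows "(\<lambda>\<epsilon>. LINT \<omega>|M. \<bar>W \<epsilon> \<omega> - (W 0 \<omega> + \<epsilon> * Z \<omega>)\<bar>) \<in> o[at 0](\<lambda>\<epsilon>. \<epsilon> ^ 1)"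
proof (rule smalloI_tendsto)
  have W: "square_integrable M (W \<eta>)" and Z: "square_integrable M Z" for \<eta>
    using L by (auto simp: has_L2_derivative_def)
  have [measurable]: "W \<eta> \<in> borel_measurable M" "Z \<in> borel_measurable M" for \<eta>
    using W Z by (auto simp: square_integrable_def)
  define Q where "Q h \<omega> = (W h \<omega> - W 0 \<omega>) / h - Z \<omega>" for h \<omega>
  have sq2: "(x - y)\<^sup>2 \<le> 2 * x\<^sup>2 + 2 * y\<^sup>2" for x y :: real
    using sum_squares_bound[of x "- y"] by (simp add: power2_diff)
  have sqdiff: "square_integrable M (\<lambda>\<omega>. f \<omega> - g \<omega>)" if "square_integrable M f" "square_integrable M g" for f g
  proof -
    have [measurable]: "f \<in> borel_measurable M" "g \<in> borel_measurable M"
      using that by (auto simp: square_integrable_def)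
    have "integrable M (\<lambda>\<omega>. (f \<omega> - g \<omega>)\<^sup>2)"
      by (rule Bochner_Integration.integrable_bound[of _ "\<lambda>\<omega>. 2 * (f \<omega>)\<^sup>2 + 2 * (g \<omega>)\<^sup>2"])
        (use that sq2 in \<open>auto simp: square_integrable_def\<close>)
    then show ?thesis by (simp add: square_integrable_def)
  qed
  have sqdiv: "square_integrable M (\<lambda>\<omega>. f \<omega> / h)" if "square_integrable M f" for f h
    using that by (auto simp: square_integrable_def power_divide)
  have Q: "square_integrable M (Q h)" for h
    unfolding Q_def by (intro sqdiff sqdiv W Z)
  have "((\<lambda>h. LINT \<omega>|M. (Q h \<omega>)\<^sup>2) \<longlongrightarrow> 0) (at 0)"
    using L by (simp add: has_L2_derivative_def Q_def)
  then have "((\<lambda>h. sqrt (LINT \<omega>|M. (Q h \<omega>)\<^sup>2)) \<longlongrightarrow> sqrt 0) (at 0)" by (intro tendsto_intros)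
  then have lim0: "((\<lambda>h. sqrt (LINT \<omega>|M. (Q h \<omega>)\<^sup>2)) \<longlongrightarrow> 0) (at 0)" by simp
  have "((\<lambda>h. LINT \<omega>|M. \<bar>Q h \<omega>\<bar>) \<longlongrightarrow> 0) (at 0)"
  proof (rule Lim_null_comparison[OF _ lim0])
    show "\<forall>\<^sub>F h in at 0. norm (LINT \<omega>|M. \<bar>Q h \<omega>\<bar>) \<le> sqrt (LINT \<omega>|M. (Q h \<omega>)\<^sup>2)"
      using L1_le_L2(2)[OF Q] by (intro always_eventually allI) (simp add: real_le_rsqrt)
  qed
  then have "((\<lambda>h. \<bar>LINT \<omega>|M. \<bar>Q h \<omega>\<bar>\<bar>) \<longlongrightarrow> 0) (at 0)" by (rule tendsto_rabs_zero)
  then show "((\<lambda>\<epsilon>. (LINT \<omega>|M. \<bar>W \<epsilon> \<omega> - (W 0 \<omega> + \<epsilon> * Z \<omega>)\<bar>) / \<epsilon> ^ 1) \<longlongrightarrow> 0) (at 0)"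
  proof (rule tendsto_rabs_zero_cancel[OF Lim_transform_eventually])
    show "\<forall>\<^sub>F \<epsilon> in at 0. \<bar>LINT \<omega>|M. \<bar>Q \<epsilon> \<omega>\<bar>\<bar> = \<bar>(LINT \<omega>|M. \<bar>W \<epsilon> \<omega> - (W 0 \<omega> + \<epsilon> * Z \<omega>)\<bar>) / \<epsilon> ^ 1\<bar>"
    proof (rule eventually_at_filter[THEN iffD2], rule always_eventually, intro allI impI)
      fix \<epsilon> :: real assume e: "\<epsilon> \<noteq> 0"
      have "\<bar>W \<epsilon> \<omega> - (W 0 \<omega> + \<epsilon> * Z \<omega>)\<bar> = \<bar>\<epsilon>\<bar> * \<bar>Q \<epsilon> \<omega>\<bar>" for \<omega>
      proof -
        have "\<epsilon> * Q \<epsilon> \<omega> = W \<epsilon> \<omega> - (W 0 \<omega> + \<epsilon> * Z \<omega>)" unfolding Q_def using e by (simp add: field_simps)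
        then show ?thesis by (simp flip: abs_mult)
      qed
      then show "\<bar>LINT \<omega>|M. \<bar>Q \<epsilon> \<omega>\<bar>\<bar> = \<bar>(LINT \<omega>|M. \<bar>W \<epsilon> \<omega> - (W 0 \<omega> + \<epsilon> * Z \<omega>)\<bar>) / \<epsilon> ^ 1\<bar>"
        using e by (simp add: abs_mult)
    qed
  qed
  show "\<forall>\<^sub>F \<epsilon> in at 0. \<epsilon> ^ 1 \<noteq> (0::real)" by (simp add: eventually_at_filter)
qed

end

section \<open>Moments from the characteristic function\<close>

lemma alternating_binomial_sum_Suc:
  fixes f :: "nat \<Rightarrow> 'a::comm_ring_1"
  shows "(\<Sum>j\<le>Suc m. (- 1) ^ j * of_nat (Suc m choose j) * f j)
    = (\<Sum>j\<le>m. (- 1) ^ j * of_nat (m choose j) * (f j - f (Suc j)))"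
proof -
  have "(\<Sum>j\<le>Suc m. (- 1) ^ j * of_nat (Suc m choose j) * f j)
      = f 0 + (\<Sum>j\<le>m. (- 1) ^ Suc j * of_nat (Suc m choose Suc j) * f (Suc j))"
    by (subst sum.atMost_Suc_shift) simp
  also have "(\<Sum>j\<le>m. (- 1) ^ Suc j * of_nat (Suc m choose Suc j) * f (Suc j))
      = (\<Sum>j\<le>m. (- 1) ^ Suc j * of_nat (m choose Suc j) * f (Suc j))
        - (\<Sum>j\<le>m. (- 1) ^ j * of_nat (m choose j) * f (Suc j))"
    unfolding sum_subtractf[symmetric] by (intro sum.cong) (auto simp: algebra_simps)
  also have "f 0 + ((\<Sum>j\<le>m. (- 1) ^ Suc j * of_nat (m choose Suc j) * f (Suc j))
        - (\<Sum>j\<le>m. (- 1) ^ j * of_nat (m choose j) * f (Suc j)))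
      = (\<Sum>j\<le>Suc m. (- 1) ^ j * of_nat (m choose j) * f j)
        - (\<Sum>j\<le>m. (- 1) ^ j * of_nat (m choose j) * f (Suc j))"
    by (subst sum.atMost_Suc_shift) simp
  also have "\<dots> = (\<Sum>j\<le>m. (- 1) ^ j * of_nat (m choose j) * (f j - f (Suc j)))"
    by (simp add: sum_subtractf right_diff_distrib binomial_eq_0)
  finally show ?thesis .
qed

text \<open>
  The finite difference of order \<open>m\<close> annihilates polynomials of degree less than \<open>m\<close>: a single
  difference lowers the degree, which is the induction step.
\<close>

lemma alternating_binomial_sum_power_eq_0:
  fixes x :: "'a::comm_ring_1"
  shows "n < m \<Longrightarrow> (\<Sum>j\<le>m. (- 1) ^ j * of_nat (m choose j) * (x + of_nat j) ^ n) = 0"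
proof (induction m arbitrary: n)
  case (Suc m)
  have diff: "(x + of_nat j) ^ n - (x + of_nat (Suc j)) ^ n
      = - (\<Sum>l<n. of_nat (n choose l) * (x + of_nat j) ^ l)" for j
  proof -
    have "(x + of_nat (Suc j)) ^ n = ((x + of_nat j) + 1) ^ n" by (simp add: algebra_simps)
    also have "\<dots> = (\<Sum>l\<le>n. of_nat (n choose l) * (x + of_nat j) ^ l)" by (subst binomial_ring) simp
    also have "\<dots> = (\<Sum>l<n. of_nat (n choose l) * (x + of_nat j) ^ l) + (x + of_nat j) ^ n"
      by (simp flip: lessThan_Suc_atMost)
    finally show ?thesis by simp
  qed
  have "(\<Sum>j\<le>Suc m. (- 1) ^ j * of_nat (Suc m choose j) * (x + of_nat j) ^ n)
      = (\<Sum>j\<le>m. (- 1) ^ j * of_nat (m choose j) * - (\<Sum>l<n. of_nat (n choose l) * (x + of_nat j) ^ l))"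
    by (simp only: alternating_binomial_sum_Suc diff)
  also have "\<dots> = - (\<Sum>j\<le>m. \<Sum>l<n. of_nat (n choose l) * ((- 1) ^ j * of_nat (m choose j) * (x + of_nat j) ^ l))"
    by (simp add: sum_distrib_left sum_negf mult_ac)
  also have "\<dots> = - (\<Sum>l<n. of_nat (n choose l) * (\<Sum>j\<le>m. (- 1) ^ j * of_nat (m choose j) * (x + of_nat j) ^ l))"
    by (subst sum.swap) (simp add: sum_distrib_left)
  also have "\<dots> = 0" using Suc by simp
  finally show ?case .
qed simp

text \<open>
  The even power is a trigonometric polynomial in \<open>y\<close>. With \<open>y = hX\<close>, its expectation is the symmetric
  difference of order \<open>2k\<close> with step \<open>h\<close> of the characteristic function of \<open>X\<close> at \<open>0\<close>.
\<close>

lemma cmod_iexp_minus_1_power: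
  "complex_of_real (cmod (iexp y - 1) ^ (2 * k))
    = (- 1) ^ k * (\<Sum>j\<le>2*k. (- 1) ^ j * of_nat (2 * k choose j) * iexp ((real j - real k) * y))"
proof -
  let ?z = "iexp y - 1"
  have inv: "exp (- (\<i> * complex_of_real y)) * iexp y = 1" by (simp add: exp_minus_inverse mult.commute)
  have "cnj ?z = exp (- (\<i> * complex_of_real y)) - 1" by (simp add: exp_cnj)
  also have "\<dots> = - exp (- (\<i> * complex_of_real y)) * ?z" using inv by (simp add: algebra_simps)
  finally have cnj: "cnj ?z = - exp (- (\<i> * complex_of_real y)) * ?z" .
  have "complex_of_real (cmod ?z ^ (2 * k)) = (complex_of_real (cmod ?z ^ 2)) ^ k"
    by (simp add: power_mult)
  also have "\<dots> = (?z * cnj ?z) ^ k" by (simp only: complex_norm_square)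
  also have "\<dots> = (- 1) ^ k * exp (- (\<i> * complex_of_real y)) ^ k * ?z ^ (2 * k)"
    unfolding cnj power_mult power2_eq_square by (simp add: power_mult_distrib[symmetric] mult_ac)
  also have "?z ^ (2 * k) = (\<Sum>j\<le>2*k. of_nat (2 * k choose j) * iexp y ^ j * (- 1) ^ (2 * k - j))"
    using binomial_ring[of "iexp y" "- 1" "2 * k"] by simp
  also have "\<dots> = (\<Sum>j\<le>2*k. (- 1) ^ j * of_nat (2 * k choose j) * iexp y ^ j)"
    by (intro sum.cong) (auto simp: mult_ac uminus_power_if even_diff_nat)
  also have "(- 1) ^ k * exp (- (\<i> * complex_of_real y)) ^ k * \<dots>
      = (- 1) ^ k * (\<Sum>j\<le>2*k. (- 1) ^ j * of_nat (2 * k choose j)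
            * (exp (- (\<i> * complex_of_real y)) ^ k * iexp y ^ j))"
    by (simp add: sum_distrib_left mult_ac)
  also have "(\<lambda>j. exp (- (\<i> * complex_of_real y)) ^ k * iexp y ^ j) = (\<lambda>j. iexp ((real j - real k) * y))"
    by (simp add: exp_of_nat_mult[symmetric] exp_add[symmetric] algebra_simps)
  finally show ?thesis .
qed

lemma sum_shifted_power_le:
  fixes x :: real
  assumes "0 \<le> x" "x \<le> 1 / 2"
  shows "summable (\<lambda>n. x ^ (n + m))" "(\<Sum>n. x ^ (n + m)) \<le> 2 * x ^ m"
proof -
  have s: "summable (\<lambda>n. x ^ n)" using assms by (intro summable_geometric) auto
  then show "summable (\<lambda>n. x ^ (n + m))" by (simp add: power_add summable_mult2)
  have "(\<Sum>n. x ^ (n + m)) = (\<Sum>n. x ^ n) * x ^ m"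
    using s by (simp add: power_add suminf_mult2)
  also have "\<dots> = 1 / (1 - x) * x ^ m" using assms by (subst suminf_geometric) auto
  also have "\<dots> \<le> 2 * x ^ m" using assms by (intro mult_right_mono) (auto simp: field_simps)
  finally show "(\<Sum>n. x ^ (n + m)) \<le> 2 * x ^ m" .
qed

text \<open>
  The difference of order \<open>2k\<close> annihilates the terms of degree below \<open>2k\<close> of the power series of \<open>p\<close>, and
  Cauchy's inequality on the unit circle bounds the remaining ones.
\<close>

lemma alternating_sum_holomorphic_le:
  fixes p :: "complex \<Rightarrow> complex" and h :: real
  assumes hol: "p holomorphic_on UNIV" and B: "\<And>z. cmod z = 1 \<Longrightarrow> cmod (p z) \<le> B"
    and h: "0 \<le> h" "real k * h \<le> 1 / 2"
  shows "cmod (\<Sum>j\<le>2*k. (- 1) ^ j * of_nat (2 * k choose j) * p (of_real ((real j - real k) * h)))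
    \<le> 4 ^ k * (B * (2 * (real k * h) ^ (2 * k)))"
proof -
  define c where "c n = (deriv ^^ n) p 0 / fact n" for n
  define d where "d n = (\<Sum>j\<le>2*k. (- 1) ^ j * of_nat (2 * k choose j) * (complex_of_real (real j - real k)) ^ n)" for n
  have "cmod (p 1) \<le> B" by (rule B) simp
  then have B0: "0 \<le> B" by (meson norm_ge_zero order_trans)
  have c: "cmod (c n) \<le> B" for n
  proof -
    have "cmod ((deriv ^^ n) p 0) \<le> fact n * B / 1 ^ n"
      by (rule Cauchy_inequality)
        (use hol B in \<open>auto intro: holomorphic_on_imp_continuous_on holomorphic_on_subset\<close>)
    then show ?thesis by (simp add: c_def norm_divide field_simps)
  qed
  have jk: "\<bar>(real j - real k) * h\<bar> \<le> real k * h" if "j \<le> 2 * k" for j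
    using that h by (auto simp: abs_mult intro!: mult_right_mono)
  have sums: "(\<lambda>n. c n * of_real ((real j - real k) * h) ^ n) sums p (of_real ((real j - real k) * h))"
    if "j \<le> 2 * k" for j
  proof -
    have "(\<lambda>n. (deriv ^^ n) p 0 / fact n * (of_real ((real j - real k) * h) - 0) ^ n) sums
        p (of_real ((real j - real k) * h))"
      by (rule holomorphic_power_series[of p 0 1])
        (use hol jk[OF that] h(2) in \<open>auto intro: holomorphic_on_subset simp: norm_mult abs_mult simp flip: of_real_diff of_real_mult\<close>)
    then show ?thesis by (simp add: c_def)
  qed
  have "(\<lambda>n. \<Sum>j\<le>2*k. (- 1) ^ j * of_nat (2 * k choose j) * (c n * of_real ((real j - real k) * h) ^ n))
      sums (\<Sum>j\<le>2*k. (- 1) ^ j * of_nat (2 * k choose j) * p (of_real ((real j - real k) * h)))"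
    (is "_ sums ?S")
    by (intro sums_sum sums_mult sums) auto
  also have "(\<lambda>n. \<Sum>j\<le>2*k. (- 1) ^ j * of_nat (2 * k choose j) * (c n * of_real ((real j - real k) * h) ^ n))
      = (\<lambda>n. c n * of_real h ^ n * d n)"
    by (auto simp: d_def sum_distrib_left power_mult_distrib mult_ac intro!: sum.cong)
  finally have S: "(\<lambda>n. c n * of_real h ^ n * d n) sums ?S" .
  have d0: "d n = 0" if "n < 2 * k" for n
    using alternating_binomial_sum_power_eq_0[OF that, of "- complex_of_nat k"]
    by (simp add: d_def algebra_simps)
  have dle: "cmod (d n) \<le> 4 ^ k * real k ^ n" for n
  proof -
    have "cmod (d n) \<le> (\<Sum>j\<le>2*k. real (2 * k choose j) * real k ^ n)"
      unfolding d_def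
    proof (rule sum_norm_le)
      fix j assume "j \<in> {..2*k}"
      then have "\<bar>real j - real k\<bar> ^ n \<le> real k ^ n" by (intro power_mono) auto
      then show "cmod ((- 1) ^ j * of_nat (2 * k choose j) * (complex_of_real (real j - real k)) ^ n)
          \<le> real (2 * k choose j) * real k ^ n"
        unfolding norm_mult norm_power norm_of_real by (auto intro!: mult_left_mono)
    qed
    also have "\<dots> = real (\<Sum>j\<le>2*k. 2 * k choose j) * real k ^ n" by (simp add: sum_distrib_right)
    also have "(\<Sum>j\<le>2*k. 2 * k choose j) = 2 ^ (2 * k)" by (rule choose_row_sum)
    finally show ?thesis by (simp add: power_mult)
  qed
  have "(\<lambda>n. c (n + 2*k) * of_real h ^ (n + 2*k) * d (n + 2*k)) sums ?S"
    using sums_split_initial_segment[OF S, of "2 * k"] d0 by simp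
  then have "?S = (\<Sum>n. c (n + 2*k) * of_real h ^ (n + 2*k) * d (n + 2*k))" by (rule sums_unique)
  also have "cmod \<dots> \<le> (\<Sum>n. 4 ^ k * B * (real k * h) ^ (n + 2*k))"
  proof (rule norm_suminf_le)
    fix n
    have "cmod (c (n + 2*k) * of_real h ^ (n + 2*k) * d (n + 2*k))
        = cmod (c (n + 2*k)) * h ^ (n + 2*k) * cmod (d (n + 2*k))"
      using h by (simp add: norm_mult norm_power)
    also have "\<dots> \<le> B * h ^ (n + 2*k) * (4 ^ k * real k ^ (n + 2*k))"
      using h B0 by (intro mult_mono c dle) auto
    finally show "cmod (c (n + 2*k) * of_real h ^ (n + 2*k) * d (n + 2*k)) \<le> 4 ^ k * B * (real k * h) ^ (n + 2*k)"
      by (simp add: power_mult_distrib mult_ac)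
  qed (use sum_shifted_power_le(1)[of "real k * h"] h in \<open>auto intro: summable_mult\<close>)
  also have "\<dots> = 4 ^ k * B * (\<Sum>n. (real k * h) ^ (n + 2*k))"
    using sum_shifted_power_le(1)[of "real k * h"] h by (intro suminf_mult) auto
  also have "\<dots> \<le> 4 ^ k * B * (2 * (real k * h) ^ (2*k))"
    using sum_shifted_power_le(2)[of "real k * h"] h B0 by (intro mult_left_mono) auto
  finally show ?thesis by simp
qed

text \<open>
  Finiteness of the moment is part of the conclusion. The expectation of \<open>|exp(ihX) - 1|\<^sup>2\<^sup>k\<close> is a
  difference of order \<open>2k\<close> of the characteristic function, hence \<open>O(h\<^sup>2\<^sup>k)\<close>; divide by \<open>h\<^sup>2\<^sup>k\<close> and let \<open>h\<close>
  tend to \<open>0\<close> with Fatou's lemma. The bound depends on the distribution only through \<open>B\<close>.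
\<close>

lemma moment_le_of_char_approx:
  fixes p :: "complex \<Rightarrow> complex"
  assumes "real_distribution \<mu>"
    and hol: "p holomorphic_on UNIV" and B: "\<And>z. cmod z = 1 \<Longrightarrow> cmod (p z) \<le> B"
    and approx: "\<And>u. \<bar>u\<bar> \<le> 1 \<Longrightarrow> cmod (char \<mu> u - p (of_real u)) \<le> B * \<bar>u\<bar> ^ (2 * k)"
    and k: "0 < k"
  shows "(\<integral>\<^sup>+x. ennreal (x ^ (2 * k)) \<partial>\<mu>) \<le> ennreal (3 * 4 ^ k * B * real k ^ (2 * k))"
proof -
  interpret real_distribution \<mu> by fact
  have "cmod (p 1) \<le> B" by (rule B) simp
  then have B0: "0 \<le> B" by (meson norm_ge_zero order_trans)
  define f where "f h x = cmod (iexp (h * x) - 1) ^ (2 * k)" for h x :: real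
  have [measurable]: "f h \<in> borel_measurable \<mu>" for h unfolding f_def by measurable
  have fint: "integrable \<mu> (f h)" for h
  proof (rule integrable_const_bound[of _ "2 ^ (2 * k)"])
    show "AE x in \<mu>. norm (f h x) \<le> 2 ^ (2 * k)"
    proof (rule AE_I2)
      fix x
      have "cmod (iexp (h * x) - 1) \<le> cmod (iexp (h * x)) + cmod 1" by (rule norm_triangle_ineq4)
      then have "cmod (iexp (h * x) - 1) \<le> 2" by simp
      then show "norm (f h x) \<le> 2 ^ (2 * k)" unfolding f_def by (auto intro!: power_mono)
    qed
  qed measurable
  have fle: "(LINT x|\<mu>. f h x) \<le> 3 * 4 ^ k * B * real k ^ (2 * k) * h ^ (2 * k)"
    if h: "0 < h" "real k * h \<le> 1 / 2" for h
  proof -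
    let ?C = "\<lambda>j. (- 1) ^ j * of_nat (2 * k choose j) :: complex"
    let ?u = "\<lambda>j. (real j - real k) * h"
    have u: "\<bar>?u j\<bar> \<le> real k * h" if "j \<le> 2 * k" for j
      using that h by (auto simp: abs_mult intro!: mult_right_mono)
    have "complex_of_real (LINT x|\<mu>. f h x) = (CLINT x|\<mu>. complex_of_real (f h x))"
      by (simp only: integral_complex_of_real)
    also have "\<dots> = (CLINT x|\<mu>. (- 1) ^ k * (\<Sum>j\<le>2*k. ?C j * iexp (?u j * x)))"
      unfolding f_def cmod_iexp_minus_1_power by (simp add: mult_ac)
    also have "\<dots> = (- 1) ^ k * (\<Sum>j\<le>2*k. ?C j * char \<mu> (?u j))"
      by (simp add: Bochner_Integration.integral_sum integrable_iexp char_def)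
    also have "\<dots> = (- 1) ^ k * ((\<Sum>j\<le>2*k. ?C j * (char \<mu> (?u j) - p (of_real (?u j))))
        + (\<Sum>j\<le>2*k. ?C j * p (of_real (?u j))))"
      by (simp add: sum.distrib[symmetric] algebra_simps)
    finally have eq: "complex_of_real (LINT x|\<mu>. f h x) = \<dots>" .
    have f0: "0 \<le> (LINT x|\<mu>. f h x)" by (auto simp: f_def)
    have "(LINT x|\<mu>. f h x) = cmod (complex_of_real (LINT x|\<mu>. f h x))" using f0 by simp
    also have "\<dots> = cmod ((\<Sum>j\<le>2*k. ?C j * (char \<mu> (?u j) - p (of_real (?u j))))
        + (\<Sum>j\<le>2*k. ?C j * p (of_real (?u j))))"
      unfolding eq norm_mult norm_power by simp
    also have "\<dots> \<le> cmod (\<Sum>j\<le>2*k. ?C j * (char \<mu> (?u j) - p (of_real (?u j))))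
        + cmod (\<Sum>j\<le>2*k. ?C j * p (of_real (?u j)))" by (rule norm_triangle_ineq)
    also have "\<dots> \<le> 4 ^ k * (B * (real k * h) ^ (2 * k)) + 4 ^ k * (B * (2 * (real k * h) ^ (2 * k)))"
    proof (rule add_mono)
      have "cmod (\<Sum>j\<le>2*k. ?C j * (char \<mu> (?u j) - p (of_real (?u j))))
          \<le> (\<Sum>j\<le>2*k. real (2 * k choose j) * (B * (real k * h) ^ (2 * k)))"
      proof (rule sum_norm_le)
        fix j assume "j \<in> {..2*k}"
        then have uj: "\<bar>?u j\<bar> \<le> real k * h" using u by auto
        have "cmod (char \<mu> (?u j) - p (of_real (?u j))) \<le> B * \<bar>?u j\<bar> ^ (2 * k)"
          using uj h by (intro approx) auto
        also have "\<dots> \<le> B * (real k * h) ^ (2 * k)" using uj B0 by (intro mult_left_mono power_mono) auto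
        finally show "cmod (?C j * (char \<mu> (?u j) - p (of_real (?u j))))
            \<le> real (2 * k choose j) * (B * (real k * h) ^ (2 * k))"
          unfolding norm_mult norm_power by (auto intro!: mult_left_mono)
      qed
      also have "\<dots> = real (\<Sum>j\<le>2*k. 2 * k choose j) * (B * (real k * h) ^ (2 * k))"
        by (simp add: sum_distrib_right)
      also have "(\<Sum>j\<le>2*k. 2 * k choose j) = 2 ^ (2 * k)" by (rule choose_row_sum)
      finally show "cmod (\<Sum>j\<le>2*k. ?C j * (char \<mu> (?u j) - p (of_real (?u j))))
          \<le> 4 ^ k * (B * (real k * h) ^ (2 * k))" by (simp add: power_mult)
      show "cmod (\<Sum>j\<le>2*k. ?C j * p (of_real (?u j))) \<le> 4 ^ k * (B * (2 * (real k * h) ^ (2 * k)))"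
        using h by (intro alternating_sum_holomorphic_le hol B) auto
    qed
    also have "\<dots> = 3 * 4 ^ k * B * real k ^ (2 * k) * h ^ (2 * k)"
      by (simp add: power_mult_distrib)
    finally show ?thesis .
  qed
  \<comment> \<open>steps small enough that \<open>k h \<le> 1/2\<close>\<close>
  define h where "h n = 1 / real (n + 2 * k)" for n
  have h0: "0 < h n" for n using k by (simp add: h_def)
  have hk: "real k * h n \<le> 1 / 2" for n using k by (simp add: h_def field_simps)
  have hlim: "h \<longlonglongrightarrow> 0"
    unfolding h_def by (rule LIMSEQ_ignore_initial_segment[OF lim_1_over_n])
  have lim: "(\<lambda>n. f (h n) x / h n ^ (2 * k)) \<longlonglongrightarrow> x ^ (2 * k)" for x
  proof -
    have "((\<lambda>z. exp (\<i> * z * of_real x)) has_field_derivative \<i> * of_real x) (at (0::complex))"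
      by (auto intro!: derivative_eq_intros)
    then have "((\<lambda>z::complex. (exp (\<i> * z * of_real x) - 1) / z) \<longlongrightarrow> \<i> * of_real x) (at 0)"
      by (simp add: DERIV_def)
    moreover have "filterlim (\<lambda>n. complex_of_real (h n)) (at 0) sequentially"
      using tendsto_of_real[OF hlim, where 'a=complex] h0 by (auto simp: filterlim_at less_imp_neq[symmetric])
    ultimately have "(\<lambda>n. (exp (\<i> * of_real (h n) * of_real x) - 1) / of_real (h n)) \<longlonglongrightarrow> \<i> * of_real x"
      by (rule filterlim_compose)
    then have "(\<lambda>n. (iexp (h n * x) - 1) /\<^sub>R h n) \<longlonglongrightarrow> \<i> * of_real x"
      by (simp add: scaleR_conv_of_real divide_inverse mult_ac)
    then have "(\<lambda>n. cmod ((iexp (h n * x) - 1) /\<^sub>R h n) ^ (2 * k)) \<longlonglongrightarrow> cmod (\<i> * of_real x) ^ (2 * k)"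
      by (intro tendsto_intros)
    moreover have "\<bar>h n\<bar> = h n" for n using h0[of n] by simp
    moreover have "(\<bar>x\<bar> ^ k)\<^sup>2 = (x ^ k)\<^sup>2" by (simp flip: power_abs)
    ultimately show ?thesis
      by (simp add: f_def norm_mult power_mult power_mult_distrib divide_inverse mult_ac power_inverse)
  qed
  have "(\<integral>\<^sup>+x. ennreal (x ^ (2 * k)) \<partial>\<mu>) = (\<integral>\<^sup>+x. liminf (\<lambda>n. ennreal (f (h n) x / h n ^ (2 * k))) \<partial>\<mu>)"
    by (intro nn_integral_cong lim_imp_Liminf[symmetric] tendsto_ennrealI lim) auto
  also have "\<dots> \<le> liminf (\<lambda>n. \<integral>\<^sup>+x. ennreal (f (h n) x / h n ^ (2 * k)) \<partial>\<mu>)"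
    by (rule nn_integral_liminf) measurable
  also have "\<dots> \<le> liminf (\<lambda>n. ennreal (3 * 4 ^ k * B * real k ^ (2 * k)))"
  proof (rule Liminf_mono[OF always_eventually], rule allI)
    fix n
    have "(\<integral>\<^sup>+x. ennreal (f (h n) x / h n ^ (2 * k)) \<partial>\<mu>) = ennreal (LINT x|\<mu>. f (h n) x / h n ^ (2 * k))"
    proof (rule nn_integral_eq_integral)
      show "integrable \<mu> (\<lambda>x. f (h n) x / h n ^ (2 * k))" using fint by simp
      show "AE x in \<mu>. 0 \<le> f (h n) x / h n ^ (2 * k)" using h0[of n] by (simp add: f_def)
    qed
    also have "(LINT x|\<mu>. f (h n) x / h n ^ (2 * k)) = (LINT x|\<mu>. f (h n) x) / h n ^ (2 * k)" by simp
    also have "\<dots> \<le> 3 * 4 ^ k * B * real k ^ (2 * k)"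
      using fle[OF h0[of n] hk[of n]] h0[of n] by (simp add: divide_le_eq)
    finally show "(\<integral>\<^sup>+x. ennreal (f (h n) x / h n ^ (2 * k)) \<partial>\<mu>) \<le> ennreal (3 * 4 ^ k * B * real k ^ (2 * k))"
      by (simp add: ennreal_leI)
  qed
  also have "\<dots> = ennreal (3 * 4 ^ k * B * real k ^ (2 * k))" by (simp add: Liminf_const)
  finally show ?thesis .
qed

text \<open>
  The exponential of the cumulant polynomial is entire, and replacing the exponent \<open>\<Psi>\<close> by this
  polynomial changes the characteristic function by \<open>O(u\<^sup>2\<^sup>k)\<close>. The constant is chosen before the distribution
  so that it can serve all times at once.
\<close>

lemma moment_bound_of_cumulant_expansion:
  fixes B :: real
  assumes k: "0 < k"
  shows "\<exists>K::real. \<forall>\<mu> \<Psi> a. real_distribution \<mu> \<longrightarrow> (\<forall>u. char \<mu> u = exp (\<Psi> u)) \<longrightarrow>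
      (\<forall>n<2*k. cmod (a n) \<le> B) \<longrightarrow>
      (\<forall>u. \<bar>u\<bar> \<le> 1 \<longrightarrow> cmod (\<Psi> u - (\<Sum>n<2*k. a n * of_real u ^ n)) \<le> B * \<bar>u\<bar> ^ (2 * k)) \<longrightarrow>
      (\<integral>\<^sup>+x. ennreal (x ^ (2 * k)) \<partial>\<mu>) \<le> ennreal K"
proof (intro exI allI impI)
  fix \<mu> and \<Psi> :: "real \<Rightarrow> complex" and a :: "nat \<Rightarrow> complex"
  assume \<mu>: "real_distribution \<mu>" and char: "\<forall>u. char \<mu> u = exp (\<Psi> u)"
    and a: "\<forall>n<2*k. cmod (a n) \<le> B"
    and R: "\<forall>u. \<bar>u\<bar> \<le> 1 \<longrightarrow> cmod (\<Psi> u - (\<Sum>n<2*k. a n * of_real u ^ n)) \<le> B * \<bar>u\<bar> ^ (2 * k)"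
  have "cmod (a 0) \<le> B" using a k by simp
  then have B0: "0 \<le> B" by (meson norm_ge_zero order_trans)
  define q where "q z = (\<Sum>n<2*k. a n * z ^ n)" for z :: complex
  define B' where "B' = exp (2 * real k * B) * (1 + B * exp B)"
  have q: "cmod (q z) \<le> 2 * real k * B" if "cmod z \<le> 1" for z
  proof -
    have "cmod (q z) \<le> (\<Sum>n<2*k. B)" unfolding q_def
    proof (rule sum_norm_le)
      fix n assume "n \<in> {..<2*k}"
      then have "cmod (a n) * cmod z ^ n \<le> B * 1"
        using a that B0 by (intro mult_mono power_le_one) auto
      then show "cmod (a n * z ^ n) \<le> B" by (simp add: norm_mult norm_power)
    qed
    then show ?thesis by simp
  qed
  have expq: "cmod (exp (q z)) \<le> exp (2 * real k * B)" if "cmod z \<le> 1" for z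
    using q[OF that] norm_exp[of "q z"] by (meson exp_le_cancel_iff order_trans)
  have e1: "exp (2 * real k * B) \<le> B'"
    unfolding B'_def using B0 by simp
  have "(\<integral>\<^sup>+x. ennreal (x ^ (2 * k)) \<partial>\<mu>) \<le> ennreal (3 * 4 ^ k * B' * real k ^ (2 * k))"
  proof (rule moment_le_of_char_approx[OF \<mu> _ _ _ k, where p="\<lambda>z. exp (q z)"])
    show "(\<lambda>z. exp (q z)) holomorphic_on UNIV"
      unfolding q_def by (intro holomorphic_intros)
    show "cmod (exp (q z)) \<le> B'" if "cmod z = 1" for z
    proof -
      have "cmod (exp (q z)) \<le> exp (2 * real k * B)" by (rule expq) (use that in simp)
      with e1 show ?thesis by linarith
    qed
    show "cmod (char \<mu> u - exp (q (of_real u))) \<le> B' * \<bar>u\<bar> ^ (2 * k)" if u: "\<bar>u\<bar> \<le> 1" for u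
    proof -
      let ?r = "\<Psi> u - q (of_real u)"
      have r: "cmod ?r \<le> B * \<bar>u\<bar> ^ (2 * k)" using R u by (simp add: q_def)
      have r1: "cmod ?r \<le> B" using r B0 u power_le_one[of "\<bar>u\<bar>" "2 * k"]
        by (smt (verit, ccfv_SIG) mult_left_le abs_ge_zero)
      have "cmod (exp ?r - 1) \<le> exp \<bar>Re ?r\<bar> * cmod ?r"
        using Taylor_exp[of ?r 0] by simp
      also have "\<dots> \<le> exp B * (B * \<bar>u\<bar> ^ (2 * k))"
        using r r1 abs_Re_le_cmod[of ?r] by (intro mult_mono) auto
      finally have er: "cmod (exp ?r - 1) \<le> exp B * (B * \<bar>u\<bar> ^ (2 * k))" .
      have "char \<mu> u - exp (q (of_real u)) = exp (q (of_real u)) * (exp ?r - 1)"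
        using char by (simp add: exp_diff field_simps)
      then have "cmod (char \<mu> u - exp (q (of_real u))) = cmod (exp (q (of_real u))) * cmod (exp ?r - 1)"
        by (simp add: norm_mult)
      also have "\<dots> \<le> exp (2 * real k * B) * (exp B * (B * \<bar>u\<bar> ^ (2 * k)))"
        using expq[of "of_real u"] er u by (intro mult_mono) auto
      also have "\<dots> \<le> B' * \<bar>u\<bar> ^ (2 * k)"
        unfolding B'_def by (simp add: algebra_simps)
      finally show ?thesis .
    qed
  qed
  then show "(\<integral>\<^sup>+x. ennreal (x ^ (2 * k)) \<partial>\<mu>)
      \<le> ennreal (3 * 4 ^ k * (exp (2 * real k * B) * (1 + B * exp B)) * real k ^ (2 * k))"
    by (simp add: B'_def)
qed

section \<open>Levy kernels\<close>

text \<open>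
  A Levy measure may have infinite mass near \<open>0\<close>. Weighted with \<open>min 1 x\<^sup>2\<close> and normalised it becomes a
  sub-probability measure, and for kernels of these the measurability of parameter-dependent integrals
  is known. Dividing the integrand by the weight is harmless because it vanishes at \<open>0\<close>.
\<close>

lemma
  fixes \<kappa> :: "'s \<Rightarrow> real measure"
  assumes \<kappa>: "\<And>A. A \<in> sets borel \<Longrightarrow> (\<lambda>s. emeasure (\<kappa> s) A) \<in> borel_measurable N"
    and sets_\<kappa>: "\<And>s. s \<in> space N \<Longrightarrow> sets (\<kappa> s) = sets borel"
    and fin: "\<And>s. s \<in> space N \<Longrightarrow> (\<integral>\<^sup>+x. ennreal (min 1 (x\<^sup>2)) \<partial>\<kappa> s) < \<infinity>"
  shows nn_integral_levy_kernel_measurable: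
      "\<And>f. case_prod f \<in> borel_measurable (N \<Otimes>\<^sub>M borel) \<Longrightarrow> (\<And>s. s \<in> space N \<Longrightarrow> f s 0 = 0) \<Longrightarrow>
        (\<lambda>s. \<integral>\<^sup>+y. f s y \<partial>\<kappa> s) \<in> borel_measurable N"
    and integral_levy_kernel_measurable:
      "\<And>f :: 's \<Rightarrow> real \<Rightarrow> 'b::{banach, second_countable_topology}.
        case_prod f \<in> borel_measurable (N \<Otimes>\<^sub>M borel) \<Longrightarrow> (\<And>s. s \<in> space N \<Longrightarrow> f s 0 = 0) \<Longrightarrow>
        (\<lambda>s. integral\<^sup>L (\<kappa> s) (f s)) \<in> borel_measurable N"
proof -
  have meas_eq: "borel_measurable (\<kappa> s) = (borel_measurable borel :: (real \<Rightarrow> ennreal) set)" if "s \<in> space N" for s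
    using sets_\<kappa>[OF that] by (rule measurable_cong_sets) simp
  have meas_eqb: "borel_measurable (\<kappa> s) = (borel_measurable borel :: (real \<Rightarrow> 'b) set)" if "s \<in> space N" for s
    using sets_\<kappa>[OF that] by (rule measurable_cong_sets) simp
  have meas_eqr: "borel_measurable (\<kappa> s) = (borel_measurable borel :: (real \<Rightarrow> real) set)" if "s \<in> space N" for s
    using sets_\<kappa>[OF that] by (rule measurable_cong_sets) simp
  have fixed: "(\<lambda>s. \<integral>\<^sup>+y. g y \<partial>\<kappa> s) \<in> borel_measurable N" if "g \<in> borel_measurable borel" for g :: "real \<Rightarrow> ennreal"
    using that
  proof induction
    case (cong f g)
    then show ?case
      by (subst measurable_cong[where g="\<lambda>s. \<integral>\<^sup>+y. g y \<partial>\<kappa> s"]) (auto intro!: nn_integral_cong)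
  next
    case (set A)
    then show ?case
      by (subst measurable_cong[where g="\<lambda>s. emeasure (\<kappa> s) A"]) (auto simp: sets_\<kappa> \<kappa>)
  next
    case (mult u c)
    then have "(\<lambda>s. c * (\<integral>\<^sup>+y. u y \<partial>\<kappa> s)) \<in> borel_measurable N" by measurable
    then show ?case
      by (subst measurable_cong[where g="\<lambda>s. c * (\<integral>\<^sup>+y. u y \<partial>\<kappa> s)"])
        (auto simp: nn_integral_cmult meas_eq mult)
  next
    case (add u v)
    then have "(\<lambda>s. (\<integral>\<^sup>+y. v y \<partial>\<kappa> s) + (\<integral>\<^sup>+y. u y \<partial>\<kappa> s)) \<in> borel_measurable N" by measurable
    then show ?case
      by (subst measurable_cong[where g="\<lambda>s. (\<integral>\<^sup>+y. v y \<partial>\<kappa> s) + (\<integral>\<^sup>+y. u y \<partial>\<kappa> s)"])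
        (auto simp: nn_integral_add meas_eq add)
  next
    case (seq U)
    then have meas: "(\<lambda>s. SUP i. (\<integral>\<^sup>+y. U i y \<partial>\<kappa> s)) \<in> borel_measurable N" by measurable
    have eq: "(\<integral>\<^sup>+y. (SUP i. U i) y \<partial>\<kappa> s) = (SUP i. (\<integral>\<^sup>+y. U i y \<partial>\<kappa> s))" if "s \<in> space N" for s
      using seq that by (simp add: image_comp) (auto intro!: nn_integral_monotone_convergence_SUP simp: meas_eq)
    show ?case by (rule measurable_cong[THEN iffD2, OF eq meas])
  qed
  define m where "m s = enn2real (\<integral>\<^sup>+x. ennreal (min 1 (x\<^sup>2)) \<partial>\<kappa> s)" for s
  have m0: "0 \<le> m s" for s by (simp add: m_def)
  have m_meas [measurable]: "m \<in> borel_measurable N"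
    unfolding m_def by (intro measurable_compose[OF fixed borel_measurable_enn2real]) measurable
  \<comment> \<open>normalised, the kernel becomes sub-probability valued\<close>
  define w where "w s x = min 1 (x\<^sup>2) / (1 + m s)" for s x
  have w_meas [measurable]: "(\<lambda>(s, x). w s x) \<in> borel_measurable (N \<Otimes>\<^sub>M borel)"
    unfolding w_def by measurable
  have w0: "0 \<le> w s x" for s x using m0[of s] by (simp add: w_def)
  have w_sec [measurable]: "w s \<in> borel_measurable borel" for s unfolding w_def by measurable
  have mass: "(\<integral>\<^sup>+x. ennreal (w s x) * indicator A x \<partial>\<kappa> s)
      = ennreal (1 / (1 + m s)) * (\<integral>\<^sup>+x. ennreal (min 1 (x\<^sup>2)) * indicator A x \<partial>\<kappa> s)"
    if "s \<in> space N" "A \<in> sets borel" for s A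
  proof -
    have "ennreal (w s x) * indicator A x = ennreal (1 / (1 + m s)) * (ennreal (min 1 (x\<^sup>2)) * indicator A x)" for x
      using m0[of s] by (simp add: w_def ennreal_mult[symmetric] mult.assoc[symmetric])
    then show ?thesis using that by (simp add: nn_integral_cmult meas_eq)
  qed
  define L where "L s = density (\<kappa> s) (\<lambda>x. ennreal (w s x))" for s
  have L: "L \<in> measurable N (subprob_algebra borel)"
  proof (rule measurable_subprob_algebra)
    fix s assume s: "s \<in> space N"
    show "sets (L s) = sets borel" using s by (simp add: L_def sets_\<kappa>)
    have sp: "space (\<kappa> s) = UNIV" using sets_eq_imp_space_eq[OF sets_\<kappa>[OF s]] by simp
    have "emeasure (L s) (space (L s)) = (\<integral>\<^sup>+x. ennreal (w s x) * indicator UNIV x \<partial>\<kappa> s)"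
      unfolding L_def using s by (subst emeasure_density) (auto simp: meas_eq sets_\<kappa> sp)
    also have "\<dots> = ennreal (1 / (1 + m s)) * (\<integral>\<^sup>+x. ennreal (min 1 (x\<^sup>2)) \<partial>\<kappa> s)"
      using mass[OF s, of UNIV] by simp
    also have "(\<integral>\<^sup>+x. ennreal (min 1 (x\<^sup>2)) \<partial>\<kappa> s) = ennreal (m s)"
      using fin[OF s] by (simp add: m_def)
    also have "ennreal (1 / (1 + m s)) * ennreal (m s) \<le> 1"
      using m0[of s] by (simp add: ennreal_mult[symmetric] divide_le_eq)
    finally show "subprob_space (L s)"
      by (intro subprob_spaceI) (auto simp: L_def sp)
  next
    fix A :: "real set" assume A: "A \<in> sets borel"
    have "(\<lambda>s. ennreal (1 / (1 + m s)) * (\<integral>\<^sup>+x. ennreal (min 1 (x\<^sup>2)) * indicator A x \<partial>\<kappa> s)) \<in> borel_measurable N"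
      using A fixed[of "\<lambda>x. ennreal (min 1 (x\<^sup>2)) * indicator A x"] by measurable
    also have "?this \<longleftrightarrow> (\<lambda>s. emeasure (L s) A) \<in> borel_measurable N"
    proof (rule measurable_cong)
      fix s assume s: "s \<in> space N"
      show "ennreal (1 / (1 + m s)) * (\<integral>\<^sup>+x. ennreal (min 1 (x\<^sup>2)) * indicator A x \<partial>\<kappa> s) = emeasure (L s) A"
        unfolding L_def using s A by (subst emeasure_density) (auto simp: meas_eq sets_\<kappa> mass)
    qed
    finally show "(\<lambda>s. emeasure (L s) A) \<in> borel_measurable N" .
  qed
  {
    fix f :: "'s \<Rightarrow> real \<Rightarrow> ennreal"
    assume f [measurable]: "case_prod f \<in> borel_measurable (N \<Otimes>\<^sub>M borel)" and f0: "\<And>s. s \<in> space N \<Longrightarrow> f s 0 = 0"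
    have "(\<lambda>s. \<integral>\<^sup>+y. f s y * ennreal (1 / w s y) \<partial>L s) \<in> borel_measurable N"
      by (rule nn_integral_measurable_subprob_algebra2[OF _ L]) measurable
    also have "?this \<longleftrightarrow> (\<lambda>s. \<integral>\<^sup>+y. f s y \<partial>\<kappa> s) \<in> borel_measurable N"
    proof (rule measurable_cong)
      fix s assume s: "s \<in> space N"
      have [measurable]: "f s \<in> borel_measurable borel" using measurable_Pair2[OF f s] by simp
      have "(\<integral>\<^sup>+y. f s y * ennreal (1 / w s y) \<partial>L s)
          = (\<integral>\<^sup>+y. ennreal (w s y) * (f s y * ennreal (1 / w s y)) \<partial>\<kappa> s)"
        unfolding L_def using s by (subst nn_integral_density) (auto simp: meas_eq)
      also have "\<dots> = (\<integral>\<^sup>+y. f s y \<partial>\<kappa> s)"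
      proof (rule nn_integral_cong)
        fix y show "ennreal (w s y) * (f s y * ennreal (1 / w s y)) = f s y"
        proof (cases "y = 0")
          case False
          then have pos: "0 < w s y" using m0[of s] by (simp add: w_def min_def)
          have "ennreal (w s y) * (f s y * ennreal (1 / w s y)) = f s y * (ennreal (w s y) * ennreal (1 / w s y))"
            by (simp add: mult_ac)
          also have "ennreal (w s y) * ennreal (1 / w s y) = 1"
            using pos by (subst ennreal_mult[symmetric]) auto
          finally show ?thesis by simp
        qed (use f0[OF s] in simp)
      qed
      finally show "(\<integral>\<^sup>+y. f s y * ennreal (1 / w s y) \<partial>L s) = (\<integral>\<^sup>+y. f s y \<partial>\<kappa> s)" .
    qed
    finally show "(\<lambda>s. \<integral>\<^sup>+y. f s y \<partial>\<kappa> s) \<in> borel_measurable N" .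
  next
    fix f :: "'s \<Rightarrow> real \<Rightarrow> 'b"
    assume f [measurable]: "case_prod f \<in> borel_measurable (N \<Otimes>\<^sub>M borel)" and f0: "\<And>s. s \<in> space N \<Longrightarrow> f s 0 = 0"
    have "(\<lambda>s. \<integral>y. (1 / w s y) *\<^sub>R f s y \<partial>L s) \<in> borel_measurable N"
    proof -
      have [measurable]: "(\<lambda>(s, y). (1 / w s y) *\<^sub>R f s y) \<in> borel_measurable (N \<Otimes>\<^sub>M borel)" by measurable
      have "(\<lambda>s. integral\<^sup>L (distr (L s) (N \<Otimes>\<^sub>M borel) (Pair s)) (\<lambda>(s, y). (1 / w s y) *\<^sub>R f s y)) \<in> borel_measurable N"
        by (rule measurable_compose[OF measurable_distr2[where M=borel, OF _ L]
              integral_measurable_subprob_algebra]) measurable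
      then show ?thesis
      proof (rule measurable_cong[THEN iffD1, rotated])
        fix s assume s: "s \<in> space N"
        have "sets (L s) = sets borel" using s by (simp add: L_def sets_\<kappa>)
        then have "Pair s \<in> measurable (L s) (N \<Otimes>\<^sub>M borel)"
          using s measurable_Pair1'[of s N borel] measurable_cong_sets[of "L s" borel "N \<Otimes>\<^sub>M borel"] by simp
        from integral_distr[OF this, of "\<lambda>(s, y). (1 / w s y) *\<^sub>R f s y"]
        show "integral\<^sup>L (distr (L s) (N \<Otimes>\<^sub>M borel) (Pair s)) (\<lambda>(s, y). (1 / w s y) *\<^sub>R f s y)
            = (\<integral>y. (1 / w s y) *\<^sub>R f s y \<partial>L s)"
          by simp
      qed
    qed
    also have "?this \<longleftrightarrow> (\<lambda>s. integral\<^sup>L (\<kappa> s) (f s)) \<in> borel_measurable N"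
    proof (rule measurable_cong)
      fix s assume s: "s \<in> space N"
      have fs [measurable]: "f s \<in> borel_measurable borel" using measurable_Pair2[OF f s] by simp
      have "(\<integral>y. (1 / w s y) *\<^sub>R f s y \<partial>L s) = (\<integral>y. w s y *\<^sub>R ((1 / w s y) *\<^sub>R f s y) \<partial>\<kappa> s)"
        unfolding L_def using w0 s by (subst integral_density) (auto simp: meas_eqb meas_eqr)
      also have "\<dots> = integral\<^sup>L (\<kappa> s) (f s)"
      proof (rule Bochner_Integration.integral_cong[OF refl])
        fix y show "w s y *\<^sub>R ((1 / w s y) *\<^sub>R f s y) = f s y"
        proof (cases "y = 0")
          case False
          then have pos: "0 < w s y" using m0[of s] by (simp add: w_def min_def)
          then show ?thesis by simp
        qed (use f0[OF s] in simp)
      qed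
      finally show "(\<integral>y. (1 / w s y) *\<^sub>R f s y \<partial>L s) = integral\<^sup>L (\<kappa> s) (f s)" .
    qed
    finally show "(\<lambda>s. integral\<^sup>L (\<kappa> s) (f s)) \<in> borel_measurable N" .
  }
qed

text \<open>
  A common majorant for all integrands that occur. It is of second order at \<open>0\<close>, where
  only \<open>x\<^sup>2\<close> is integrable, and of exponential growth at a rate \<open>M\<close> that the exponential moments allow.
\<close>

definition jump_weight :: "real \<Rightarrow> real \<Rightarrow> real" where
  "jump_weight M y = min 1 (y\<^sup>2) * exp (M * \<bar>y\<bar>)"

lemma jump_weight_nonneg: "0 \<le> jump_weight M y" by (simp add: jump_weight_def)

lemma jump_weight_measurable [measurable]: "jump_weight M \<in> borel_measurable borel"
  unfolding jump_weight_def by measurable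

lemma jump_weight_cases:
  "(\<bar>y\<bar> \<le> 1 \<and> jump_weight M y = y\<^sup>2 * exp (M * \<bar>y\<bar>)) \<or> (1 < \<bar>y\<bar> \<and> jump_weight M y = exp (M * \<bar>y\<bar>))"
proof (cases "\<bar>y\<bar> \<le> 1")
  case True
  then have "y\<^sup>2 \<le> 1" by (simp add: abs_square_le_1)
  with True show ?thesis by (simp add: jump_weight_def min_def)
next
  case False
  then have "\<not> y\<^sup>2 \<le> 1" by (simp add: abs_square_le_1)
  with False show ?thesis by (simp add: jump_weight_def min_def)
qed

lemma power_le_fact_exp:
  fixes x :: real
  assumes "0 \<le> x"
  shows "x ^ n \<le> fact n * exp x"
proof -
  have "(\<lambda>n. x ^ n / fact n) sums exp x"
    using exp_converges[of x] by (simp add: field_simps)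
  then have "(\<Sum>k\<in>{n}. x ^ k / fact k) \<le> exp x"
    using assms sum_le_suminf[of "\<lambda>n. x ^ n / fact n" "{n}"] by (auto simp: sums_iff)
  then show ?thesis by (simp add: field_simps)
qed

text \<open>
  For \<open>\<bar>y\<bar> \<le> 1\<close> the factor \<open>y\<^sup>2\<close> is split off and the rest is at most \<open>M\<^sup>n \<le> n! exp M\<close>; elsewhere
  \<open>(M \<bar>y\<bar>)\<^sup>n \<le> n! exp (M \<bar>y\<bar>)\<close>.
\<close>

lemma power_le_jump_weight:
  assumes M: "0 < M" and v: "\<bar>v\<bar> \<le> M" and n: "2 \<le> n"
  shows "\<bar>v * y\<bar> ^ n \<le> fact n * exp M * jump_weight M y"
proof -
  have vy: "\<bar>v * y\<bar> ^ n \<le> (M * \<bar>y\<bar>) ^ n"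
    using v by (intro power_mono) (auto simp: abs_mult intro!: mult_right_mono)
  consider "\<bar>y\<bar> \<le> 1" "jump_weight M y = y\<^sup>2 * exp (M * \<bar>y\<bar>)"
    | "1 < \<bar>y\<bar>" "jump_weight M y = exp (M * \<bar>y\<bar>)"
    using jump_weight_cases by blast
  then show ?thesis
  proof cases
    case 1
    have "\<bar>y\<bar> ^ n \<le> \<bar>y\<bar> ^ 2" using 1 n by (intro power_decreasing) auto
    then have "(M * \<bar>y\<bar>) ^ n \<le> (fact n * exp M) * (y\<^sup>2 * exp (M * \<bar>y\<bar>))"
      unfolding power_mult_distrib using power_le_fact_exp[of M n] M
      by (intro mult_mono order_trans[of "\<bar>y\<bar> ^ n" "y\<^sup>2" "y\<^sup>2 * exp (M * \<bar>y\<bar>)"] mult_left_le_one_le)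
        (auto simp: mult_ge1_I intro!: mult_le_cancel_left1[THEN iffD2])
    with vy 1 show ?thesis by simp
  next
    case 2
    have "(M * \<bar>y\<bar>) ^ n \<le> fact n * exp (M * \<bar>y\<bar>)" using M by (intro power_le_fact_exp) auto
    also have "\<dots> \<le> fact n * exp M * exp (M * \<bar>y\<bar>)" using M by simp
    finally show ?thesis using vy 2 by simp
  qed
qed

lemma exp_minus_1_minus_le_jump_weight:
  assumes v: "\<bar>v\<bar> \<le> M"
  shows "\<bar>exp (v * y) - 1 - v * y\<bar> \<le> (1 + M\<^sup>2) * jump_weight M y"
proof -
  let ?z = "v * y"
  have M0: "0 \<le> M" using v by linarith
  have z: "\<bar>?z\<bar> \<le> M * \<bar>y\<bar>" using v by (auto simp: abs_mult intro!: mult_right_mono)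
  consider "\<bar>y\<bar> \<le> 1" "jump_weight M y = y\<^sup>2 * exp (M * \<bar>y\<bar>)"
    | "1 < \<bar>y\<bar>" "jump_weight M y = exp (M * \<bar>y\<bar>)"
    using jump_weight_cases by blast
  then show ?thesis
  proof cases
    case 1
    have "\<bar>exp ?z - 1 - ?z\<bar> \<le> exp \<bar>?z\<bar> * \<bar>?z\<bar>\<^sup>2"
      using Taylor_exp_field[of ?z 1] by (simp add: algebra_simps power2_eq_square)
    also have "\<dots> \<le> exp (M * \<bar>y\<bar>) * (M * \<bar>y\<bar>)\<^sup>2"
      using z by (intro mult_mono power_mono) auto
    also have "\<dots> \<le> (1 + M\<^sup>2) * (y\<^sup>2 * exp (M * \<bar>y\<bar>))"
      by (simp add: power_mult_distrib algebra_simps)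
    finally show ?thesis using 1 by simp
  next
    case 2
    have a: "1 + \<bar>?z\<bar> \<le> exp \<bar>?z\<bar>" by (rule exp_ge_add_one_self)
    have b: "1 + ?z \<le> exp ?z" by (rule exp_ge_add_one_self)
    have c: "exp ?z \<le> exp \<bar>?z\<bar>" by simp
    have d: "exp ?z \<le> 1" if "?z \<le> 0" using that by simp
    have "\<bar>exp ?z - 1 - ?z\<bar> \<le> exp \<bar>?z\<bar>" 
    proof (cases "?z \<le> 0")
      case True
      from d[OF this] a b True show ?thesis by linarith
    next
      case False
      with b c show ?thesis by linarith
    qed
    also have "\<dots> \<le> exp (M * \<bar>y\<bar>)" using z by simp
    also have "\<dots> \<le> (1 + M\<^sup>2) * exp (M * \<bar>y\<bar>)" by simp
    finally show ?thesis using 2 by simp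
  qed
qed

lemma abs_exp_minus_1_le: "\<bar>exp z - 1\<bar> \<le> exp \<bar>z\<bar>" "\<bar>exp z - 1\<bar> \<le> \<bar>z\<bar> * exp \<bar>z\<bar>" for z :: real
proof -
  show "\<bar>exp z - 1\<bar> \<le> exp \<bar>z\<bar>"
  proof -
    have "exp z \<le> exp \<bar>z\<bar>" "1 \<le> exp \<bar>z\<bar>" "0 < exp z" by auto
    then show ?thesis by linarith
  qed
  show "\<bar>exp z - 1\<bar> \<le> \<bar>z\<bar> * exp \<bar>z\<bar>" using Taylor_exp_field[of z 0] by (simp add: mult.commute)
qed

text \<open>
  Two distinct factors supply \<open>y\<^sup>2\<close> near \<open>0\<close>. Far out, the exponents add up to at most \<open>M\<close>; this is where
  the bound on the sum of all volatilities enters.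
\<close>

lemma prod_exp_minus_1_le_jump_weight:
  assumes fin: "finite S" and jk: "j \<in> S" "k \<in> S" "j \<noteq> k" and sum: "(\<Sum>l\<in>S. \<bar>v l\<bar>) \<le> M"
  shows "\<bar>\<Prod>l\<in>S. exp (v l * y) - 1\<bar> \<le> (1 + M\<^sup>2) * jump_weight M y"
proof -
  have "0 \<le> (\<Sum>l\<in>S. \<bar>v l\<bar>)" by (rule sum_nonneg) auto
  then have M0: "0 \<le> M" using sum by linarith
  have expM: "(\<Prod>l\<in>S. exp \<bar>v l * y\<bar>) \<le> exp (M * \<bar>y\<bar>)"
  proof -
    have "(\<Prod>l\<in>S. exp \<bar>v l * y\<bar>) = exp ((\<Sum>l\<in>S. \<bar>v l\<bar>) * \<bar>y\<bar>)"
      using fin by (simp add: exp_sum abs_mult sum_distrib_right)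
    also have "\<dots> \<le> exp (M * \<bar>y\<bar>)" using sum by (auto intro: mult_right_mono)
    finally show ?thesis .
  qed
  consider "\<bar>y\<bar> \<le> 1" "jump_weight M y = y\<^sup>2 * exp (M * \<bar>y\<bar>)"
    | "1 < \<bar>y\<bar>" "jump_weight M y = exp (M * \<bar>y\<bar>)"
    using jump_weight_cases by blast
  then show ?thesis
  proof cases
    case 1
    define r where "r l = (if l = j \<or> l = k then M * \<bar>y\<bar> else 1)" for l
    have vM: "\<bar>v l\<bar> \<le> M" if "l \<in> S" for l
      using member_le_sum[of l S "\<lambda>l. \<bar>v l\<bar>"] that fin sum by simp
    have "\<bar>\<Prod>l\<in>S. exp (v l * y) - 1\<bar> = (\<Prod>l\<in>S. \<bar>exp (v l * y) - 1\<bar>)" by (rule abs_prod)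
    also have "\<dots> \<le> (\<Prod>l\<in>S. r l * exp \<bar>v l * y\<bar>)"
    proof (rule prod_mono)
      fix l assume l: "l \<in> S"
      have "\<bar>v l * y\<bar> * exp \<bar>v l * y\<bar> \<le> M * \<bar>y\<bar> * exp \<bar>v l * y\<bar>"
        using vM[OF l] by (auto simp: abs_mult intro!: mult_right_mono)
      then show "0 \<le> \<bar>exp (v l * y) - 1\<bar> \<and> \<bar>exp (v l * y) - 1\<bar> \<le> r l * exp \<bar>v l * y\<bar>"
        using abs_exp_minus_1_le(1)[of "v l * y"] order_trans[OF abs_exp_minus_1_le(2)[of "v l * y"]]
        by (simp add: r_def)
    qed
    also have "\<dots> = (\<Prod>l\<in>S. r l) * (\<Prod>l\<in>S. exp \<bar>v l * y\<bar>)" by (rule prod.distrib)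
    also have "(\<Prod>l\<in>S. r l) = (\<Prod>l\<in>{j, k}. r l)"
      using fin jk by (intro prod.mono_neutral_right) (auto simp: r_def)
    also have "\<dots> = M\<^sup>2 * y\<^sup>2" using jk by (simp add: r_def power2_eq_square)
    also have "M\<^sup>2 * y\<^sup>2 * (\<Prod>l\<in>S. exp \<bar>v l * y\<bar>) \<le> M\<^sup>2 * y\<^sup>2 * exp (M * \<bar>y\<bar>)"
      using expM by (intro mult_left_mono) auto
    also have "\<dots> \<le> (1 + M\<^sup>2) * (y\<^sup>2 * exp (M * \<bar>y\<bar>))" by (simp add: algebra_simps)
    finally show ?thesis using 1 by simp
  next
    case 2
    have "\<bar>\<Prod>l\<in>S. exp (v l * y) - 1\<bar> = (\<Prod>l\<in>S. \<bar>exp (v l * y) - 1\<bar>)" by (rule abs_prod)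
    also have "\<dots> \<le> (\<Prod>l\<in>S. exp \<bar>v l * y\<bar>)" using abs_exp_minus_1_le by (intro prod_mono) auto
    also have "\<dots> \<le> exp (M * \<bar>y\<bar>)" by (rule expM)
    also have "\<dots> \<le> (1 + M\<^sup>2) * exp (M * \<bar>y\<bar>)" by simp
    finally show ?thesis using 2 by simp
  qed
qed

lemma iexp_minus_1_minus_le_jump_weight:
  assumes M: "0 < M"
  shows "cmod (iexp (v * y) - 1 - \<i> * of_real (v * y)) \<le> v\<^sup>2 * (1 + 1 / M\<^sup>2) * jump_weight M y"
proof -
  have a: "cmod (iexp (v * y) - 1 - \<i> * of_real (v * y)) \<le> v\<^sup>2 * y\<^sup>2 / 2"
    using iexp_approx1[of "v * y" 1] by (simp add: algebra_simps power2_eq_square abs_mult_self_eq)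
  consider "\<bar>y\<bar> \<le> 1" "jump_weight M y = y\<^sup>2 * exp (M * \<bar>y\<bar>)"
    | "1 < \<bar>y\<bar>" "jump_weight M y = exp (M * \<bar>y\<bar>)"
    using jump_weight_cases by blast
  then show ?thesis
  proof cases
    case 1
    have "v\<^sup>2 * y\<^sup>2 / 2 \<le> v\<^sup>2 * y\<^sup>2 * 1" by simp
    also have "\<dots> \<le> v\<^sup>2 * y\<^sup>2 * ((1 + 1 / M\<^sup>2) * exp (M * \<bar>y\<bar>))"
    proof (intro mult_left_mono)
      have "1 * 1 \<le> (1 + 1 / M\<^sup>2) * exp (M * \<bar>y\<bar>)" using M by (intro mult_mono) auto
      then show "1 \<le> (1 + 1 / M\<^sup>2) * exp (M * \<bar>y\<bar>)" by simp
    qed auto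
    finally show ?thesis using 1 a by (simp add: mult_ac)
  next
    case 2
    have "(M * \<bar>y\<bar>) ^ 2 \<le> fact 2 * exp (M * \<bar>y\<bar>)" using M by (intro power_le_fact_exp) auto
    then have "y\<^sup>2 / 2 \<le> exp (M * \<bar>y\<bar>) / M\<^sup>2"
      using M by (simp add: power_mult_distrib field_simps)
    then have "v\<^sup>2 * (y\<^sup>2 / 2) \<le> v\<^sup>2 * (exp (M * \<bar>y\<bar>) / M\<^sup>2)" by (intro mult_left_mono) auto
    also have "\<dots> \<le> v\<^sup>2 * ((1 + 1 / M\<^sup>2) * exp (M * \<bar>y\<bar>))"
      by (intro mult_left_mono) (auto simp: algebra_simps)
    finally show ?thesis using 2 a by (simp add: mult_ac)
  qed
qed

section \<open>The drift as a polynomial in the weights\<close>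

lemma nn_integral_cmult_add_add:
  assumes "f \<in> borel_measurable A" "g \<in> borel_measurable A" "h \<in> borel_measurable A"
  shows "(\<integral>\<^sup>+x. C * f x + (g x + h x) \<partial>A) = C * (\<integral>\<^sup>+x. f x \<partial>A) + ((\<integral>\<^sup>+x. g x \<partial>A) + (\<integral>\<^sup>+x. h x \<partial>A))"
  using assms by (simp add: nn_integral_add nn_integral_cmult)

context levy_libor
begin

abbreviation Tstar :: real where "Tstar \<equiv> T (Suc N)"

abbreviation (input) libor_drift :: "real \<Rightarrow> nat \<Rightarrow> (nat \<Rightarrow> real) \<Rightarrow> real" where
  "libor_drift \<equiv> drift N T lam c \<nu>"

abbreviation time_space :: "real measure" where "time_space \<equiv> restrict_space borel {0..Tstar}"

lemma tenor_mono: "i \<le> j \<Longrightarrow> j \<le> Suc N \<Longrightarrow> T i \<le> T j"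
proof (induction rule: dec_induct)
  case (step n)
  then have "T i \<le> T n" "T n < T (Suc n)" using tenor_increasing[of n] by auto
  then show ?case by simp
qed simp

lemma tenor_nonneg: "i \<le> Suc N \<Longrightarrow> 0 \<le> T i"
  using tenor_mono[of 0 i] tenor_start by simp

lemma tenor_le_Tstar: "i \<le> Suc N \<Longrightarrow> T i \<le> Tstar"
  using tenor_mono[of i "Suc N"] by simp

lemma accrual_pos: "l \<le> N \<Longrightarrow> 0 < accrual T l"
  using tenor_increasing[of l] by (simp add: accrual_def)

lemma driver_facts:
  shows c_measurable: "c \<in> borel_measurable time_space"
    and nu_kernel: "A \<in> sets borel \<Longrightarrow> (\<lambda>s. emeasure (\<nu> s) A) \<in> borel_measurable time_space"
    and c_nonneg: "s \<in> {0..Tstar} \<Longrightarrow> 0 \<le> c s"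
    and nu_levy: "s \<in> {0..Tstar} \<Longrightarrow> levy_measure (\<nu> s)"
    and H_adapted: "t \<in> {0..Tstar} \<Longrightarrow> H t \<in> borel_measurable (F t)"
    and H_cadlag: "\<omega> \<in> space P \<Longrightarrow> cadlag_on Tstar (\<lambda>t. H t \<omega>)"
    and H_indep: "0 \<le> s \<Longrightarrow> s < t \<Longrightarrow> t \<le> Tstar \<Longrightarrow> indep_set (sets (F s))
          (sets (vimage_algebra (space P) (\<lambda>\<omega>. H t \<omega> - H s \<omega>) borel))"
    and H_char: "t \<in> {0..Tstar} \<Longrightarrow> (CLINT \<omega>|P. iexp (u * H t \<omega>)) =
        exp (CLINT s:{0..t}|lborel. levy_exponent 0 (c s) (\<nu> s) u)"
  using driver unfolding time_inhom_levy_def adapted_on_def by auto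

lemma nu_facts:
  assumes "s \<in> {0..Tstar}"
  shows sets_nu: "sets (\<nu> s) = sets borel"
    and nu_truncated: "(\<integral>\<^sup>+x. ennreal (min 1 (x\<^sup>2)) \<partial>\<nu> s) < \<infinity>"
  using nu_levy[OF assms] by (auto simp: levy_measure_def)

lemma measurable_nu:
  assumes "s \<in> {0..Tstar}" "f \<in> borel_measurable borel"
  shows "f \<in> borel_measurable (\<nu> s)"
  using assms sets_nu measurable_cong_sets[of "\<nu> s" borel borel borel] by (metis measurable_cong_sets)

lemma nn_integral_nu_measurable:
  assumes "case_prod f \<in> borel_measurable (time_space \<Otimes>\<^sub>M borel)" "\<And>s. s \<in> {0..Tstar} \<Longrightarrow> f s 0 = 0"
  shows "(\<lambda>s. \<integral>\<^sup>+y. f s y \<partial>\<nu> s) \<in> borel_measurable time_space"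
  by (rule nn_integral_levy_kernel_measurable) (use assms nu_kernel sets_nu nu_truncated in auto)

lemma integral_nu_measurable:
  fixes f :: "real \<Rightarrow> real \<Rightarrow> 'b::{banach, second_countable_topology}"
  assumes "case_prod f \<in> borel_measurable (time_space \<Otimes>\<^sub>M borel)" "\<And>s. s \<in> {0..Tstar} \<Longrightarrow> f s 0 = 0"
  shows "(\<lambda>s. integral\<^sup>L (\<nu> s) (f s)) \<in> borel_measurable time_space"
  by (rule integral_levy_kernel_measurable) (use assms nu_kernel sets_nu nu_truncated in auto)

abbreviation (input) tail_moment :: "real \<Rightarrow> real \<Rightarrow> ennreal" where
  "tail_moment u s \<equiv> \<integral>\<^sup>+x\<in>{x. 1 < \<bar>x\<bar>}. ennreal (exp (u * x)) \<partial>\<nu> s"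

lemma pm_M_mem: "M \<in> {- (1 + e) * M..(1 + e) * M}" "- M \<in> {- (1 + e) * M..(1 + e) * M}"
  using M_pos e_pos by (auto simp: algebra_simps)

lemma jump_weight_le:
  "ennreal (jump_weight M y) \<le> ennreal (exp M) * ennreal (min 1 (y\<^sup>2))
    + (ennreal (exp (M * y)) * indicator {x. 1 < \<bar>x\<bar>} y + ennreal (exp (- M * y)) * indicator {x. 1 < \<bar>x\<bar>} y)"
proof -
  consider "\<bar>y\<bar> \<le> 1" "jump_weight M y = y\<^sup>2 * exp (M * \<bar>y\<bar>)"
    | "1 < \<bar>y\<bar>" "jump_weight M y = exp (M * \<bar>y\<bar>)"
    using jump_weight_cases by blast
  then show ?thesis
  proof cases
    case 1
    then have "y\<^sup>2 \<le> 1" by (simp add: abs_square_le_1)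
    then have "jump_weight M y \<le> exp M * min 1 (y\<^sup>2)"
    proof -
      have "M * \<bar>y\<bar> \<le> M" using 1(1) M_pos by simp
      then have "y\<^sup>2 * exp (M * \<bar>y\<bar>) \<le> y\<^sup>2 * exp M" by (intro mult_left_mono) auto
      then show ?thesis using 1 \<open>y\<^sup>2 \<le> 1\<close> by (simp add: mult.commute)
    qed
    then have "ennreal (jump_weight M y) \<le> ennreal (exp M * min 1 (y\<^sup>2))" by (rule ennreal_leI)
    also have "\<dots> = ennreal (exp M) * ennreal (min 1 (y\<^sup>2))" by (rule ennreal_mult) auto
    finally show ?thesis by (simp add: add_increasing2)
  next
    case 2
    have "jump_weight M y \<le> exp (M * y) + exp (- M * y)"
      using 2 by (cases "0 \<le> y") auto
    then have "ennreal (jump_weight M y) \<le> ennreal (exp (M * y)) + ennreal (exp (- M * y))"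
      by (simp flip: ennreal_plus add: ennreal_leI)
    with 2 show ?thesis by (simp add: add_increasing)
  qed
qed

lemma nn_jump_weight_le:
  assumes "s \<in> {0..Tstar}"
  shows "(\<integral>\<^sup>+y. ennreal (jump_weight M y) \<partial>\<nu> s)
    \<le> ennreal (exp M) * (\<integral>\<^sup>+x. ennreal (min 1 (x\<^sup>2)) \<partial>\<nu> s) + (tail_moment M s + tail_moment (- M) s)"
proof -
  have meas: "(\<lambda>x. ennreal (min 1 (x\<^sup>2))) \<in> borel_measurable (\<nu> s)"
    "(\<lambda>x. ennreal (exp (u * x)) * indicator {x. 1 < \<bar>x\<bar>} x) \<in> borel_measurable (\<nu> s)" for u
    by (rule measurable_nu[OF assms], measurable)+
  have "(\<integral>\<^sup>+y. ennreal (jump_weight M y) \<partial>\<nu> s) \<le> (\<integral>\<^sup>+y. ennreal (exp M) * ennreal (min 1 (y\<^sup>2))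
    + (ennreal (exp (M * y)) * indicator {x. 1 < \<bar>x\<bar>} y + ennreal (exp (- M * y)) * indicator {x. 1 < \<bar>x\<bar>} y) \<partial>\<nu> s)"
    by (intro nn_integral_mono jump_weight_le)
  also have "\<dots> = ennreal (exp M) * (\<integral>\<^sup>+x. ennreal (min 1 (x\<^sup>2)) \<partial>\<nu> s) + (tail_moment M s + tail_moment (- M) s)"
    by (intro nn_integral_cmult_add_add meas)
  finally show ?thesis .
qed

lemma integrable_jump_weight:
  assumes "s \<in> {0..Tstar}"
  shows "integrable (\<nu> s) (jump_weight M)"
proof (rule integrableI_bounded)
  show "jump_weight M \<in> borel_measurable (\<nu> s)" by (rule measurable_nu[OF assms]) measurable
  have "(\<integral>\<^sup>+y. ennreal (norm (jump_weight M y)) \<partial>\<nu> s) = (\<integral>\<^sup>+y. ennreal (jump_weight M y) \<partial>\<nu> s)"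
    by (simp add: jump_weight_nonneg)
  also have "\<dots> \<le> ennreal (exp M) * (\<integral>\<^sup>+x. ennreal (min 1 (x\<^sup>2)) \<partial>\<nu> s) + (tail_moment M s + tail_moment (- M) s)"
    by (rule nn_jump_weight_le[OF assms])
  also have "\<dots> < \<infinity>"
    using nu_truncated[OF assms] exponential_moments_pointwise[OF pm_M_mem(1) assms]
      exponential_moments_pointwise[OF pm_M_mem(2) assms]
    by (simp add: ennreal_mult_less_top)
  finally show "(\<integral>\<^sup>+y. ennreal (norm (jump_weight M y)) \<partial>\<nu> s) < \<infinity>" .
qed

definition jump_mass :: "real \<Rightarrow> real" where
  "jump_mass s = (LINT y|\<nu> s. jump_weight M y)"

text \<open>
  Up to constants, this bounds at time \<open>s\<close> every coefficient of the drift and the characteristic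
  exponent of \<open>H\<close>, and it is integrable over the horizon.
\<close>

definition activity :: "real \<Rightarrow> real" where
  "activity s = c s + jump_mass s"

lemma jump_mass_nonneg: "0 \<le> jump_mass s"
  by (simp add: jump_mass_def jump_weight_nonneg)

lemma jump_mass_le_activity: "s \<in> {0..Tstar} \<Longrightarrow> jump_mass s \<le> activity s"
  and c_le_activity: "s \<in> {0..Tstar} \<Longrightarrow> c s \<le> activity s"
  and activity_nonneg: "s \<in> {0..Tstar} \<Longrightarrow> 0 \<le> activity s"
  using c_nonneg jump_mass_nonneg by (auto simp: activity_def)

lemma jump_integral:
  fixes f :: "real \<Rightarrow> 'b::{banach, second_countable_topology}"
  assumes s: "s \<in> {0..Tstar}" and f: "f \<in> borel_measurable borel"
    and le: "\<And>y. norm (f y) \<le> K * jump_weight M y"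
  shows "integrable (\<nu> s) f" "norm (integral\<^sup>L (\<nu> s) f) \<le> K * jump_mass s"
proof -
  have Kw: "integrable (\<nu> s) (\<lambda>y. K * jump_weight M y)" using integrable_jump_weight[OF s] by simp
  have f': "f \<in> borel_measurable (\<nu> s)"
    using f sets_nu[OF s] measurable_cong_sets by blast
  show int: "integrable (\<nu> s) f"
    by (rule Bochner_Integration.integrable_bound[OF Kw f']) (use le in \<open>auto intro: order_trans[OF _ abs_ge_self]\<close>)
  have "norm (integral\<^sup>L (\<nu> s) f) \<le> (LINT y|\<nu> s. norm (f y))" by (rule integral_norm_bound)
  also have "\<dots> \<le> (LINT y|\<nu> s. K * jump_weight M y)"
    using int Kw le by (intro integral_mono) auto
  finally show "norm (integral\<^sup>L (\<nu> s) f) \<le> K * jump_mass s" by (simp add: jump_mass_def)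
qed

lemma jump_mass_measurable [measurable]: "jump_mass \<in> borel_measurable time_space"
  unfolding jump_mass_def by (rule integral_nu_measurable) (auto simp: jump_weight_def)

lemma activity_measurable [measurable]: "activity \<in> borel_measurable time_space"
  unfolding activity_def using c_measurable by measurable

lemma time_space_measurable_indicator:
  fixes f :: "real \<Rightarrow> 'b::real_normed_vector"
  assumes "f \<in> borel_measurable time_space" "A \<in> sets borel" "A \<subseteq> {0..Tstar}"
  shows "(\<lambda>s. indicator A s *\<^sub>R f s) \<in> borel_measurable borel"
proof -
  have "f \<in> borel_measurable (restrict_space borel A)"
    using measurable_restrict_mono[OF assms(1,3)] .
  then show ?thesis using assms(2) by (subst (asm) borel_measurable_restrict_space_iff) auto
qed

lemma activity_set_integrable: "set_integrable lborel {0..Tstar} activity"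
  unfolding set_integrable_def
proof (rule integrableI_bounded)
  show "(\<lambda>s. indicator {0..Tstar} s *\<^sub>R activity s) \<in> borel_measurable lborel"
    using time_space_measurable_indicator[of activity "{0..Tstar}"] by simp
  let ?m = "\<lambda>s. \<integral>\<^sup>+x. ennreal (min 1 (x\<^sup>2)) \<partial>\<nu> s"
  have meas: "?m \<in> borel_measurable time_space" "tail_moment u \<in> borel_measurable time_space" for u
    by (rule nn_integral_nu_measurable; simp)+
  have cm: "(\<lambda>s. ennreal (c s)) \<in> borel_measurable time_space" using c_measurable by measurable
  have ind [measurable]: "(\<lambda>s. f s * indicator {0..Tstar} s) \<in> borel_measurable borel"
    if "f \<in> borel_measurable time_space" for f :: "real \<Rightarrow> ennreal"
    using that by (subst (asm) borel_measurable_restrict_space_iff_ennreal) auto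
  have "ennreal (norm (indicator {0..Tstar} s *\<^sub>R activity s))
     \<le> ennreal (1 + exp M) * ((ennreal (c s) + ?m s) * indicator {0..Tstar} s)
       + (tail_moment M s * indicator {0..Tstar} s + tail_moment (- M) s * indicator {0..Tstar} s)" for s
  proof (cases "s \<in> {0..Tstar}")
    case s: True
    have "ennreal (norm (indicator {0..Tstar} s *\<^sub>R activity s)) = ennreal (c s) + ennreal (jump_mass s)"
      using s c_nonneg[OF s] jump_mass_nonneg[of s] by (simp add: activity_def ennreal_plus[symmetric] del: ennreal_plus)
    also have "ennreal (jump_mass s) = (\<integral>\<^sup>+y. ennreal (jump_weight M y) \<partial>\<nu> s)"
      unfolding jump_mass_def
      by (rule nn_integral_eq_integral[symmetric]) (auto intro: integrable_jump_weight[OF s] simp: jump_weight_nonneg)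
    also have "\<dots> \<le> ennreal (exp M) * ?m s + (tail_moment M s + tail_moment (- M) s)"
      by (rule nn_jump_weight_le[OF s])
    also have "ennreal (c s) + (ennreal (exp M) * ?m s + (tail_moment M s + tail_moment (- M) s))
        \<le> ennreal (1 + exp M) * (ennreal (c s) + ?m s) + (tail_moment M s + tail_moment (- M) s)"
    proof -
      have "1 * ennreal (c s) \<le> ennreal (1 + exp M) * ennreal (c s)"
        by (intro mult_right_mono) (auto simp: ennreal_1[symmetric] intro!: ennreal_leI simp del: ennreal_1)
      moreover have "ennreal (exp M) * ?m s \<le> ennreal (1 + exp M) * ?m s"
        by (intro mult_right_mono ennreal_leI) auto
      ultimately have "ennreal (c s) + ennreal (exp M) * ?m s \<le> ennreal (1 + exp M) * (ennreal (c s) + ?m s)"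
        by (simp add: distrib_left add_mono)
      then show ?thesis by (simp add: add.assoc[symmetric] add_right_mono)
    qed
    finally show ?thesis using s by simp
  qed simp
  then have "(\<integral>\<^sup>+s. ennreal (norm (indicator {0..Tstar} s *\<^sub>R activity s)) \<partial>lborel)
      \<le> (\<integral>\<^sup>+s. ennreal (1 + exp M) * ((ennreal (c s) + ?m s) * indicator {0..Tstar} s)
       + (tail_moment M s * indicator {0..Tstar} s + tail_moment (- M) s * indicator {0..Tstar} s) \<partial>lborel)"
    by (rule nn_integral_mono)
  also have "\<dots> = ennreal (1 + exp M) * (\<integral>\<^sup>+s. (ennreal (c s) + ?m s) * indicator {0..Tstar} s \<partial>lborel)
      + ((\<integral>\<^sup>+s. tail_moment M s * indicator {0..Tstar} s \<partial>lborel)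
         + (\<integral>\<^sup>+s. tail_moment (- M) s * indicator {0..Tstar} s \<partial>lborel))"
    by (intro nn_integral_cmult_add_add; unfold measurable_lborel2;
        rule ind[OF borel_measurable_add[OF cm meas(1)]] ind[OF meas(2)])
  also have "\<dots> < \<infinity>"
    using characteristics_integrable exponential_moments[OF pm_M_mem(1)] exponential_moments[OF pm_M_mem(2)]
    by (simp add: ennreal_mult_less_top)
  finally show "(\<integral>\<^sup>+s. ennreal (norm (indicator {0..Tstar} s *\<^sub>R activity s)) \<partial>lborel) < \<infinity>" .
qed

definition activity_total :: real where
  "activity_total = (LINT s:{0..Tstar}|lborel. activity s)"

lemma activity_total_nonneg: "0 \<le> activity_total"
  unfolding activity_total_def set_lebesgue_integral_def
  by (rule Bochner_Integration.integral_nonneg) (auto simp: indicator_def activity_nonneg)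

lemma time_integral_activity:
  fixes f :: "real \<Rightarrow> 'b::{banach, second_countable_topology}"
  assumes f: "f \<in> borel_measurable time_space" and A: "A \<in> sets borel" "A \<subseteq> {0..Tstar}"
    and le: "\<And>s. s \<in> {0..Tstar} \<Longrightarrow> norm (f s) \<le> K * activity s" and K: "0 \<le> K"
  shows "set_integrable lborel A f" "norm (LINT s:A|lborel. f s) \<le> K * activity_total"
proof -
  have int: "integrable lborel (\<lambda>s. K * (indicator {0..Tstar} s *\<^sub>R activity s))"
    using activity_set_integrable by (intro integrable_mult_right) (simp add: set_integrable_def)
  have pt: "norm (indicator A s *\<^sub>R f s) \<le> K * (indicator {0..Tstar} s *\<^sub>R activity s)" for s
  proof (cases "s \<in> A")
    case True
    then have "s \<in> {0..Tstar}" using A by auto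
    with True le[OF this] show ?thesis by simp
  qed (auto simp: indicator_def activity_nonneg K)
  have m: "(\<lambda>s. indicator A s *\<^sub>R f s) \<in> borel_measurable lborel"
    using time_space_measurable_indicator[OF f A] by simp
  show "set_integrable lborel A f"
    unfolding set_integrable_def
    by (rule Bochner_Integration.integrable_bound[OF int m]) (use pt in \<open>auto intro: order_trans[OF _ abs_ge_self]\<close>)
  then have i: "integrable lborel (\<lambda>s. indicator A s *\<^sub>R f s)" by (simp add: set_integrable_def)
  have "norm (LINT s:A|lborel. f s) \<le> (LINT s|lborel. norm (indicator A s *\<^sub>R f s))"
    unfolding set_lebesgue_integral_def by (rule integral_norm_bound)
  also have "\<dots> \<le> (LINT s|lborel. K * (indicator {0..Tstar} s *\<^sub>R activity s))"
    by (intro integral_mono integrable_norm[OF i] int pt)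
  also have "\<dots> = K * activity_total" by (simp add: activity_total_def set_lebesgue_integral_def)
  finally show "norm (LINT s:A|lborel. f s) \<le> K * activity_total" .
qed

lemma vol_le_M:
  assumes "l \<in> {1..N}" "s \<in> {0..Tstar}"
  shows "\<bar>lam s l\<bar> \<le> M"
  using member_le_sum[of l "{1..N}" "\<lambda>l. \<bar>lam s l\<bar>"] vol_sum[OF assms(2)] assms(1) by simp

lemma vol_measurable:
  assumes l: "l \<in> {1..N}"
  shows "(\<lambda>s. lam s l) \<in> borel_measurable time_space"
proof -
  have "(\<lambda>s. indicator {0..T l} s *\<^sub>R lam s l) \<in> borel_measurable borel"
    by (rule borel_measurable_continuous_on_indicator[OF _ vol_continuous[OF l]]) simp
  then have "(\<lambda>s. indicator {0..T l} s *\<^sub>R lam s l) \<in> borel_measurable time_space"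
    by (rule measurable_restrict_space1)
  then show ?thesis
    by (rule measurable_cong[THEN iffD1, rotated]) (use vol_extension[OF l] in \<open>auto simp: indicator_def\<close>)
qed

text \<open>
  The \<open>S\<close>-term of \<open>(exp (\<lambda>\<^sub>l y) - 1) \<Prod>\<^sub>m (w\<^sub>m (exp (\<lambda>\<^sub>m y) - 1) + 1) - \<lambda>\<^sub>l y\<close>, multiplied out over the
  maturities \<open>m > l\<close>, without its weights. The compensator \<open>\<lambda>\<^sub>l y\<close> belongs to \<open>S = \<emptyset>\<close>, the only
  term that is of first order at \<open>0\<close>.
\<close>

definition jump_factor :: "nat \<Rightarrow> nat set \<Rightarrow> real \<Rightarrow> real \<Rightarrow> real" where
  "jump_factor l S s y =
     (exp (lam s l * y) - 1) * (\<Prod>m\<in>S. exp (lam s m * y) - 1) - (if S = {} then lam s l * y else 0)"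

lemma jump_factor_le:
  assumes l: "l \<in> {1..N}" and S: "S \<subseteq> {l+1..N}" and s: "s \<in> {0..Tstar}"
  shows "\<bar>jump_factor l S s y\<bar> \<le> (1 + M\<^sup>2) * jump_weight M y"
proof (cases "S = {}")
  case True
  then show ?thesis
    using exp_minus_1_minus_le_jump_weight[OF vol_le_M[OF l s], of y] by (simp add: jump_factor_def)
next
  case False
  then obtain m where m: "m \<in> S" by auto
  have fin: "finite S" using S finite_subset by blast
  have lS: "l \<notin> S" using S by auto
  have "(\<Sum>k\<in>insert l S. \<bar>lam s k\<bar>) \<le> (\<Sum>k\<in>{1..N}. \<bar>lam s k\<bar>)"
    using S l by (intro sum_mono2) auto
  then have "(\<Sum>k\<in>insert l S. \<bar>lam s k\<bar>) \<le> M" using vol_sum[OF s] by linarith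
  then have "\<bar>\<Prod>k\<in>insert l S. exp (lam s k * y) - 1\<bar> \<le> (1 + M\<^sup>2) * jump_weight M y"
    using prod_exp_minus_1_le_jump_weight[of "insert l S" l m "lam s" M y] fin m lS by auto
  then show ?thesis using False fin lS by (simp add: jump_factor_def)
qed

lemma jump_factor_measurable:
  assumes l: "l \<in> {1..N}" and S: "S \<subseteq> {l+1..N}"
  shows "case_prod (jump_factor l S) \<in> borel_measurable (time_space \<Otimes>\<^sub>M borel)"
proof -
  have [measurable]: "(\<lambda>z. lam (fst z) m) \<in> borel_measurable (time_space \<Otimes>\<^sub>M (borel :: real measure))" if "m \<in> {1..N}" for m
    by (rule measurable_compose[OF measurable_fst vol_measurable[OF that]])
  have "(\<lambda>z. jump_factor l S (fst z) (snd z)) \<in> borel_measurable (time_space \<Otimes>\<^sub>M borel)"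
    unfolding jump_factor_def using l S
    by (intro borel_measurable_diff borel_measurable_times borel_measurable_prod borel_measurable_exp
        borel_measurable_const measurable_If measurable_snd) auto
  then show ?thesis by (simp add: case_prod_beta')
qed

definition drift_coeff :: "nat \<Rightarrow> nat set \<Rightarrow> real \<Rightarrow> real" where
  "drift_coeff l S s = - (LINT y|\<nu> s. jump_factor l S s y)"

lemma drift_coeff_measurable:
  assumes l: "l \<in> {1..N}" and S: "S \<subseteq> {l+1..N}"
  shows "drift_coeff l S \<in> borel_measurable time_space"
proof -
  have "(\<lambda>s. LINT y|\<nu> s. jump_factor l S s y) \<in> borel_measurable time_space"
    by (rule integral_nu_measurable[OF jump_factor_measurable[OF assms]]) (simp add: jump_factor_def)
  then show ?thesis unfolding drift_coeff_def by measurable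
qed

lemma drift_coeff_le:
  assumes l: "l \<in> {1..N}" and S: "S \<subseteq> {l+1..N}" and s: "s \<in> {0..Tstar}"
  shows "integrable (\<nu> s) (jump_factor l S s)" "\<bar>drift_coeff l S s\<bar> \<le> (1 + M\<^sup>2) * activity s"
proof -
  have m: "jump_factor l S s \<in> borel_measurable borel"
    using measurable_Pair2[OF jump_factor_measurable[OF l S], of s] s by simp
  note j = jump_integral[OF s m, of "1 + M\<^sup>2"]
  show "integrable (\<nu> s) (jump_factor l S s)" using j(1) jump_factor_le[OF l S s] by simp
  have "\<bar>drift_coeff l S s\<bar> \<le> (1 + M\<^sup>2) * jump_mass s"
    using j(2) jump_factor_le[OF l S s] by (simp add: drift_coeff_def)
  also have "\<dots> \<le> (1 + M\<^sup>2) * activity s" using jump_mass_le_activity[OF s] by (intro mult_left_mono) auto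
  finally show "\<bar>drift_coeff l S s\<bar> \<le> (1 + M\<^sup>2) * activity s" .
qed

text \<open>
  Multiplying out separates the integrals over the jump measure, which depend on time alone, from the
  weights, which carry the dependence on the rates.
\<close>

lemma drift_expansion:
  assumes l: "l \<in> {1..N}" and s: "s \<in> {0..Tstar}"
  shows "libor_drift s l x =
    - 1 / 2 * (lam s l)\<^sup>2 * c s
    + (\<Sum>m\<in>{l+1..N}. - (c s * lam s l * lam s m) * weight T m x)
    + (\<Sum>S\<in>Pow {l+1..N}. drift_coeff l S s * (\<Prod>m\<in>S. weight T m x))"
proof -
  let ?A = "{l+1..N}"
  have pt: "(exp (lam s l * y) - 1) * (\<Prod>m\<in>?A. drift_beta T lam s y m x) - lam s l * y
      = (\<Sum>S\<in>Pow ?A. (\<Prod>m\<in>S. weight T m x) * jump_factor l S s y)" for y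
  proof -
    have "(\<Prod>m\<in>?A. drift_beta T lam s y m x)
        = (\<Sum>S\<in>Pow ?A. (\<Prod>m\<in>S. weight T m x * (exp (lam s m * y) - 1)) * (\<Prod>m\<in>?A - S. 1))"
      unfolding drift_beta_def by (rule prod_add) simp
    then have "(exp (lam s l * y) - 1) * (\<Prod>m\<in>?A. drift_beta T lam s y m x)
        = (\<Sum>S\<in>Pow ?A. (\<Prod>m\<in>S. weight T m x) * ((exp (lam s l * y) - 1) * (\<Prod>m\<in>S. exp (lam s m * y) - 1)))"
      by (simp add: sum_distrib_left prod.distrib mult_ac)
    moreover have "lam s l * y = (\<Sum>S\<in>Pow ?A. (\<Prod>m\<in>S. weight T m x) * (if S = {} then lam s l * y else 0))"
    proof -
      have "(\<Sum>S\<in>Pow ?A. (\<Prod>m\<in>S. weight T m x) * (if S = {} then lam s l * y else 0))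
          = (\<Sum>S\<in>{{}}. (\<Prod>m\<in>S. weight T m x) * (if S = {} then lam s l * y else 0))"
        by (intro sum.mono_neutral_right) auto
      then show ?thesis by simp
    qed
    ultimately show ?thesis
      by (simp add: jump_factor_def right_diff_distrib sum_subtractf)
  qed
  have "(LINT y|\<nu> s. (exp (lam s l * y) - 1) * (\<Prod>m\<in>?A. drift_beta T lam s y m x) - lam s l * y)
      = (\<Sum>S\<in>Pow ?A. (\<Prod>m\<in>S. weight T m x) * (LINT y|\<nu> s. jump_factor l S s y))"
    unfolding pt using drift_coeff_le(1)[OF l _ s]
    by (subst Bochner_Integration.integral_sum) auto
  then show ?thesis
    unfolding drift_def drift_coeff_def
    by (simp add: sum_distrib_left sum_negf mult_ac)
qed

end

section \<open>Characteristic functions of the increments of the driver\<close>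

lemma (in prob_space) indep_var_of_indep_set:
  assumes ind: "indep_set (sets A) (sets B)"
    and sp: "space A = space M" "space B = space M"
    and X: "X \<in> measurable A N1" and Y: "Y \<in> measurable B N2"
  shows "indep_var N1 X N2 Y"
proof -
  have sub: "sets A \<subseteq> events" "sets B \<subseteq> events"
    using ind by (auto simp: indep_set_def indep_sets_def split: bool.splits)
  have rv: "random_variable N1 X" "random_variable N2 Y"
    using measurable_mono[of N1 N1 A M] measurable_mono[of N2 N2 B M] sub sp X Y by auto
  have "sigma_sets (space M) {X -` S \<inter> space M |S. S \<in> sets N1} \<subseteq> sets A"
    unfolding sp(1)[symmetric] by (rule sets.sigma_sets_subset) (use X in \<open>auto intro: measurable_sets\<close>)
  moreover have "sigma_sets (space M) {Y -` S \<inter> space M |S. S \<in> sets N2} \<subseteq> sets B"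
    unfolding sp(2)[symmetric] by (rule sets.sigma_sets_subset) (use Y in \<open>auto intro: measurable_sets\<close>)
  ultimately have "indep_set (sigma_sets (space M) {X -` S \<inter> space M |S. S \<in> sets N1})
      (sigma_sets (space M) {Y -` S \<inter> space M |S. S \<in> sets N2})"
    using ind unfolding indep_set_def
    by (elim indep_sets_mono_sets) (auto split: bool.splits)
  then show ?thesis using rv by (simp add: indep_var_eq)
qed

lemma set_integral_consecutive:
  fixes f :: "real \<Rightarrow> 'b::{banach, second_countable_topology}"
  assumes q: "\<And>k. k < n \<Longrightarrow> q k \<le> q (Suc k)" and f: "set_integrable lborel {q 0<..q n} f"
  shows "(\<Sum>k<n. LINT r:{q k<..q (Suc k)}|lborel. f r) = (LINT r:{q 0<..q n}|lborel. f r)"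
  using assms
proof (induction n)
  case 0
  then show ?case by (simp add: set_lebesgue_integral_def)
next
  case (Suc n)
  have "q 0 \<le> q n"
    using Suc.prems(1) by (intro lift_Suc_mono_le[of "\<lambda>k. q (min k n)" 0 n, simplified]) (auto simp: min_def less_Suc_eq not_le)
  moreover have "q n \<le> q (Suc n)" using Suc.prems(1) by simp
  ultimately have U: "{q 0<..q (Suc n)} = {q 0<..q n} \<union> {q n<..q (Suc n)}" by auto
  have i: "set_integrable lborel {q 0<..q n} f" "set_integrable lborel {q n<..q (Suc n)} f"
    using Suc.prems(2) by (auto intro: set_integrable_subset simp: U)
  then have "(LINT r:{q 0<..q (Suc n)}|lborel. f r)
      = (LINT r:{q 0<..q n}|lborel. f r) + (LINT r:{q n<..q (Suc n)}|lborel. f r)"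
    unfolding U by (intro set_integral_Un) auto
  then show ?case using Suc.IH[OF _ i(1)] Suc.prems(1) by simp
qed

context levy_libor
begin

text \<open>
  The characteristic exponent of the driver at time \<open>s\<close>.
\<close>

definition psi :: "real \<Rightarrow> real \<Rightarrow> complex" where
  "psi s v = levy_exponent 0 (c s) (\<nu> s) v"

lemma psi_eq: "psi s v = - of_real (c s / 2 * v\<^sup>2) + (CLINT y|\<nu> s. iexp (v * y) - 1 - \<i> * of_real (v * y))"
  by (simp add: psi_def levy_exponent_def)

lemma psi_jump_part:
  assumes "s \<in> {0..Tstar}"
  shows "integrable (\<nu> s) (\<lambda>y. iexp (v * y) - 1 - \<i> * of_real (v * y))"
    and "cmod (CLINT y|\<nu> s. iexp (v * y) - 1 - \<i> * of_real (v * y)) \<le> v\<^sup>2 * (1 + 1 / M\<^sup>2) * jump_mass s"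
  by (rule jump_integral[OF assms _ iexp_minus_1_minus_le_jump_weight[OF M_pos]], measurable)+

lemma psi_le:
  assumes s: "s \<in> {0..Tstar}"
  shows "cmod (psi s v) \<le> v\<^sup>2 * (2 + 1 / M\<^sup>2) * activity s"
proof -
  have "cmod (psi s v) \<le> cmod (of_real (c s / 2 * v\<^sup>2))
      + cmod (CLINT y|\<nu> s. iexp (v * y) - 1 - \<i> * of_real (v * y))"
    unfolding psi_eq by (rule order_trans[OF norm_triangle_ineq]) (simp only: norm_minus_cancel order_refl)
  also have "\<dots> \<le> v\<^sup>2 * c s + v\<^sup>2 * (1 + 1 / M\<^sup>2) * jump_mass s"
    by (rule add_mono[OF _ psi_jump_part(2)[OF s]])
      (use c_nonneg[OF s] in \<open>simp add: norm_mult norm_divide norm_power mult.commute\<close>)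
  also have "\<dots> \<le> v\<^sup>2 * activity s + v\<^sup>2 * (1 + 1 / M\<^sup>2) * activity s"
    using c_le_activity[OF s] jump_mass_le_activity[OF s] by (intro add_mono mult_left_mono) auto
  also have "\<dots> = v\<^sup>2 * (2 + 1 / M\<^sup>2) * activity s" by (simp add: algebra_simps)
  finally show ?thesis .
qed

lemma psi_0 [simp]: "psi s 0 = 0" by (simp add: psi_eq)

lemma psi_measurable:
  assumes f [measurable]: "f \<in> borel_measurable time_space"
  shows "(\<lambda>s. psi s (f s)) \<in> borel_measurable time_space"
proof -
  note [measurable] = c_measurable
  have [measurable]: "(\<lambda>z. f (fst z)) \<in> borel_measurable (time_space \<Otimes>\<^sub>M (borel :: real measure))"
    by (rule measurable_compose[OF measurable_fst f])
  have "(\<lambda>(s, y). iexp (f s * y) - 1 - \<i> * of_real (f s * y)) \<in> borel_measurable (time_space \<Otimes>\<^sub>M borel)"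
    unfolding case_prod_beta' by measurable
  then have [measurable]: "(\<lambda>s. CLINT y|\<nu> s. iexp (f s * y) - 1 - \<i> * of_real (f s * y)) \<in> borel_measurable time_space"
    by (rule integral_nu_measurable) simp
  show ?thesis unfolding psi_eq by measurable
qed

lemma psi_tendsto:
  assumes s: "s \<in> {0..Tstar}" and v: "v \<longlonglongrightarrow> v0"
  shows "(\<lambda>n. psi s (v n)) \<longlonglongrightarrow> psi s v0"
proof -
  obtain V where V: "\<And>n. \<bar>v n\<bar> \<le> V"
    using convergent_imp_Bseq[OF convergentI[OF v]] by (auto simp: Bseq_def)
  have "(\<lambda>n. CLINT y|\<nu> s. iexp (v n * y) - 1 - \<i> * of_real (v n * y))
      \<longlonglongrightarrow> (CLINT y|\<nu> s. iexp (v0 * y) - 1 - \<i> * of_real (v0 * y))"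
  proof (rule integral_dominated_convergence[where w="\<lambda>y. V\<^sup>2 * (1 + 1 / M\<^sup>2) * jump_weight M y"])
    show "integrable (\<nu> s) (\<lambda>y. V\<^sup>2 * (1 + 1 / M\<^sup>2) * jump_weight M y)"
      using integrable_jump_weight[OF s] by simp
    show "AE y in \<nu> s. (\<lambda>n. iexp (v n * y) - 1 - \<i> * of_real (v n * y))
        \<longlonglongrightarrow> iexp (v0 * y) - 1 - \<i> * of_real (v0 * y)"
      by (intro AE_I2 tendsto_intros v)
    show "AE y in \<nu> s. norm (iexp (v n * y) - 1 - \<i> * of_real (v n * y)) \<le> V\<^sup>2 * (1 + 1 / M\<^sup>2) * jump_weight M y" for n
    proof (rule AE_I2)
      fix y
      have "(v n)\<^sup>2 \<le> V\<^sup>2" using V[of n] power_mono[of "\<bar>v n\<bar>" V 2] by simp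
      then have "(v n)\<^sup>2 * (1 + 1 / M\<^sup>2) * jump_weight M y \<le> V\<^sup>2 * (1 + 1 / M\<^sup>2) * jump_weight M y"
        by (intro mult_right_mono jump_weight_nonneg) auto
      then show "norm (iexp (v n * y) - 1 - \<i> * of_real (v n * y)) \<le> V\<^sup>2 * (1 + 1 / M\<^sup>2) * jump_weight M y"
        using iexp_minus_1_minus_le_jump_weight[OF M_pos, of "v n" y] by linarith
    qed
  qed (rule borel_measurable_integrable[OF psi_jump_part(1)[OF s]])+
  then show ?thesis unfolding psi_eq by (intro tendsto_intros v)
qed

lemma psi_time_integral:
  assumes f: "f \<in> borel_measurable time_space" and le: "\<And>s. s \<in> {0..Tstar} \<Longrightarrow> \<bar>f s\<bar> \<le> V"
    and A: "A \<in> sets borel" "A \<subseteq> {0..Tstar}"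
  shows "set_integrable lborel A (\<lambda>s. psi s (f s))"
proof (rule time_integral_activity(1)[OF psi_measurable[OF f] A])
  fix s assume s: "s \<in> {0..Tstar}"
  have "(f s)\<^sup>2 \<le> V\<^sup>2" using le[OF s] power_mono[of "\<bar>f s\<bar>" V 2] by simp
  then have "(f s)\<^sup>2 * (2 + 1 / M\<^sup>2) * activity s \<le> V\<^sup>2 * (2 + 1 / M\<^sup>2) * activity s"
    by (intro mult_right_mono activity_nonneg[OF s]) auto
  then show "cmod (psi s (f s)) \<le> V\<^sup>2 * (2 + 1 / M\<^sup>2) * activity s" using psi_le[OF s, of "f s"] by linarith
qed auto

lemma F_mono_measurable: "s \<le> t \<Longrightarrow> f \<in> borel_measurable (F s) \<Longrightarrow> f \<in> borel_measurable (F t)"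
  using measurable_mono[of borel borel "F s" "F t"] sets_F_mono[of s t] space_F by auto

lemma F_sub: "t \<le> Tstar \<Longrightarrow> sets (F t) \<subseteq> sets P"
  using sets_F_mono[of t Tstar] terminal_sigma_algebra by simp

lemma F_measurable: "t \<le> Tstar \<Longrightarrow> f \<in> borel_measurable (F t) \<Longrightarrow> f \<in> borel_measurable P"
  using measurable_mono[of borel borel "F t" P] F_sub[of t] space_F by auto

lemma H_increment_expectation:
  fixes Z :: "'a \<Rightarrow> complex"
  assumes st: "0 \<le> s" "s < t" "t \<le> Tstar"
    and Z: "Z \<in> borel_measurable (F s)" and bd: "\<And>\<omega>. \<omega> \<in> space P \<Longrightarrow> cmod (Z \<omega>) \<le> C"
  shows "(CLINT \<omega>|P. Z \<omega> * iexp (u * (H t \<omega> - H s \<omega>)))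
    = (CLINT \<omega>|P. Z \<omega>) * (CLINT \<omega>|P. iexp (u * (H t \<omega> - H s \<omega>)))"
proof -
  let ?V = "vimage_algebra (space P) (\<lambda>\<omega>. H t \<omega> - H s \<omega>) borel"
  have Ht: "H t \<in> borel_measurable P" and Hs: "H s \<in> borel_measurable P"
    using F_measurable[OF _ H_adapted] st by auto
  have "(\<lambda>\<omega>. H t \<omega> - H s \<omega>) \<in> measurable ?V borel" by (rule measurable_vimage_algebra1) auto
  then have "(\<lambda>\<omega>. iexp (u * (H t \<omega> - H s \<omega>))) \<in> borel_measurable ?V" by measurable
  then have ind: "indep_var borel Z borel (\<lambda>\<omega>. iexp (u * (H t \<omega> - H s \<omega>)))"
    using indep_var_of_indep_set[OF H_indep[OF st] _ _ Z] space_F by simp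
  show ?thesis
  proof (rule indep_var_lebesgue_integral[OF ind])
    have ZP: "Z \<in> borel_measurable P"
      using Z measurable_mono[of borel borel "F s" P] F_sub[of s] space_F st by auto
    show "integrable P Z" by (rule integrable_const_bound[of _ C]) (use bd ZP in auto)
    show "integrable P (\<lambda>\<omega>. iexp (u * (H t \<omega> - H s \<omega>)))"
      by (rule integrable_const_bound[of _ 1]) (use Ht Hs in auto)
  qed
qed

lemma H_increment_char:
  assumes st: "0 \<le> s" "s < t" "t \<le> Tstar"
  shows "(CLINT \<omega>|P. iexp (u * (H t \<omega> - H s \<omega>))) = exp (CLINT r:{s<..t}|lborel. psi r u)"
proof -
  have i: "set_integrable lborel A (\<lambda>r. psi r u)" if "A \<in> sets borel" "A \<subseteq> {0..Tstar}" for A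
    by (rule psi_time_integral[where V="\<bar>u\<bar>"]) (use that in auto)
  have U: "{0..t} = {0..s} \<union> {s<..t}" using st by auto
  have split: "(CLINT r:{0..t}|lborel. psi r u) = (CLINT r:{0..s}|lborel. psi r u) + (CLINT r:{s<..t}|lborel. psi r u)"
    unfolding U using st by (intro set_integral_Un i) auto
  have [measurable]: "H s \<in> borel_measurable (F s)" using H_adapted[of s] st by auto
  have Hs: "(\<lambda>\<omega>. iexp (u * H s \<omega>)) \<in> borel_measurable (F s)" by measurable
  have "iexp (u * H t \<omega>) = iexp (u * H s \<omega>) * iexp (u * (H t \<omega> - H s \<omega>))" for \<omega>
    by (simp add: exp_add[symmetric] algebra_simps)
  then have "(CLINT \<omega>|P. iexp (u * H t \<omega>)) = (CLINT \<omega>|P. iexp (u * H s \<omega>) * iexp (u * (H t \<omega> - H s \<omega>)))"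
    by simp
  also have "\<dots> = (CLINT \<omega>|P. iexp (u * H s \<omega>)) * (CLINT \<omega>|P. iexp (u * (H t \<omega> - H s \<omega>)))"
    by (rule H_increment_expectation[OF st Hs, of 1]) simp
  finally have "exp (CLINT r:{0..t}|lborel. psi r u)
      = exp (CLINT r:{0..s}|lborel. psi r u) * (CLINT \<omega>|P. iexp (u * (H t \<omega> - H s \<omega>)))"
    using H_char[of t u] H_char[of s u] st by (simp add: psi_def)
  then show ?thesis unfolding split exp_add by simp
qed

text \<open>
  Splitting off the last increment: everything before it is measurable at its starting time, so the
  increment is independent of it.
\<close>

lemma H_chain_char:
  assumes A: "A \<in> sets (F (q 0))" and q0: "0 \<le> q 0"
  shows "(\<And>k. k < n \<Longrightarrow> q k \<le> q (Suc k)) \<Longrightarrow> q n \<le> Tstar \<Longrightarrow>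
    (CLINT \<omega>|P. indicator A \<omega> * iexp (u * (\<Sum>k<n. a k * (H (q (Suc k)) \<omega> - H (q k) \<omega>))))
    = prob A * exp (\<Sum>k<n. CLINT r:{q k<..q (Suc k)}|lborel. psi r (u * a k))"
proof (induction n)
  case 0
  have AP: "A \<in> sets P" using A F_sub[of "q 0"] 0 by auto
  have "(\<lambda>\<omega>. indicator A \<omega> :: complex) = (\<lambda>\<omega>. of_real (indicator A \<omega>))" by (auto simp: indicator_def)
  then have "(CLINT \<omega>|P. indicator A \<omega>) = of_real (prob A)"
    using AP sets.sets_into_space[OF AP] by (simp add: Int_absorb2)
  then show ?case by simp
next
  case (Suc n)
  have mono: "q j \<le> q k" if "j \<le> k" "k \<le> Suc n" for j k
    using that
  proof (induction k rule: dec_induct)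
    case (step m)
    then have "q j \<le> q m" "q m \<le> q (Suc m)" using Suc.prems(1)[of m] by auto
    then show ?case by simp
  qed simp
  define Z where "Z \<omega> = indicator A \<omega> * iexp (u * (\<Sum>k<n. a k * (H (q (Suc k)) \<omega> - H (q k) \<omega>)))" for \<omega>
  have qn: "0 \<le> q n" "q n \<le> q (Suc n)" "q n \<le> Tstar"
    using mono[of 0 n] mono[of n "Suc n"] q0 Suc.prems(2) by auto
  have Z_meas: "Z \<in> borel_measurable (F (q n))"
  proof -
    have [measurable]: "H (q k) \<in> borel_measurable (F (q n))" if "k \<le> n" for k
    proof -
      have "0 \<le> q k" "q k \<le> q n" using that mono[of 0 k] mono[of k n] q0 by auto
      then show ?thesis using H_adapted[of "q k"] qn by (intro F_mono_measurable[of "q k" "q n"]) auto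
    qed
    have [measurable]: "A \<in> sets (F (q n))"
      using A sets_F_mono[of "q 0" "q n"] mono[of 0 n] by auto
    have "(\<lambda>\<omega>. \<Sum>k<n. a k * (H (q (Suc k)) \<omega> - H (q k) \<omega>)) \<in> borel_measurable (F (q n))"
      by (intro borel_measurable_sum borel_measurable_times borel_measurable_diff) auto
    then show ?thesis unfolding Z_def by measurable
  qed
  have IH: "(CLINT \<omega>|P. Z \<omega>) = prob A * exp (\<Sum>k<n. CLINT r:{q k<..q (Suc k)}|lborel. psi r (u * a k))"
    unfolding Z_def using Suc.IH Suc.prems(1) qn by simp
  have eq: "indicator A \<omega> * iexp (u * (\<Sum>k<Suc n. a k * (H (q (Suc k)) \<omega> - H (q k) \<omega>)))
      = Z \<omega> * iexp ((u * a n) * (H (q (Suc n)) \<omega> - H (q n) \<omega>))" for \<omega>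
    unfolding Z_def by (simp add: mult.assoc exp_add[symmetric] algebra_simps)
  show ?case
  proof (cases "q n = q (Suc n)")
    case True
    then show ?thesis unfolding eq using IH by (simp add: set_lebesgue_integral_def)
  next
    case False
    then have lt: "q n < q (Suc n)" using qn by simp
    have Zb: "cmod (Z \<omega>) \<le> 1" for \<omega> by (simp add: Z_def norm_mult indicator_def)
    show ?thesis
      unfolding eq H_increment_expectation[OF qn(1) lt Suc.prems(2) Z_meas Zb]
        H_increment_char[OF qn(1) lt Suc.prems(2)] IH
      by (simp add: exp_add)
  qed
qed

end

section \<open>Riemann sums of the volatilities against the driver\<close>

text \<open>
  By right continuity it suffices to look at rational times and at \<open>\<tau>\<close>. Measurability matters because
  the measure of a set that is not measurable is \<open>0\<close> by convention, so convergence ucp would carry no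
  information about subsets of such sets.
\<close>

lemma exceedance_measurable:
  fixes Z :: "real \<Rightarrow> 'a \<Rightarrow> real"
  assumes Z: "\<And>t. t \<in> {0..\<tau>} \<Longrightarrow> Z t \<in> borel_measurable P"
    and rc: "\<And>\<omega> t. \<omega> \<in> space P \<Longrightarrow> t \<in> {0..<\<tau>} \<Longrightarrow> ((\<lambda>t. Z t \<omega>) \<longlongrightarrow> Z t \<omega>) (at_right t)"
  shows "{\<omega>\<in>space P. \<exists>t\<in>{0..\<tau>}. \<eta> < \<bar>Z t \<omega>\<bar>} \<in> sets P"
proof -
  let ?Q = "{0..\<tau>} \<inter> (\<rat> \<union> {\<tau>})"
  have "{\<omega>\<in>space P. \<exists>t\<in>{0..\<tau>}. \<eta> < \<bar>Z t \<omega>\<bar>} = (\<Union>t\<in>?Q. {\<omega>\<in>space P. \<eta> < \<bar>Z t \<omega>\<bar>})"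
  proof (intro equalityI subsetI)
    fix \<omega> assume "\<omega> \<in> {\<omega>\<in>space P. \<exists>t\<in>{0..\<tau>}. \<eta> < \<bar>Z t \<omega>\<bar>}"
    then obtain t where w: "\<omega> \<in> space P" and t: "t \<in> {0..\<tau>}" "\<eta> < \<bar>Z t \<omega>\<bar>" by auto
    have "\<exists>q\<in>?Q. \<eta> < \<bar>Z q \<omega>\<bar>"
    proof (cases "t = \<tau>")
      case True
      then show ?thesis using t by auto
    next
      case False
      then have t': "t \<in> {0..<\<tau>}" using t by auto
      have "((\<lambda>t. \<bar>Z t \<omega>\<bar>) \<longlongrightarrow> \<bar>Z t \<omega>\<bar>) (at_right t)"
        by (intro tendsto_intros rc w t')
      then have "\<forall>\<^sub>F r in at_right t. \<eta> < \<bar>Z r \<omega>\<bar>" using t(2) by (rule order_tendstoD(1))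
      then obtain b where b: "t < b" "\<And>r. t < r \<Longrightarrow> r < b \<Longrightarrow> \<eta> < \<bar>Z r \<omega>\<bar>"
        by (auto simp: eventually_at_right_field)
      obtain q where "q \<in> \<rat>" "t < q" "q < min b \<tau>"
        using Rats_dense_in_real[of t "min b \<tau>"] b(1) t' by auto
      then show ?thesis using b(2)[of q] t' by (intro bexI[of _ q]) auto
    qed
    then show "\<omega> \<in> (\<Union>t\<in>?Q. {\<omega>\<in>space P. \<eta> < \<bar>Z t \<omega>\<bar>})" using w by blast
  qed auto
  also have "\<dots> \<in> sets P"
  proof (rule sets.countable_UN')
    show "countable ?Q" by (intro countable_Int2) (auto simp: countable_rat)
    have "{\<omega>\<in>space P. \<eta> < \<bar>Z t \<omega>\<bar>} \<in> sets P" if "t \<in> ?Q" for t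
    proof -
      have [measurable]: "Z t \<in> borel_measurable P" using Z that by auto
      show ?thesis by measurable
    qed
    then show "(\<lambda>t. {\<omega>\<in>space P. \<eta> < \<bar>Z t \<omega>\<bar>}) ` ?Q \<subseteq> sets P" by blast
  qed
  finally show ?thesis .
qed

lemma (in prob_space) expectation_iexp_tendsto:
  fixes D :: "nat \<Rightarrow> 'a \<Rightarrow> real"
  assumes [measurable]: "\<And>n. D n \<in> borel_measurable M" "D' \<in> borel_measurable M" "A \<in> events"
    and lim: "\<And>\<eta>. 0 < \<eta> \<Longrightarrow> (\<lambda>n. prob {\<omega>\<in>space M. \<eta> < \<bar>D n \<omega> - D' \<omega>\<bar>}) \<longlonglongrightarrow> 0"
  shows "(\<lambda>n. CLINT \<omega>|M. indicator A \<omega> * iexp (u * D n \<omega>)) \<longlonglongrightarrow> (CLINT \<omega>|M. indicator A \<omega> * iexp (u * D' \<omega>))"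
proof (rule LIMSEQ_I)
  fix r :: real assume r: "0 < r"
  \<comment> \<open>half of \<open>r\<close> pays for small deviations, the other half for the probability of large ones\<close>
  define \<eta> where "\<eta> = r / (2 * (1 + \<bar>u\<bar>))"
  have \<eta>: "0 < \<eta>" using r by (simp add: \<eta>_def add_pos_nonneg)
  have u\<eta>: "\<bar>u\<bar> * \<eta> < r / 2" using r by (simp add: \<eta>_def field_simps add_pos_nonneg)
  have "0 < r / 4" using r by simp
  from LIMSEQ_D[OF lim[OF \<eta>] this] obtain n0 where
    n0: "\<And>n. n \<ge> n0 \<Longrightarrow> prob {\<omega>\<in>space M. \<eta> < \<bar>D n \<omega> - D' \<omega>\<bar>} < r / 4" by auto
  have int: "integrable M (\<lambda>\<omega>. indicator A \<omega> * iexp (u * f \<omega>))" if [measurable]: "f \<in> borel_measurable M" for f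
    by (rule integrable_const_bound[of _ 1]) (auto simp: norm_mult indicator_def)
  have "cmod ((CLINT \<omega>|M. indicator A \<omega> * iexp (u * D n \<omega>)) - (CLINT \<omega>|M. indicator A \<omega> * iexp (u * D' \<omega>))) < r"
    if n: "n \<ge> n0" for n
  proof -
    let ?B = "{\<omega>\<in>space M. \<eta> < \<bar>D n \<omega> - D' \<omega>\<bar>}"
    have B [measurable]: "?B \<in> events" by measurable
    have "cmod ((CLINT \<omega>|M. indicator A \<omega> * iexp (u * D n \<omega>)) - (CLINT \<omega>|M. indicator A \<omega> * iexp (u * D' \<omega>)))
        = cmod (CLINT \<omega>|M. indicator A \<omega> * iexp (u * D n \<omega>) - indicator A \<omega> * iexp (u * D' \<omega>))"
      by (simp only: Bochner_Integration.integral_diff[OF int[OF assms(1)] int[OF assms(2)]])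
    also have "\<dots> \<le> (LINT \<omega>|M. cmod (indicator A \<omega> * iexp (u * D n \<omega>) - indicator A \<omega> * iexp (u * D' \<omega>)))"
      by (rule integral_norm_bound)
    also have "\<dots> \<le> (LINT \<omega>|M. \<bar>u\<bar> * \<eta> + 2 * indicator ?B \<omega>)"
    proof (rule integral_mono)
      show "integrable M (\<lambda>\<omega>. cmod (indicator A \<omega> * iexp (u * D n \<omega>) - indicator A \<omega> * iexp (u * D' \<omega>)))"
        by (intro integrable_norm Bochner_Integration.integrable_diff int assms)
      show "integrable M (\<lambda>\<omega>. \<bar>u\<bar> * \<eta> + 2 * indicator ?B \<omega>)"
        by (intro Bochner_Integration.integrable_add integrable_mult_right integrable_real_indicator)
          (auto simp: emeasure_eq_measure)
      fix \<omega> assume w: "\<omega> \<in> space M"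
      have "cmod (indicator A \<omega> * iexp (u * D n \<omega>) - indicator A \<omega> * iexp (u * D' \<omega>))
          \<le> cmod (iexp (u * D n \<omega>) - iexp (u * D' \<omega>))" by (auto simp: indicator_def)
      also have "\<dots> \<le> \<bar>u\<bar> * \<eta> + 2 * indicator ?B \<omega>"
      proof (cases "\<omega> \<in> ?B")
        case True
        have "cmod (iexp (u * D n \<omega>) - iexp (u * D' \<omega>)) \<le> cmod (iexp (u * D n \<omega>)) + cmod (iexp (u * D' \<omega>))"
          by (rule norm_triangle_ineq4)
        moreover have "0 \<le> \<bar>u\<bar> * \<eta>" using \<eta> by simp
        ultimately show ?thesis using True by simp
      next
        case False
        then have le: "\<bar>D n \<omega> - D' \<omega>\<bar> \<le> \<eta>" using w by auto
        have "iexp (u * D n \<omega>) - iexp (u * D' \<omega>) = iexp (u * D' \<omega>) * (iexp (u * (D n \<omega> - D' \<omega>)) - 1)"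
          by (simp add: algebra_simps exp_add[symmetric])
        then have "cmod (iexp (u * D n \<omega>) - iexp (u * D' \<omega>)) = cmod (iexp (u * (D n \<omega> - D' \<omega>)) - 1)"
          by (simp add: norm_mult)
        also have "\<dots> \<le> \<bar>u * (D n \<omega> - D' \<omega>)\<bar>"
          using iexp_approx1[of "u * (D n \<omega> - D' \<omega>)" 0] by simp
        also have "\<dots> \<le> \<bar>u\<bar> * \<eta>" using le by (auto simp: abs_mult intro!: mult_left_mono)
        finally show ?thesis using False by simp
      qed
      finally show "cmod (indicator A \<omega> * iexp (u * D n \<omega>) - indicator A \<omega> * iexp (u * D' \<omega>))
          \<le> \<bar>u\<bar> * \<eta> + 2 * indicator ?B \<omega>" .
    qed
    also have "\<dots> = \<bar>u\<bar> * \<eta> + 2 * prob ?B"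
      by (subst Bochner_Integration.integral_add)
        (auto simp: emeasure_eq_measure prob_space intro!: integrable_mult_right integrable_real_indicator)
    also have "\<dots> < r" using u\<eta> n0[OF n] by simp
    finally show ?thesis .
  qed
  then show "\<exists>n0. \<forall>n\<ge>n0. norm ((CLINT \<omega>|M. indicator A \<omega> * iexp (u * D n \<omega>))
      - (CLINT \<omega>|M. indicator A \<omega> * iexp (u * D' \<omega>))) < r" by blast
qed

lemma sum_list_map_upt: "(\<Sum>x\<leftarrow>map f [0..<n]. g x) = (\<Sum>k<n. g (f k))"
  by (simp add: interv_sum_list_conv_sum_set_nat comp_def atLeast0LessThan)

context levy_libor
begin

text \<open>
  Left-endpoint Riemann sums along the uniform partition of \<open>[0,T\<^sub>l]\<close> into \<open>n + 1\<close> intervals, so that no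
  division by \<open>0\<close> arises.
\<close>

definition grid :: "nat \<Rightarrow> nat \<Rightarrow> nat \<Rightarrow> real" where
  "grid l n k = T l * real k / real (Suc n)"

definition riemann :: "nat \<Rightarrow> nat \<Rightarrow> 'a elementary" where
  "riemann l n = (\<lambda>_. lam 0 l, map (\<lambda>k. (grid l n k, grid l n (Suc k), \<lambda>_. lam (grid l n k) l)) [0..<Suc n])"

definition step_vol :: "nat \<Rightarrow> nat \<Rightarrow> real \<Rightarrow> real" where
  "step_vol l n r = lam 0 l * indicator {0} r
     + (\<Sum>k<Suc n. lam (grid l n k) l * indicator {grid l n k<..grid l n (Suc k)} r)"

abbreviation (input) riemann_sum :: "nat \<Rightarrow> nat \<Rightarrow> real \<Rightarrow> 'a \<Rightarrow> real" where
  "riemann_sum l n \<equiv> elementary_integral H (riemann l n)"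

lemma elementary_value_riemann: "elementary_value (riemann l n) r \<omega> = step_vol l n r"
  unfolding elementary_value_def riemann_def step_vol_def snd_conv fst_conv sum_list_map_upt by simp

lemma elementary_integral_riemann:
  "riemann_sum l n t \<omega> =
    (\<Sum>k<Suc n. lam (grid l n k) l * (H (min (grid l n (Suc k)) t) \<omega> - H (min (grid l n k) t) \<omega>))"
  unfolding elementary_integral_def riemann_def snd_conv sum_list_map_upt by simp

lemma step_vol_measurable [measurable]: "step_vol l n \<in> borel_measurable borel"
  unfolding step_vol_def by measurable

context
  fixes l :: nat
  assumes l: "l \<in> {1..N}"
begin

lemma tenor_pos: "0 < T l"
  using tenor_increasing[of 0] tenor_mono[of 1 l] tenor_start l by simp

lemma tenor_le: "T l \<le> Tstar"
  using tenor_le_Tstar[of l] l by simp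

lemma grid_0 [simp]: "grid l n 0 = 0" and grid_end [simp]: "grid l n (Suc n) = T l"
  by (simp_all add: grid_def del: of_nat_Suc)

lemma grid_mono: "j \<le> k \<Longrightarrow> grid l n j \<le> grid l n k"
  unfolding grid_def using tenor_pos by (intro divide_right_mono mult_left_mono) auto

lemma grid_bounds: "k \<le> Suc n \<Longrightarrow> grid l n k \<in> {0..T l}"
  using grid_mono[of 0 k n] grid_mono[of k "Suc n" n] by simp

lemma step_vol_eq:
  assumes k: "k < Suc n" and r: "r \<in> {grid l n k<..grid l n (Suc k)}"
  shows "step_vol l n r = lam (grid l n k) l"
proof -
  have "0 < r" using r grid_mono[of 0 k n] by simp
  define f where "f j = lam (grid l n j) l * indicator {grid l n j<..grid l n (Suc j)} r" for j
  have "sum f {..<Suc n} = sum f {k}"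
  proof (rule sum.mono_neutral_right)
    show "\<forall>j\<in>{..<Suc n} - {k}. f j = 0"
    proof
      fix j assume "j \<in> {..<Suc n} - {k}"
      then consider "Suc j \<le> k" | "Suc k \<le> j" by fastforce
      then have "r \<notin> {grid l n j<..grid l n (Suc j)}"
        using r grid_mono[of "Suc j" k n] grid_mono[of "Suc k" j n] by cases auto
      then show "f j = 0" by (simp add: f_def)
    qed
  qed (use k in auto)
  also have "\<dots> = lam (grid l n k) l" using r by (simp add: f_def)
  finally have "sum f {..<Suc n} = lam (grid l n k) l" .
  moreover have "step_vol l n r = sum f {..<Suc n}"
    unfolding step_vol_def f_def[symmetric] using \<open>0 < r\<close> by (simp del: sum.lessThan_Suc)
  ultimately show ?thesis by simp
qed

lemma grid_cell:
  assumes "0 < r" "r \<le> T l"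
  shows "\<exists>k<Suc n. r \<in> {grid l n k<..grid l n (Suc k)}"
  using ex_least_nat_less[of "\<lambda>k. r \<le> grid l n k" "Suc n"] assms
  by (auto simp: not_le)

lemma step_vol_0: "step_vol l n 0 = lam 0 l"
proof -
  have "indicator {grid l n k<..grid l n (Suc k)} 0 = (0::real)" for k
    using grid_mono[of 0 k n] by (auto simp: indicator_def)
  then show ?thesis by (simp add: step_vol_def)
qed

lemma step_vol_late: "T l < r \<Longrightarrow> step_vol l n r = 0"
proof -
  assume r: "T l < r"
  have "indicator {grid l n k<..grid l n (Suc k)} r = (0::real)" if "k < Suc n" for k
    using grid_mono[of "Suc k" "Suc n" n] that r by (auto simp: indicator_def)
  then show ?thesis using r tenor_pos by (simp add: step_vol_def)
qed

lemma step_vol_le: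
  assumes "r \<in> {0..Tstar}"
  shows "\<bar>step_vol l n r\<bar> \<le> M"
proof -
  consider "r = 0" | "0 < r" "r \<le> T l" | "T l < r" using assms by force
  then show ?thesis
  proof cases
    case 1
    then show ?thesis using vol_le_M[OF l, of 0] assms by (simp add: step_vol_0)
  next
    case 2
    obtain k where k: "k < Suc n" "r \<in> {grid l n k<..grid l n (Suc k)}" using grid_cell[OF 2] by blast
    have "grid l n k \<in> {0..Tstar}" using grid_bounds[of k n] k tenor_le by simp
    then show ?thesis using vol_le_M[OF l] step_vol_eq[OF k] by simp
  next
    case 3
    then show ?thesis using M_pos by (simp add: step_vol_late)
  qed
qed

lemma step_vol_tendsto:
  assumes r: "r \<in> {0..T l}"
  shows "(\<lambda>n. step_vol l n r) \<longlonglongrightarrow> lam r l"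
proof (cases "r = 0")
  case True
  then show ?thesis by (simp add: step_vol_0)
next
  case False
  then have r': "0 < r" "r \<le> T l" using r by auto
  have "\<forall>n. \<exists>k<Suc n. r \<in> {grid l n k<..grid l n (Suc k)}" using grid_cell[OF r'] by blast
  then obtain k where k: "\<And>n. k n < Suc n" "\<And>n. r \<in> {grid l n (k n)<..grid l n (Suc (k n))}" by metis
  have "(\<lambda>n. grid l n (k n)) \<longlonglongrightarrow> r"
  proof (rule tendsto_sandwich[of "\<lambda>n. r - T l / real (Suc n)" _ _ "\<lambda>n. r"])
    have "grid l n (Suc (k n)) = grid l n (k n) + T l / real (Suc n)" for n
    proof -
      have "T l * real (Suc (k n)) = T l * real (k n) + T l" by (simp add: algebra_simps)
      then show ?thesis unfolding grid_def by (simp only: add_divide_distrib)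
    qed
    then have "r - T l / real (Suc n) \<le> grid l n (k n)" for n using k(2)[of n] by auto
    then show "\<forall>\<^sub>F n in sequentially. r - T l / real (Suc n) \<le> grid l n (k n)" by simp
    show "\<forall>\<^sub>F n in sequentially. grid l n (k n) \<le> r" using k(2) by (intro always_eventually) (auto intro: less_imp_le)
    have "(\<lambda>n. T l / real (Suc n)) \<longlonglongrightarrow> 0"
      by (rule LIMSEQ_Suc[OF lim_const_over_n])
    then have "(\<lambda>n. r - T l / real (Suc n)) \<longlonglongrightarrow> r - 0" by (intro tendsto_intros)
    then show "(\<lambda>n. r - T l / real (Suc n)) \<longlonglongrightarrow> r" by simp
  qed simp
  moreover have "grid l n (k n) \<in> {0..T l}" for n using k(1)[of n] by (intro grid_bounds) simp
  ultimately have "(\<lambda>n. lam (grid l n (k n)) l) \<longlonglongrightarrow> lam r l"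
    using vol_continuous[OF l] r by (auto simp: continuous_on_sequentially comp_def)
  then show ?thesis using step_vol_eq[OF k] by simp
qed

lemma riemann_elementary: "elementary_process P F (T l) (riemann l n)"
  unfolding elementary_process_def riemann_def
  using grid_bounds grid_mono by (auto intro: exI[of _ "\<bar>lam _ l\<bar>"])

text \<open>
  Confining the grid points to \<open>[s,t]\<close> turns the increment over \<open>[s,t]\<close> into a sum over a chain that
  starts exactly at \<open>s\<close>, whether or not \<open>s\<close> is a grid point.
\<close>

lemma riemann_integral_increment:
  assumes st: "0 \<le> s" "s \<le> t"
  shows "riemann_sum l n t \<omega> - riemann_sum l n s \<omega>
    = (\<Sum>k<Suc n. lam (grid l n k) l *
        (H (max s (min (grid l n (Suc k)) t)) \<omega> - H (max s (min (grid l n k) t)) \<omega>))"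
proof -
  have clamp: "H (max s (min x t)) \<omega> = H (min x t) \<omega> - H (min x s) \<omega> + H s \<omega>" for x
    using st by (auto simp: max_def min_def)
  show ?thesis
    unfolding elementary_integral_riemann clamp sum_subtractf[symmetric] right_diff_distrib[symmetric]
    by (simp add: algebra_simps)
qed

lemma riemann_increment_char:
  assumes st: "0 \<le> s" "s \<le> t" "t \<le> T l" and A: "A \<in> sets (F s)"
  shows "(CLINT \<omega>|P. indicator A \<omega> * iexp (u *
      (riemann_sum l n t \<omega> - riemann_sum l n s \<omega>)))
    = prob A * exp (CLINT r:{s<..t}|lborel. psi r (u * step_vol l n r))"
proof -
  define q where "q k = max s (min (grid l n k) t)" for k
  have q0: "q 0 = s" and qn: "q (Suc n) = t" using st by (simp_all add: q_def)
  have mono: "q k \<le> q (Suc k)" for k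
    unfolding q_def using grid_mono[of k "Suc k" n] by (auto simp: max_def min_def)
  have int: "set_integrable lborel {s<..t} (\<lambda>r. psi r (u * step_vol l n r))"
  proof (rule psi_time_integral[where V="\<bar>u\<bar> * M"])
    show "\<bar>u * step_vol l n r\<bar> \<le> \<bar>u\<bar> * M" if "r \<in> {0..Tstar}" for r
      using step_vol_le[OF that] by (auto simp: abs_mult intro!: mult_left_mono)
    show "(\<lambda>r. u * step_vol l n r) \<in> borel_measurable time_space"
      by (rule measurable_restrict_space1) measurable
    show "{s<..t} \<subseteq> {0..Tstar}" using st tenor_le by auto
  qed simp
  have "(CLINT \<omega>|P. indicator A \<omega> * iexp (u *
      (riemann_sum l n t \<omega> - riemann_sum l n s \<omega>)))
    = (CLINT \<omega>|P. indicator A \<omega> * iexp (u * (\<Sum>k<Suc n. lam (grid l n k) l * (H (q (Suc k)) \<omega> - H (q k) \<omega>))))"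
    unfolding riemann_integral_increment[OF st(1,2)] q_def ..
  also have "\<dots> = prob A * exp (\<Sum>k<Suc n. CLINT r:{q k<..q (Suc k)}|lborel. psi r (u * lam (grid l n k) l))"
    by (rule H_chain_char) (use A q0 qn mono st tenor_le in auto)
  also have "(\<Sum>k<Suc n. CLINT r:{q k<..q (Suc k)}|lborel. psi r (u * lam (grid l n k) l))
      = (\<Sum>k<Suc n. CLINT r:{q k<..q (Suc k)}|lborel. psi r (u * step_vol l n r))"
  proof (intro sum.cong refl set_lebesgue_integral_cong)
    fix k assume k: "k \<in> {..<Suc n}"
    show "\<forall>r. r \<in> {q k<..q (Suc k)} \<longrightarrow> psi r (u * lam (grid l n k) l) = psi r (u * step_vol l n r)"
    proof (intro allI impI)
      fix r assume "r \<in> {q k<..q (Suc k)}"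
      then have "r \<in> {grid l n k<..grid l n (Suc k)}"
        using st by (auto simp: q_def max_def min_def split: if_splits)
      then show "psi r (u * lam (grid l n k) l) = psi r (u * step_vol l n r)"
        using step_vol_eq[of k n r] k by simp
    qed
  qed simp
  also have "\<dots> = (CLINT r:{q 0<..q (Suc n)}|lborel. psi r (u * step_vol l n r))"
    by (rule set_integral_consecutive) (use mono int q0 qn in auto)
  finally show ?thesis unfolding q0 qn .
qed

lemma step_vol_exponent_tendsto:
  assumes st: "0 \<le> s" "t \<le> T l"
  shows "(\<lambda>n. CLINT r:{s<..t}|lborel. psi r (u * step_vol l n r))
    \<longlonglongrightarrow> (CLINT r:{s<..t}|lborel. psi r (u * lam r l))"
  unfolding set_lebesgue_integral_def
proof (rule integral_dominated_convergence)
  let ?K = "(\<bar>u\<bar> * M)\<^sup>2 * (2 + 1 / M\<^sup>2)"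
  have sub: "{s<..t} \<subseteq> {0..Tstar}" using st tenor_le by auto
  have "(\<lambda>r. u * lam r l) \<in> borel_measurable time_space" using vol_measurable[OF l] by measurable
  from time_space_measurable_indicator[OF psi_measurable[OF this] _ sub]
  show "(\<lambda>r. indicator {s<..t} r *\<^sub>R psi r (u * lam r l)) \<in> borel_measurable lborel" by simp
  have "(\<lambda>r. u * step_vol l n r) \<in> borel_measurable time_space" for n
    by (rule measurable_restrict_space1) measurable
  from time_space_measurable_indicator[OF psi_measurable[OF this] _ sub]
  show "(\<lambda>r. indicator {s<..t} r *\<^sub>R psi r (u * step_vol l n r)) \<in> borel_measurable lborel" for n by simp
  show "integrable lborel (\<lambda>r. ?K * (indicator {0..Tstar} r *\<^sub>R activity r))"
    using activity_set_integrable unfolding set_integrable_def by (rule integrable_mult_right)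
  show "AE r in lborel. (\<lambda>n. indicator {s<..t} r *\<^sub>R psi r (u * step_vol l n r))
      \<longlonglongrightarrow> indicator {s<..t} r *\<^sub>R psi r (u * lam r l)"
  proof (rule AE_I2)
    fix r
    show "(\<lambda>n. indicator {s<..t} r *\<^sub>R psi r (u * step_vol l n r)) \<longlonglongrightarrow> indicator {s<..t} r *\<^sub>R psi r (u * lam r l)"
    proof (cases "r \<in> {s<..t}")
      case True
      then have "r \<in> {0..T l}" "r \<in> {0..Tstar}" using st sub by auto
      then show ?thesis by (intro tendsto_scaleR tendsto_const psi_tendsto tendsto_mult step_vol_tendsto) auto
    qed simp
  qed
  show "AE r in lborel. norm (indicator {s<..t} r *\<^sub>R psi r (u * step_vol l n r)) \<le> ?K * (indicator {0..Tstar} r *\<^sub>R activity r)" for n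
  proof (rule AE_I2)
    fix r
    show "norm (indicator {s<..t} r *\<^sub>R psi r (u * step_vol l n r)) \<le> ?K * (indicator {0..Tstar} r *\<^sub>R activity r)"
    proof (cases "r \<in> {s<..t}")
      case True
      then have r: "r \<in> {0..Tstar}" using sub by auto
      have "\<bar>u * step_vol l n r\<bar> \<le> \<bar>u\<bar> * M"
        using step_vol_le[OF r] by (auto simp: abs_mult intro!: mult_left_mono)
      then have "(u * step_vol l n r)\<^sup>2 \<le> (\<bar>u\<bar> * M)\<^sup>2"
        using power_mono[of "\<bar>u * step_vol l n r\<bar>" "\<bar>u\<bar> * M" 2] by simp
      then have "(u * step_vol l n r)\<^sup>2 * (2 + 1 / M\<^sup>2) * activity r \<le> ?K * activity r"
        by (intro mult_right_mono activity_nonneg[OF r]) auto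
      then show ?thesis using psi_le[OF r, of "u * step_vol l n r"] True r by simp
    qed (auto simp: indicator_def activity_nonneg)
  qed
qed

end

end

section \<open>Integrals of the volatilities\<close>

text \<open>
  Conditionally on an event \<open>A\<close> of positive probability, \<open>D\<close> has the characteristic function it has
  unconditionally, hence the same distribution.
\<close>

lemma (in prob_space) indep_set_of_char:
  assumes G: "sets G \<subseteq> events" and D [measurable]: "D \<in> borel_measurable M"
    and char: "\<And>A u. A \<in> sets G \<Longrightarrow> (CLINT \<omega>|M. indicator A \<omega> * iexp (u * D \<omega>)) = prob A * (CLINT \<omega>|M. iexp (u * D \<omega>))"
  shows "indep_set (sets G) (sets (vimage_algebra (space M) D borel))"
proof (rule indep_setI)
  show "sets (vimage_algebra (space M) D borel) \<subseteq> events"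
    using measurable_sets[OF D] by (auto simp: sets_vimage_algebra2)
  fix A b assume A: "A \<in> sets G" and b: "b \<in> sets (vimage_algebra (space M) D borel)"
  from b obtain S where S [measurable]: "S \<in> sets borel" and bS: "b = D -` S \<inter> space M"
    by (auto simp: sets_vimage_algebra2)
  have AM [measurable]: "A \<in> events" using A G by auto
  have bM [measurable]: "b \<in> events" unfolding bS by measurable
  show "prob (A \<inter> b) = prob A * prob b"
  proof (cases "prob A = 0")
    case True
    have "prob (A \<inter> b) \<le> prob A" by (intro finite_measure_mono) auto
    then show ?thesis using True by (simp add: measure_le_0_iff)
  next
    case False
    then have pA: "0 < prob A" by (simp add: zero_less_measure_iff)
    define Q where "Q = density M (\<lambda>\<omega>. ennreal (indicator A \<omega> / prob A))"
    have Qem: "emeasure Q B = ennreal (prob (A \<inter> B) / prob A)" if [measurable]: "B \<in> events" for B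
    proof -
      have "emeasure Q B = (\<integral>\<^sup>+\<omega>. ennreal (indicator A \<omega> / prob A) * indicator B \<omega> \<partial>M)"
        unfolding Q_def by (rule emeasure_density) auto
      also have "\<dots> = (\<integral>\<^sup>+\<omega>. ennreal (1 / prob A) * indicator (A \<inter> B) \<omega> \<partial>M)"
        by (intro nn_integral_cong) (auto simp: indicator_def)
      also have "\<dots> = ennreal (1 / prob A) * emeasure M (A \<inter> B)" by (rule nn_integral_cmult_indicator) auto
      also have "\<dots> = ennreal (prob (A \<inter> B) / prob A)"
        using pA by (simp add: emeasure_eq_measure ennreal_mult[symmetric])
      finally show ?thesis .
    qed
    have "emeasure Q (space Q) = 1"
      using Qem[of "space M"] pA sets.sets_into_space[OF AM] by (simp add: Q_def Int_absorb2)
    then interpret Q: prob_space Q by (rule prob_spaceI)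
    have DQ [measurable]: "D \<in> borel_measurable Q" by (simp add: Q_def)
    have "distr Q borel D = distr M borel D"
    proof (rule Levy_uniqueness)
      show "real_distribution (distr Q borel D)" by (rule Q.real_distribution_distr) simp
      show "real_distribution (distr M borel D)" by (rule real_distribution_distr) simp
      show "char (distr Q borel D) = char (distr M borel D)"
      proof
        fix u
        have "char (distr Q borel D) u = (CLINT \<omega>|Q. iexp (u * D \<omega>))"
          unfolding char_def by (rule integral_distr) auto
        also have "\<dots> = (CLINT \<omega>|M. (indicator A \<omega> / prob A) *\<^sub>R iexp (u * D \<omega>))"
          unfolding Q_def by (rule integral_density) auto
        also have "\<dots> = (CLINT \<omega>|M. of_real (1 / prob A) * (indicator A \<omega> * iexp (u * D \<omega>)))"
          by (intro Bochner_Integration.integral_cong) (auto simp: indicator_def scaleR_conv_of_real)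
        also have "\<dots> = of_real (1 / prob A) * (CLINT \<omega>|M. indicator A \<omega> * iexp (u * D \<omega>))"
          by (rule integral_mult_right_zero)
        also have "\<dots> = (CLINT \<omega>|M. iexp (u * D \<omega>))" unfolding char[OF A] using pA by simp
        also have "\<dots> = char (distr M borel D) u"
          unfolding char_def by (rule integral_distr[symmetric]) auto
        finally show "char (distr Q borel D) u = char (distr M borel D) u" .
      qed
    qed
    then have "emeasure (distr Q borel D) S = emeasure (distr M borel D) S" by simp
    then have "emeasure Q b = emeasure M b"
      by (simp add: emeasure_distr bS) (simp add: Q_def)
    then have "prob (A \<inter> b) / prob A = prob b"
      using Qem[OF bM] by (simp add: emeasure_eq_measure ennreal_inj measure_nonneg)
    then show ?thesis using pA by (simp add: field_simps)
  qed
qed (rule G)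

lemma abs_power_le_even_power: "\<bar>x\<bar> ^ k \<le> 1 + x ^ (2 * (k + 2))" for x :: real
proof (cases "\<bar>x\<bar> \<le> 1")
  case True
  then have "\<bar>x\<bar> ^ k \<le> 1" by (intro power_le_one) auto
  moreover have "0 \<le> x ^ (2 * (k + 2))" by (rule zero_le_even_power) simp
  ultimately show ?thesis by linarith
next
  case False
  then have "\<bar>x\<bar> ^ k \<le> \<bar>x\<bar> ^ (2 * (k + 2))" by (intro power_increasing) auto
  also have "\<dots> = x ^ (2 * (k + 2))" by (simp only: power_mult power2_abs)
  finally show ?thesis by simp
qed

lemma half_less_abs_of_diff: "\<eta> < \<bar>x - y\<bar> \<Longrightarrow> \<eta> / 2 < \<bar>x\<bar> \<or> \<eta> / 2 < \<bar>y\<bar>" for x y \<eta> :: real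
  by linarith

lemma (in prob_space) AE_eq_0_of_small:
  assumes "\<And>\<eta>. 0 < \<eta> \<Longrightarrow> {\<omega>\<in>space M. \<exists>t\<in>S. \<eta> < \<bar>Z t \<omega>\<bar>} \<in> events"
    and "\<And>\<eta>. 0 < \<eta> \<Longrightarrow> prob {\<omega>\<in>space M. \<exists>t\<in>S. \<eta> < \<bar>Z t \<omega> :: real\<bar>} = 0"
  shows "AE \<omega> in M. \<forall>t\<in>S. Z t \<omega> = 0"
proof -
  have "AE \<omega> in M. \<not> (\<exists>t\<in>S. inverse (real (Suc m)) < \<bar>Z t \<omega>\<bar>)" for m
    by (rule AE_I'[of "{\<omega>\<in>space M. \<exists>t\<in>S. inverse (real (Suc m)) < \<bar>Z t \<omega>\<bar>}"])
      (use assms[of "inverse (real (Suc m))"] in \<open>auto simp: null_sets_def emeasure_eq_measure\<close>)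
  then have "AE \<omega> in M. \<forall>m. \<not> (\<exists>t\<in>S. inverse (real (Suc m)) < \<bar>Z t \<omega>\<bar>)" by (simp add: AE_all_countable)
  then show ?thesis
  proof eventually_elim
    case (elim \<omega>)
    show ?case
    proof (intro ballI, rule ccontr)
      fix t assume t: "t \<in> S" "Z t \<omega> \<noteq> 0"
      then obtain m where "inverse (real (Suc m)) < \<bar>Z t \<omega>\<bar>" using reals_Archimedean[of "\<bar>Z t \<omega>\<bar>"] by auto
      with elim t show False by blast
    qed
  qed
qed

context levy_libor
begin

lemma H_min_right_continuous:
  assumes w: "\<omega> \<in> space P" and t: "0 \<le> t" "t < Tstar"
  shows "((\<lambda>t. H (min g t) \<omega>) \<longlongrightarrow> H (min g t) \<omega>) (at_right t)"
proof (cases "g \<le> t")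
  case True
  have "\<forall>\<^sub>F r in at_right t. H (min g r) \<omega> = H (min g t) \<omega>"
    using True by (auto simp: eventually_at_right_field min_def intro!: exI[of _ "t + 1"])
  then show ?thesis by (rule tendsto_eventually)
next
  case False
  then have "\<forall>\<^sub>F r in at_right t. H r \<omega> = H (min g r) \<omega>"
    by (auto simp: eventually_at_right_field min_def intro!: exI[of _ g])
  moreover have "((\<lambda>t. H t \<omega>) \<longlongrightarrow> H t \<omega>) (at_right t)"
    using H_cadlag[OF w] t by (auto simp: cadlag_on_def)
  ultimately show ?thesis using False by (auto intro: Lim_transform_eventually)
qed

context
  fixes l :: nat
  assumes l: "l \<in> {1..N}"
begin

lemmas lT = tenor_pos[OF l] tenor_le[OF l]

lemma riemann_integral_measurable:
  assumes "t \<in> {0..T l}"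
  shows "riemann_sum l n t \<in> borel_measurable P"
proof -
  have "H (min (grid l n k) t) \<in> borel_measurable P" if "k \<le> Suc n" for k
    using grid_bounds[OF l that] assms lT by (intro F_measurable[OF _ H_adapted]) auto
  then show ?thesis
    unfolding elementary_integral_riemann
    by (intro borel_measurable_sum borel_measurable_times borel_measurable_diff) auto
qed

lemma riemann_integral_right_continuous:
  assumes "\<omega> \<in> space P" "t \<in> {0..<T l}"
  shows "((\<lambda>t. riemann_sum l n t \<omega>) \<longlongrightarrow> riemann_sum l n t \<omega>) (at_right t)"
  unfolding elementary_integral_riemann
  using assms lT by (intro tendsto_intros H_min_right_continuous) auto

definition vol_integral :: "(real \<Rightarrow> 'a \<Rightarrow> real) \<Rightarrow> bool" where
  "vol_integral J \<longleftrightarrow> stochastic_integral P F (T l) (\<lambda>s \<omega>. lam s l) H J"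

lemma vol_integralD:
  assumes "vol_integral J"
  shows "t \<in> {0..T l} \<Longrightarrow> J t \<in> borel_measurable (F t)"
    and "t \<in> {0..T l} \<Longrightarrow> J t \<in> borel_measurable P"
    and "\<omega> \<in> space P \<Longrightarrow> cadlag_on (T l) (\<lambda>t. J t \<omega>)"
    and "ucp_tendsto P (T l) (riemann_sum l) J"
proof -
  show ad: "J t \<in> borel_measurable (F t)" if "t \<in> {0..T l}" for t
    using assms that by (auto simp: vol_integral_def stochastic_integral_def adapted_on_def)
  show "J t \<in> borel_measurable P" if "t \<in> {0..T l}" for t
    using ad[OF that] that lT by (intro F_measurable[of t]) auto
  show "\<omega> \<in> space P \<Longrightarrow> cadlag_on (T l) (\<lambda>t. J t \<omega>)"
    using assms by (auto simp: vol_integral_def stochastic_integral_def)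
  have bd: "\<bar>elementary_value (riemann l n) t \<omega>\<bar> \<le> M" if "t \<in> {0..T l}" for n t \<omega>
    unfolding elementary_value_riemann using that lT by (intro step_vol_le[OF l]) auto
  have cv: "(\<lambda>n. elementary_value (riemann l n) t \<omega>) \<longlonglongrightarrow> lam t l" if "t \<in> {0..T l}" for t \<omega>
    unfolding elementary_value_riemann by (rule step_vol_tendsto[OF l that])
  show "ucp_tendsto P (T l) (riemann_sum l) J"
    using assms riemann_elementary[OF l] bd cv
    unfolding vol_integral_def stochastic_integral_def by blast
qed

lemma riemann_deviation_measurable:
  assumes J: "vol_integral J"
  shows "{\<omega>\<in>space P. \<exists>t\<in>{0..T l}. \<eta> < \<bar>riemann_sum l n t \<omega> - J t \<omega>\<bar>} \<in> events"
proof (rule exceedance_measurable)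
  show "(\<lambda>\<omega>. riemann_sum l n t \<omega> - J t \<omega>) \<in> borel_measurable P" if "t \<in> {0..T l}" for t
    using riemann_integral_measurable[OF that] vol_integralD(2)[OF J that] by measurable
  show "((\<lambda>t. riemann_sum l n t \<omega> - J t \<omega>) \<longlongrightarrow>
      riemann_sum l n t \<omega> - J t \<omega>) (at_right t)"
    if "\<omega> \<in> space P" "t \<in> {0..<T l}" for \<omega> t
    using vol_integralD(3)[OF J that(1)] that(2) riemann_integral_right_continuous[OF that]
    by (intro tendsto_intros) (auto simp: cadlag_on_def)
qed

lemma riemann_deviation_tendsto:
  assumes J: "vol_integral J" and "0 < \<eta>"
  shows "(\<lambda>n. prob {\<omega>\<in>space P. \<exists>t\<in>{0..T l}. \<eta> < \<bar>riemann_sum l n t \<omega> - J t \<omega>\<bar>}) \<longlonglongrightarrow> 0"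
  using vol_integralD(4)[OF J] \<open>0 < \<eta>\<close> by (auto simp: ucp_tendsto_def)

text \<open>
  Both sides pass to the limit along the Riemann sums: the left one by convergence in probability,
  the right one by dominated convergence with the activity as majorant.
\<close>

lemma vol_integral_increment_char:
  assumes J: "vol_integral J" and st: "0 \<le> s" "s \<le> t" "t \<le> T l" and A: "A \<in> sets (F s)"
  shows "(CLINT \<omega>|P. indicator A \<omega> * iexp (u * (J t \<omega> - J s \<omega>)))
    = prob A * exp (CLINT r:{s<..t}|lborel. psi r (u * lam r l))"
proof (rule LIMSEQ_unique)
  let ?I = "\<lambda>n. riemann_sum l n"
  have AP: "A \<in> events" using A F_sub[of s] st lT by auto
  have mt: "s \<in> {0..T l}" "t \<in> {0..T l}" using st by auto
  note [measurable] = riemann_integral_measurable[OF mt(1)] riemann_integral_measurable[OF mt(2)]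
    vol_integralD(2)[OF J mt(1)] vol_integralD(2)[OF J mt(2)]
  show "(\<lambda>n. CLINT \<omega>|P. indicator A \<omega> * iexp (u * (?I n t \<omega> - ?I n s \<omega>)))
      \<longlonglongrightarrow> (CLINT \<omega>|P. indicator A \<omega> * iexp (u * (J t \<omega> - J s \<omega>)))"
  proof (rule expectation_iexp_tendsto[OF _ _ AP])
    fix \<eta> :: real assume \<eta>: "0 < \<eta>"
    let ?B = "\<lambda>n. {\<omega>\<in>space P. \<exists>t\<in>{0..T l}. \<eta> / 2 < \<bar>?I n t \<omega> - J t \<omega>\<bar>}"
    show "(\<lambda>n. prob {\<omega>\<in>space P. \<eta> < \<bar>?I n t \<omega> - ?I n s \<omega> - (J t \<omega> - J s \<omega>)\<bar>}) \<longlonglongrightarrow> 0"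
    proof (rule tendsto_sandwich[of "\<lambda>_. 0" _ _ "\<lambda>n. prob (?B n)"])
      have "{\<omega>\<in>space P. \<eta> < \<bar>?I n t \<omega> - ?I n s \<omega> - (J t \<omega> - J s \<omega>)\<bar>} \<subseteq> ?B n" for n
      proof
        fix \<omega> assume w: "\<omega> \<in> {\<omega>\<in>space P. \<eta> < \<bar>?I n t \<omega> - ?I n s \<omega> - (J t \<omega> - J s \<omega>)\<bar>}"
        then have "\<eta> / 2 < \<bar>?I n t \<omega> - J t \<omega>\<bar> \<or> \<eta> / 2 < \<bar>?I n s \<omega> - J s \<omega>\<bar>"
          by (intro half_less_abs_of_diff) (simp add: algebra_simps)
        with w mt show "\<omega> \<in> ?B n" by blast
      qed
      then show "\<forall>\<^sub>F n in sequentially. prob {\<omega>\<in>space P. \<eta> < \<bar>?I n t \<omega> - ?I n s \<omega> - (J t \<omega> - J s \<omega>)\<bar>} \<le> prob (?B n)"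
        by (intro always_eventually allI finite_measure_mono riemann_deviation_measurable[OF J])
      show "(\<lambda>n. prob (?B n)) \<longlonglongrightarrow> 0" using riemann_deviation_tendsto[OF J, of "\<eta> / 2"] \<eta> by simp
    qed auto
  qed measurable
  show "(\<lambda>n. CLINT \<omega>|P. indicator A \<omega> * iexp (u * (?I n t \<omega> - ?I n s \<omega>)))
      \<longlonglongrightarrow> prob A * exp (CLINT r:{s<..t}|lborel. psi r (u * lam r l))"
    unfolding riemann_increment_char[OF l st A]
    by (intro tendsto_intros step_vol_exponent_tendsto[OF l]) (use st in auto)
qed

text \<open>
  Both processes are ucp limits of the same Riemann sums. A solution of the perturbed equation comes
  with its own integral for each \<open>\<epsilon>\<close>; this lemma allows one integral to be used for all of them.
\<close>

lemma vol_integral_unique: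
  assumes J: "vol_integral J" and K: "vol_integral K"
  shows "AE \<omega> in P. \<forall>t\<in>{0..T l}. J t \<omega> = K t \<omega>"
proof -
  let ?I = "\<lambda>n. riemann_sum l n"
  have "AE \<omega> in P. \<forall>t\<in>{0..T l}. J t \<omega> - K t \<omega> = 0"
  proof (rule AE_eq_0_of_small[of "{0..T l}" "\<lambda>t \<omega>. J t \<omega> - K t \<omega>"])
    fix \<eta> :: real assume \<eta>: "0 < \<eta>"
    let ?S = "{\<omega>\<in>space P. \<exists>t\<in>{0..T l}. \<eta> < \<bar>J t \<omega> - K t \<omega>\<bar>}"
    show S: "?S \<in> events"
    proof (rule exceedance_measurable)
      show "(\<lambda>\<omega>. J t \<omega> - K t \<omega>) \<in> borel_measurable P" if "t \<in> {0..T l}" for t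
        using vol_integralD(2)[OF J that] vol_integralD(2)[OF K that] by measurable
      show "((\<lambda>t. J t \<omega> - K t \<omega>) \<longlongrightarrow> J t \<omega> - K t \<omega>) (at_right t)"
        if "\<omega> \<in> space P" "t \<in> {0..<T l}" for \<omega> t
        using vol_integralD(3)[OF J that(1)] vol_integralD(3)[OF K that(1)] that(2)
        by (intro tendsto_intros) (auto simp: cadlag_on_def)
    qed
    let ?B = "\<lambda>J n. {\<omega>\<in>space P. \<exists>t\<in>{0..T l}. \<eta> / 2 < \<bar>?I n t \<omega> - J t \<omega>\<bar>}"
    have le: "prob ?S \<le> prob (?B J n) + prob (?B K n)" for n
    proof -
      have "?S \<subseteq> ?B J n \<union> ?B K n"
      proof
        fix \<omega> assume "\<omega> \<in> ?S"
        then obtain t where t: "\<omega> \<in> space P" "t \<in> {0..T l}" "\<eta> < \<bar>J t \<omega> - K t \<omega>\<bar>" by auto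
        then have "\<eta> / 2 < \<bar>?I n t \<omega> - K t \<omega>\<bar> \<or> \<eta> / 2 < \<bar>?I n t \<omega> - J t \<omega>\<bar>"
          by (intro half_less_abs_of_diff) (simp add: algebra_simps)
        with t show "\<omega> \<in> ?B J n \<union> ?B K n" by blast
      qed
      then have "prob ?S \<le> prob (?B J n \<union> ?B K n)"
        by (intro finite_measure_mono sets.Un riemann_deviation_measurable J K)
      also have "\<dots> \<le> prob (?B J n) + prob (?B K n)"
        by (intro measure_Un_le riemann_deviation_measurable J K)
      finally show ?thesis .
    qed
    have "(\<lambda>n. prob (?B J n) + prob (?B K n)) \<longlonglongrightarrow> 0 + 0"
      using \<eta> by (intro tendsto_add riemann_deviation_tendsto J K) auto
    then have "prob ?S \<le> 0"
      using le by (intro LIMSEQ_le_const[of "\<lambda>n. prob (?B J n) + prob (?B K n)" 0]) auto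
    then show "prob ?S = 0" by (simp add: measure_le_0_iff)
  qed
  then show ?thesis by simp
qed

lemma vol_integral_0:
  assumes J: "vol_integral J"
  shows "AE \<omega> in P. J 0 \<omega> = 0"
proof -
  let ?I = "\<lambda>n. riemann_sum l n"
  have I0: "?I n 0 \<omega> = 0" for n \<omega>
  proof -
    have "min (grid l n k) 0 = 0" for k using grid_mono[OF l, of 0 k n] grid_0[OF l] by simp
    then show ?thesis unfolding elementary_integral_riemann by simp
  qed
  have z: "(0::real) \<in> {0..T l}" using lT by simp
  have "AE \<omega> in P. \<forall>t\<in>{0}. J t \<omega> = 0"
  proof (rule AE_eq_0_of_small[of "{0}" J])
    fix \<eta> :: real assume \<eta>: "0 < \<eta>"
    let ?S = "{\<omega>\<in>space P. \<exists>t\<in>{0}. \<eta> < \<bar>J t \<omega>\<bar>}"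
    let ?B = "\<lambda>n. {\<omega>\<in>space P. \<exists>t\<in>{0..T l}. \<eta> < \<bar>?I n t \<omega> - J t \<omega>\<bar>}"
    have [measurable]: "J 0 \<in> borel_measurable P" by (rule vol_integralD(2)[OF J z])
    have "{\<omega>\<in>space P. \<eta> < \<bar>J 0 \<omega>\<bar>} \<in> events" by measurable
    then show "?S \<in> events" by simp
    have "?S \<subseteq> ?B n" for n
    proof
      fix \<omega> assume "\<omega> \<in> ?S"
      then have "\<omega> \<in> space P" "\<eta> < \<bar>?I n 0 \<omega> - J 0 \<omega>\<bar>" by (auto simp: I0)
      with z show "\<omega> \<in> ?B n" by blast
    qed
    then have "prob ?S \<le> prob (?B n)" for n
      by (intro finite_measure_mono riemann_deviation_measurable J)
    then have "prob ?S \<le> 0"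
      using riemann_deviation_tendsto[OF J \<eta>] by (intro LIMSEQ_le_const[of "\<lambda>n. prob (?B n)" 0]) auto
    then show "prob ?S = 0" by (simp add: measure_le_0_iff)
  qed
  then show ?thesis by simp
qed

section \<open>Moments of the integrals\<close>

definition jump_cumulant :: "nat \<Rightarrow> real \<Rightarrow> real" where
  "jump_cumulant n s = (LINT y|\<nu> s. (lam s l * y) ^ n)"

lemma vol_jump_pair_measurable:
  "(\<lambda>z. lam (fst z) l) \<in> borel_measurable (time_space \<Otimes>\<^sub>M (borel :: real measure))"
  by (rule measurable_compose[OF measurable_fst vol_measurable[OF l]])

lemma jump_cumulant_measurable: "2 \<le> n \<Longrightarrow> jump_cumulant n \<in> borel_measurable time_space"
proof -
  assume n: "2 \<le> n"
  note [measurable] = vol_jump_pair_measurable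
  have "(\<lambda>(s, y). (lam s l * y) ^ n) \<in> borel_measurable (time_space \<Otimes>\<^sub>M borel)"
    unfolding case_prod_beta' by measurable
  then show ?thesis
    unfolding jump_cumulant_def using n by (intro integral_nu_measurable) auto
qed

lemma jump_cumulant_le:
  assumes n: "2 \<le> n" and s: "s \<in> {0..Tstar}"
  shows "integrable (\<nu> s) (\<lambda>y. (lam s l * y) ^ n)" "\<bar>jump_cumulant n s\<bar> \<le> fact n * exp M * jump_mass s"
proof -
  have "norm ((lam s l * y) ^ n) \<le> fact n * exp M * jump_weight M y" for y
    using power_le_jump_weight[OF M_pos vol_le_M[OF l s] n, of y] by (simp add: power_abs)
  note j = jump_integral[OF s _ this]
  show "integrable (\<nu> s) (\<lambda>y. (lam s l * y) ^ n)" by (rule j) measurable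
  have "norm (LINT y|\<nu> s. (lam s l * y) ^ n) \<le> fact n * exp M * jump_mass s" by (rule j) measurable
  then show "\<bar>jump_cumulant n s\<bar> \<le> fact n * exp M * jump_mass s" by (simp add: jump_cumulant_def)
qed

text \<open>
  The coefficient of \<open>u\<^sup>n\<close> in the expansion of \<open>psi s (u * lam s l)\<close> at \<open>u = 0\<close>. There is none for \<open>n < 2\<close>,
  because the truncation function is the identity and \<open>H\<close> has no drift.
\<close>

definition cumulant_coeff :: "nat \<Rightarrow> real \<Rightarrow> complex" where
  "cumulant_coeff n s = (if 2 \<le> n then \<i> ^ n / fact n * of_real (jump_cumulant n s) else 0)
     - (if n = 2 then of_real (c s * (lam s l)\<^sup>2 / 2) else 0)"

lemma cumulant_coeff_measurable: "cumulant_coeff n \<in> borel_measurable time_space"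
proof -
  note [measurable] = c_measurable vol_measurable[OF l]
  show ?thesis
  proof (cases "2 \<le> n")
    case True
    note [measurable] = jump_cumulant_measurable[OF True]
    show ?thesis unfolding cumulant_coeff_def by measurable
  qed (auto simp: cumulant_coeff_def[abs_def])
qed

lemma cumulant_coeff_le:
  assumes s: "s \<in> {0..Tstar}"
  shows "cmod (cumulant_coeff n s) \<le> (exp M + M\<^sup>2) * activity s"
proof -
  have 1: "cmod (if 2 \<le> n then \<i> ^ n / fact n * of_real (jump_cumulant n s) else 0) \<le> exp M * activity s"
  proof (cases "2 \<le> n")
    case True
    have "cmod (\<i> ^ n / fact n * of_real (jump_cumulant n s)) = \<bar>jump_cumulant n s\<bar> / fact n"
      by (simp add: norm_mult norm_divide norm_power)
    also have "\<dots> \<le> exp M * jump_mass s"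
      using jump_cumulant_le(2)[OF True s] by (simp add: divide_le_eq mult_ac)
    also have "\<dots> \<le> exp M * activity s" using jump_mass_le_activity[OF s] by simp
    finally show ?thesis using True by simp
  qed (use activity_nonneg[OF s] in simp)
  have 2: "cmod (if n = 2 then of_real (c s * (lam s l)\<^sup>2 / 2) else 0) \<le> M\<^sup>2 * activity s"
  proof (cases "n = 2")
    case True
    have "(lam s l)\<^sup>2 \<le> M\<^sup>2" using vol_le_M[OF l s] power_mono[of "\<bar>lam s l\<bar>" M 2] by simp
    then have "c s * (lam s l)\<^sup>2 \<le> activity s * M\<^sup>2"
      using c_nonneg[OF s] c_le_activity[OF s] activity_nonneg[OF s] by (intro mult_mono) auto
    moreover have "0 \<le> c s * (lam s l)\<^sup>2" using c_nonneg[OF s] by simp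
    moreover have "cmod (of_real (c s * (lam s l)\<^sup>2 / 2)) = \<bar>c s * (lam s l)\<^sup>2 / 2\<bar>" by (rule norm_of_real)
    ultimately show ?thesis using True by (simp add: mult.commute)
  qed (use activity_nonneg[OF s] in simp)
  show ?thesis
    unfolding cumulant_coeff_def using norm_triangle_ineq4 1 2
    by (smt (verit, best) distrib_right)
qed

text \<open>
  Taylor's theorem for \<open>exp (i u \<lambda> y)\<close> under the jump integral. The terms of degree \<open>0\<close> and \<open>1\<close> are those
  subtracted in the exponent, and the Gaussian part is the correction in degree \<open>2\<close>, whence \<open>k \<ge> 2\<close>.
\<close>

lemma psi_cumulant_expansion:
  assumes s: "s \<in> {0..Tstar}" and k: "2 \<le> k"
  shows "cmod (psi s (u * lam s l) - (\<Sum>n<2*k. cumulant_coeff n s * of_real u ^ n)) \<le> exp M * \<bar>u\<bar> ^ (2 * k) * activity s"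
proof -
  let ?v = "u * lam s l"
  have set: "{..<2*k} = insert 0 (insert 1 {2..<2*k})" using k by auto
  define g where "g n y = (\<i> * of_real (?v * y)) ^ n / fact n" for n y
  have g_alt: "g n y = \<i> ^ n / fact n * of_real u ^ n * of_real ((lam s l * y) ^ n)" for n y
    by (simp add: g_def power_mult_distrib mult_ac)
  have g_int: "integrable (\<nu> s) (g n)" if "2 \<le> n" for n
    unfolding g_alt[abs_def]
    by (intro integrable_mult_right integrable_of_real jump_cumulant_le(1)[OF that s])
  have "(\<Sum>n<2*k. cumulant_coeff n s * of_real u ^ n)
      = (\<Sum>n\<in>{2..<2*k}. \<i> ^ n / fact n * of_real u ^ n * of_real (jump_cumulant n s))
        - (\<Sum>n\<in>{2..<2*k}. if n = 2 then of_real (c s * (lam s l)\<^sup>2 / 2) * of_real u ^ n else 0)"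
    unfolding set sum_subtractf[symmetric]
    by (simp add: cumulant_coeff_def) (intro sum.cong refl; simp add: algebra_simps)
  also have "(\<Sum>n\<in>{2..<2*k}. if n = 2 then of_real (c s * (lam s l)\<^sup>2 / 2) * of_real u ^ n else 0)
      = complex_of_real (c s / 2 * ?v\<^sup>2)"
    using k by (simp add: sum.delta power_mult_distrib)
  also have "(\<Sum>n\<in>{2..<2*k}. \<i> ^ n / fact n * of_real u ^ n * of_real (jump_cumulant n s))
      = (CLINT y|\<nu> s. \<Sum>n\<in>{2..<2*k}. g n y)"
  proof -
    have "(CLINT y|\<nu> s. \<Sum>n\<in>{2..<2*k}. g n y) = (\<Sum>n\<in>{2..<2*k}. CLINT y|\<nu> s. g n y)"
      by (rule Bochner_Integration.integral_sum) (use g_int in auto)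
    also have "\<dots> = (\<Sum>n\<in>{2..<2*k}. \<i> ^ n / fact n * of_real u ^ n * of_real (jump_cumulant n s))"
      unfolding g_alt jump_cumulant_def integral_mult_right_zero integral_complex_of_real ..
    finally show ?thesis ..
  qed
  finally have "psi s ?v - (\<Sum>n<2*k. cumulant_coeff n s * of_real u ^ n)
      = (CLINT y|\<nu> s. iexp (?v * y) - 1 - \<i> * of_real (?v * y)) - (CLINT y|\<nu> s. \<Sum>n\<in>{2..<2*k}. g n y)"
    unfolding psi_eq by simp
  also have "\<dots> = (CLINT y|\<nu> s. (iexp (?v * y) - 1 - \<i> * of_real (?v * y)) - (\<Sum>n\<in>{2..<2*k}. g n y))"
    using psi_jump_part(1)[OF s, of ?v] g_int
    by (subst Bochner_Integration.integral_diff) auto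
  also have "(\<lambda>y. (iexp (?v * y) - 1 - \<i> * of_real (?v * y)) - (\<Sum>n\<in>{2..<2*k}. g n y))
      = (\<lambda>y. iexp (?v * y) - (\<Sum>n<2*k. g n y))"
    unfolding set by (simp add: g_def algebra_simps)
  finally have eq: "psi s ?v - (\<Sum>n<2*k. cumulant_coeff n s * of_real u ^ n)
      = (CLINT y|\<nu> s. iexp (?v * y) - (\<Sum>n<2*k. g n y))" .
  have le: "cmod (iexp (?v * y) - (\<Sum>n<2*k. g n y)) \<le> exp M * \<bar>u\<bar> ^ (2 * k) * jump_weight M y" for y
  proof -
    have "{..<2*k} = {..2*k-1}" using k by auto
    then have "cmod (iexp (?v * y) - (\<Sum>n<2*k. g n y)) \<le> \<bar>?v * y\<bar> ^ (2 * k) / fact (2 * k)"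
      using iexp_approx1[of "?v * y" "2 * k - 1"] k by (simp add: g_def)
    also have "\<bar>?v * y\<bar> ^ (2 * k) = \<bar>u\<bar> ^ (2 * k) * \<bar>lam s l * y\<bar> ^ (2 * k)"
      by (simp add: abs_mult power_mult_distrib mult_ac)
    also have "\<dots> / fact (2 * k) \<le> \<bar>u\<bar> ^ (2 * k) * (fact (2 * k) * exp M * jump_weight M y) / fact (2 * k)"
      using k by (intro divide_right_mono mult_left_mono power_le_jump_weight[OF M_pos vol_le_M[OF l s]]) auto
    finally show ?thesis by (simp add: mult_ac)
  qed
  have "(\<lambda>y. iexp (?v * y) - (\<Sum>n<2*k. g n y)) \<in> borel_measurable borel" unfolding g_def by measurable
  from jump_integral(2)[OF s this le]
  have "cmod (psi s ?v - (\<Sum>n<2*k. cumulant_coeff n s * of_real u ^ n)) \<le> exp M * \<bar>u\<bar> ^ (2 * k) * jump_mass s"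
    unfolding eq .
  also have "\<dots> \<le> exp M * \<bar>u\<bar> ^ (2 * k) * activity s"
    using jump_mass_le_activity[OF s] by (intro mult_left_mono) auto
  finally show ?thesis .
qed

lemma vol_integral_even_moment:
  assumes J: "vol_integral J" and k: "2 \<le> k"
  shows "\<exists>K::real. \<forall>t\<in>{0..T l}. (\<integral>\<^sup>+\<omega>. ennreal (J t \<omega> ^ (2 * k)) \<partial>P) \<le> ennreal K"
proof -
  \<comment> \<open>bounds the integrated cumulants and the remainder for all \<open>t\<close> at once\<close>
  define B where "B = (exp M + M\<^sup>2) * activity_total"
  have k0: "0 < k" using k by simp
  obtain K :: real where K: "\<forall>\<mu> \<Psi> a. real_distribution \<mu> \<longrightarrow> (\<forall>u. char \<mu> u = exp (\<Psi> u)) \<longrightarrow>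
      (\<forall>n<2*k. cmod (a n) \<le> B) \<longrightarrow>
      (\<forall>u. \<bar>u\<bar> \<le> 1 \<longrightarrow> cmod (\<Psi> u - (\<Sum>n<2*k. a n * of_real u ^ n)) \<le> B * \<bar>u\<bar> ^ (2 * k)) \<longrightarrow>
      (\<integral>\<^sup>+x. ennreal (x ^ (2 * k)) \<partial>\<mu>) \<le> ennreal K"
    using moment_bound_of_cumulant_expansion[OF k0, of B] by blast
  have "(\<integral>\<^sup>+\<omega>. ennreal (J t \<omega> ^ (2 * k)) \<partial>P) \<le> ennreal K" if t: "t \<in> {0..T l}" for t
  proof -
    have z: "(0::real) \<in> {0..T l}" using lT by simp
    note [measurable] = vol_integralD(2)[OF J t] vol_integralD(2)[OF J z]
    \<comment> \<open>The characteristic function is known for increments; \<open>J 0\<close> vanishes almost surely.\<close>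
    let ?D = "\<lambda>\<omega>. J t \<omega> - J 0 \<omega>"
    define \<Psi> where "\<Psi> u = (CLINT r:{0<..t}|lborel. psi r (u * lam r l))" for u
    define a where "a n = (CLINT r:{0<..t}|lborel. cumulant_coeff n r)" for n
    have sub: "{0<..t} \<in> sets borel" "{0<..t} \<subseteq> {0..Tstar}" using t lT by auto
    have E0: "0 \<le> exp M + M\<^sup>2" by simp
    have "(\<integral>\<^sup>+x. ennreal (x ^ (2 * k)) \<partial>distr P borel ?D) \<le> ennreal K"
    proof (rule K[THEN spec[of _ "distr P borel ?D"], THEN spec[of _ \<Psi>], THEN spec[of _ a],
          THEN mp, THEN mp, THEN mp, THEN mp])
      show "real_distribution (distr P borel ?D)" by (rule real_distribution_distr) measurable
      show "\<forall>u. char (distr P borel ?D) u = exp (\<Psi> u)"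
      proof
        fix u
        have "char (distr P borel ?D) u = (CLINT \<omega>|P. iexp (u * ?D \<omega>))"
          unfolding char_def by (rule integral_distr) auto
        also have "\<dots> = (CLINT \<omega>|P. indicator (space P) \<omega> * iexp (u * ?D \<omega>))"
          by (intro Bochner_Integration.integral_cong) auto
        also have "\<dots> = prob (space P) * exp (\<Psi> u)"
          unfolding \<Psi>_def
          by (rule vol_integral_increment_char[OF J]) (use t space_F[of 0] sets.top[of "F 0"] in auto)
        finally show "char (distr P borel ?D) u = exp (\<Psi> u)" by (simp add: prob_space)
      qed
      show "\<forall>n<2*k. cmod (a n) \<le> B"
        unfolding a_def B_def
        by (intro allI impI time_integral_activity(2)[OF cumulant_coeff_measurable sub cumulant_coeff_le E0])
      show "\<forall>u. \<bar>u\<bar> \<le> 1 \<longrightarrow> cmod (\<Psi> u - (\<Sum>n<2*k. a n * of_real u ^ n)) \<le> B * \<bar>u\<bar> ^ (2 * k)"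
      proof (intro allI impI)
        fix u :: real
        have mu: "(\<lambda>r. u * lam r l) \<in> borel_measurable time_space" using vol_measurable[OF l] by measurable
        have i1: "set_integrable lborel {0<..t} (\<lambda>r. psi r (u * lam r l))"
        proof (rule psi_time_integral[OF mu _ sub, of "\<bar>u\<bar> * M"])
          show "\<bar>u * lam r l\<bar> \<le> \<bar>u\<bar> * M" if "r \<in> {0..Tstar}" for r
            using vol_le_M[OF l that] by (auto simp: abs_mult intro!: mult_left_mono)
        qed
        have i2: "set_integrable lborel {0<..t} (\<lambda>r. cumulant_coeff n r * of_real u ^ n)" for n
          by (intro set_integrable_mult_left impI time_integral_activity(1)[OF cumulant_coeff_measurable sub cumulant_coeff_le E0])
        have i3: "set_integrable lborel {0<..t} (\<lambda>r. \<Sum>n<2*k. cumulant_coeff n r * of_real u ^ n)"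
          using i2 unfolding set_integrable_def scaleR_sum_right
          by (intro Bochner_Integration.integrable_sum) auto
        have "\<Psi> u - (\<Sum>n<2*k. a n * of_real u ^ n)
            = \<Psi> u - (\<Sum>n<2*k. CLINT r:{0<..t}|lborel. cumulant_coeff n r * of_real u ^ n)"
          unfolding a_def by simp
        also have "\<dots> = \<Psi> u - (CLINT r:{0<..t}|lborel. \<Sum>n<2*k. cumulant_coeff n r * of_real u ^ n)"
          using i2 unfolding set_integrable_def set_lebesgue_integral_def scaleR_sum_right
          by (subst Bochner_Integration.integral_sum) auto
        also have "\<dots> = (CLINT r:{0<..t}|lborel. psi r (u * lam r l) - (\<Sum>n<2*k. cumulant_coeff n r * of_real u ^ n))"
          unfolding \<Psi>_def using i1 i3 by (rule set_integral_diff(2)[symmetric])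
        finally have eq: "\<Psi> u - (\<Sum>n<2*k. a n * of_real u ^ n) = \<dots>" .
        have "cmod (\<Psi> u - (\<Sum>n<2*k. a n * of_real u ^ n)) \<le> (exp M * \<bar>u\<bar> ^ (2 * k)) * activity_total"
          unfolding eq
        proof (rule time_integral_activity(2)[OF _ sub psi_cumulant_expansion[OF _ k]])
          note [measurable] = psi_measurable[OF mu] cumulant_coeff_measurable
          show "(\<lambda>r. psi r (u * lam r l) - (\<Sum>n<2*k. cumulant_coeff n r * of_real u ^ n)) \<in> borel_measurable time_space"
            by measurable
        qed auto
        also have "\<dots> \<le> B * \<bar>u\<bar> ^ (2 * k)"
          unfolding B_def using activity_total_nonneg by (simp add: algebra_simps)
        finally show "cmod (\<Psi> u - (\<Sum>n<2*k. a n * of_real u ^ n)) \<le> B * \<bar>u\<bar> ^ (2 * k)" .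
      qed
    qed
    also have "(\<integral>\<^sup>+x. ennreal (x ^ (2 * k)) \<partial>distr P borel ?D) = (\<integral>\<^sup>+\<omega>. ennreal (?D \<omega> ^ (2 * k)) \<partial>P)"
      by (rule nn_integral_distr) auto
    also have "\<dots> = (\<integral>\<^sup>+\<omega>. ennreal (J t \<omega> ^ (2 * k)) \<partial>P)"
      using vol_integral_0[OF J] by (intro nn_integral_cong_AE) auto
    finally show ?thesis .
  qed
  then show ?thesis by blast
qed

lemma vol_integral_moment:
  assumes J: "vol_integral J"
  shows "\<exists>K::real. \<forall>t\<in>{0..T l}. (\<integral>\<^sup>+\<omega>. ennreal (\<bar>J t \<omega>\<bar> ^ k) \<partial>P) \<le> ennreal K"
proof -
  have k2: "2 \<le> k + 2" by simp
  obtain K :: real where K: "\<forall>t\<in>{0..T l}. (\<integral>\<^sup>+\<omega>. ennreal (J t \<omega> ^ (2 * (k + 2))) \<partial>P) \<le> ennreal K"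
    using vol_integral_even_moment[OF J k2] by blast
  have "(\<integral>\<^sup>+\<omega>. ennreal (\<bar>J t \<omega>\<bar> ^ k) \<partial>P) \<le> ennreal (1 + max 0 K)" if t: "t \<in> {0..T l}" for t
  proof -
    note [measurable] = vol_integralD(2)[OF J t]
    have "(\<integral>\<^sup>+\<omega>. ennreal (\<bar>J t \<omega>\<bar> ^ k) \<partial>P) \<le> (\<integral>\<^sup>+\<omega>. ennreal 1 + ennreal (J t \<omega> ^ (2 * (k + 2))) \<partial>P)"
    proof (rule nn_integral_mono)
      fix \<omega>
      have "0 \<le> J t \<omega> ^ (2 * (k + 2))" by (simp only: power_mult zero_le_power zero_le_power2)
      then show "ennreal (\<bar>J t \<omega>\<bar> ^ k) \<le> ennreal 1 + ennreal (J t \<omega> ^ (2 * (k + 2)))"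
        using ennreal_leI[OF abs_power_le_even_power[of "J t \<omega>" k]] by (simp only: ennreal_plus zero_le_one)
    qed
    also have "\<dots> = ennreal 1 + (\<integral>\<^sup>+\<omega>. ennreal (J t \<omega> ^ (2 * (k + 2))) \<partial>P)"
      by (subst nn_integral_add) (auto simp: emeasure_space_1)
    also have "\<dots> \<le> ennreal 1 + ennreal (max 0 K)"
      using K[rule_format, OF t] order_trans[OF _ ennreal_leI[of K "max 0 K"]]
      by (intro add_left_mono) (simp del: power_Suc add: mult_2)
    finally show ?thesis by simp
  qed
  then show ?thesis by blast
qed

end

end

section \<open>Left limits of cadlag processes\<close>

lemma cadlag_on_left_limit:
  assumes "cadlag_on \<tau> f" "0 < s" "s \<le> \<tau>"
  shows "(f \<longlongrightarrow> Lim (at_left s) f) (at_left s)"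
proof -
  have "s \<in> {0<..\<tau>}" using assms by simp
  then obtain L where "(f \<longlongrightarrow> L) (at_left s)" using assms(1) unfolding cadlag_on_def by blast
  then show ?thesis using tendsto_Lim[of "at_left s" f L] by simp
qed

text \<open>
  The one-sided limits bound the function near every point of the compact interval.
\<close>

lemma cadlag_on_bounded:
  assumes f: "cadlag_on \<tau> f"
  shows "\<exists>C. \<forall>t\<in>{0..\<tau>}. \<bar>f t\<bar> \<le> C"
proof -
  have loc: "\<exists>S C. open S \<and> t \<in> S \<and> (\<forall>r\<in>S \<inter> {0..\<tau>}. \<bar>f r\<bar> \<le> C)" if t: "t \<in> {0..\<tau>}" for t
  proof -
    have bd: "\<exists>C. \<forall>\<^sub>F r in F. \<bar>f r\<bar> \<le> C" if "(f \<longlongrightarrow> L) F" for F L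
    proof -
      have "((\<lambda>r. \<bar>f r\<bar>) \<longlongrightarrow> \<bar>L\<bar>) F" by (intro tendsto_intros that)
      then have "\<forall>\<^sub>F r in F. \<bar>f r\<bar> < \<bar>L\<bar> + 1" by (rule order_tendstoD) simp
      then show ?thesis by (auto elim!: eventually_mono intro!: exI[of _ "\<bar>L\<bar> + 1"])
    qed
    have right: "\<exists>b C. t < b \<and> (\<forall>r. t < r \<longrightarrow> r < b \<longrightarrow> r \<le> \<tau> \<longrightarrow> \<bar>f r\<bar> \<le> C)"
    proof (cases "t < \<tau>")
      case True
      then have "(f \<longlongrightarrow> f t) (at_right t)" using f t by (auto simp: cadlag_on_def)
      from bd[OF this] show ?thesis by (auto simp: eventually_at_right_field)
    qed (auto intro!: exI[of _ "t + 1"])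
    have left: "\<exists>a C. a < t \<and> (\<forall>r. a < r \<longrightarrow> r < t \<longrightarrow> 0 \<le> r \<longrightarrow> \<bar>f r\<bar> \<le> C)"
    proof (cases "0 < t")
      case True
      with bd[OF cadlag_on_left_limit[OF f True]] t show ?thesis by (auto simp: eventually_at_left_field)
    qed (auto intro!: exI[of _ "t - 1"])
    obtain b C where b: "t < b" "\<forall>r. t < r \<longrightarrow> r < b \<longrightarrow> r \<le> \<tau> \<longrightarrow> \<bar>f r\<bar> \<le> C" using right by blast
    obtain a D where a: "a < t" "\<forall>r. a < r \<longrightarrow> r < t \<longrightarrow> 0 \<le> r \<longrightarrow> \<bar>f r\<bar> \<le> D" using left by blast
    have "\<bar>f r\<bar> \<le> max \<bar>f t\<bar> (max C D)" if "r \<in> {a<..<b} \<inter> {0..\<tau>}" for r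
    proof (cases r t rule: linorder_cases)
      case less
      then show ?thesis using a(2) that by (simp add: le_max_iff_disj)
    next
      case greater
      then show ?thesis using b(2) that by (simp add: le_max_iff_disj)
    qed simp
    with a(1) b(1) show ?thesis
      by (intro exI[of _ "{a<..<b}"] exI[of _ "max \<bar>f t\<bar> (max C D)"]) auto
  qed
  define \<O> where "\<O> = {S. open S \<and> (\<exists>C. \<forall>r\<in>S \<inter> {0..\<tau>}. \<bar>f r\<bar> \<le> C)}"
  have "compact {0..\<tau>}" by simp
  moreover have "{0..\<tau>} \<subseteq> \<Union>\<O>" using loc unfolding \<O>_def by blast
  ultimately obtain \<D> where D: "\<D> \<subseteq> \<O>" "finite \<D>" "{0..\<tau>} \<subseteq> \<Union>\<D>"
    by (rule compactE) (auto simp: \<O>_def)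
  then have "\<forall>S\<in>\<D>. \<exists>C. \<forall>r\<in>S \<inter> {0..\<tau>}. \<bar>f r\<bar> \<le> C" unfolding \<O>_def by blast
  then obtain C where C: "\<And>S r. S \<in> \<D> \<Longrightarrow> r \<in> S \<inter> {0..\<tau>} \<Longrightarrow> \<bar>f r\<bar> \<le> C S" by metis
  have "\<bar>f t\<bar> \<le> (\<Sum>S\<in>\<D>. \<bar>C S\<bar>)" if t: "t \<in> {0..\<tau>}" for t
  proof -
    obtain S where S: "S \<in> \<D>" "t \<in> S" using D t by blast
    then have "\<bar>f t\<bar> \<le> \<bar>C S\<bar>" using C[OF S(1), of t] t by simp
    also have "\<dots> \<le> (\<Sum>S\<in>\<D>. \<bar>C S\<bar>)" by (rule member_le_sum) (use S D in auto)
    finally show ?thesis .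
  qed
  then show ?thesis by blast
qed

definition left_process :: "real \<Rightarrow> (real \<Rightarrow> 'a \<Rightarrow> real) \<Rightarrow> real \<Rightarrow> 'a \<Rightarrow> real" where
  "left_process \<tau> J s \<omega> = (if 0 < s \<and> s \<le> \<tau> then Lim (at_left s) (\<lambda>r. J r \<omega>) else 0)"

text \<open>
  The left limit at \<open>s\<close> is the limit of the values at the last point of \<open>\<int>/(n+1)\<close> strictly before \<open>s\<close>.
  These approximations read the process at countably many times, hence are jointly measurable, and
  Fatou's lemma carries the moment bounds over.
\<close>

lemma (in prob_space) moment_process_left_process:
  fixes J :: "real \<Rightarrow> 'a \<Rightarrow> real"
  assumes J: "\<And>t. t \<in> {0..\<tau>} \<Longrightarrow> J t \<in> borel_measurable M"
    and cad: "\<And>\<omega>. \<omega> \<in> space M \<Longrightarrow> cadlag_on \<tau> (\<lambda>t. J t \<omega>)"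
    and mom: "\<And>k. \<exists>K::real. \<forall>t\<in>{0..\<tau>}. (\<integral>\<^sup>+\<omega>. ennreal (\<bar>J t \<omega>\<bar> ^ k) \<partial>M) \<le> ennreal K"
  shows "moment_process M (left_process \<tau> J)"
proof -
  \<comment> \<open>the last point of \<open>\<int>/(n+1)\<close> strictly before \<open>s\<close>\<close>
  define g where "g n s = (of_int \<lceil>s * real (Suc n)\<rceil> - 1) / real (Suc n)" for n s
  have g: "s - 1 / real (Suc n) \<le> g n s" "g n s < s" for n s
    unfolding g_def by (simp_all add: field_simps del: of_nat_Suc) linarith+
  have g0: "0 \<le> g n s" if "0 < s" for n s
  proof -
    have "0 < s * real (Suc n)" using that by simp
    then have "1 \<le> \<lceil>s * real (Suc n)\<rceil>" by (simp add: less_ceiling_iff one_le_ceiling)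
    then have "(1::real) \<le> of_int \<lceil>s * real (Suc n)\<rceil>" by linarith
    then show ?thesis unfolding g_def by simp
  qed
  define A where "A n s \<omega> = (if 0 < s \<and> s \<le> \<tau> then J (g n s) \<omega> else 0)" for n s \<omega>
  have lim: "(\<lambda>n. A n s \<omega>) \<longlonglongrightarrow> left_process \<tau> J s \<omega>" if w: "\<omega> \<in> space M" for s \<omega>
  proof (cases "0 < s \<and> s \<le> \<tau>")
    case True
    have "g n s < s" for n by (rule g)
    moreover have "(\<lambda>n. g n s) \<longlonglongrightarrow> s"
    proof (rule tendsto_sandwich[of "\<lambda>n. s - 1 / real (Suc n)" _ _ "\<lambda>n. s"])
      have "(\<lambda>n. s - 1 / real (Suc n)) \<longlonglongrightarrow> s - 0"
        by (intro tendsto_intros LIMSEQ_Suc[OF lim_1_over_n])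
      then show "(\<lambda>n. s - 1 / real (Suc n)) \<longlonglongrightarrow> s" by simp
    qed (use g in \<open>auto intro!: always_eventually intro: less_imp_le\<close>)
    ultimately have "filterlim (\<lambda>n. g n s) (at_left s) sequentially"
      by (auto simp: filterlim_at intro!: always_eventually less_imp_neq)
    from filterlim_compose[OF cadlag_on_left_limit[OF cad[OF w]] this] True
    show ?thesis by (simp add: A_def left_process_def)
  next
    case False
    then have "A n s \<omega> = left_process \<tau> J s \<omega>" for n by (auto simp: A_def left_process_def)
    then show ?thesis by simp
  qed
  have A_meas: "case_prod (A n) \<in> borel_measurable (borel \<Otimes>\<^sub>M M)" for n
  proof -
    define K where "K i \<omega> = (if of_int (i - 1) / real (Suc n) \<in> {0..\<tau>} then J (of_int (i - 1) / real (Suc n)) \<omega> else 0)"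
      for i :: int and \<omega>
    have K [measurable]: "K i \<in> borel_measurable M" for i
      using J[of "of_int (i - 1) / real (Suc n)"] unfolding K_def[abs_def]
      by (cases "of_int (i - 1) / real (Suc n) \<in> {0..\<tau>}") auto
    have "(\<lambda>z. K \<lceil>fst z * real (Suc n)\<rceil> (snd z)) \<in> borel_measurable ((borel :: real measure) \<Otimes>\<^sub>M M)"
      by (rule measurable_compose_countable[where f="\<lambda>i z. K i (snd z)" and g="\<lambda>z. \<lceil>fst z * real (Suc n)\<rceil>"])
        measurable
    then have "(\<lambda>z. if 0 < fst z \<and> fst z \<le> \<tau> then K \<lceil>fst z * real (Suc n)\<rceil> (snd z) else 0) \<in> borel_measurable (borel \<Otimes>\<^sub>M M)"
      by measurable
    also have "(\<lambda>z. if 0 < fst z \<and> fst z \<le> \<tau> then K \<lceil>fst z * real (Suc n)\<rceil> (snd z) else 0) = case_prod (A n)"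
    proof (intro ext)
      fix z :: "real \<times> 'a"
      obtain s \<omega> where z: "z = (s, \<omega>)" by (cases z)
      have "K \<lceil>s * real (Suc n)\<rceil> \<omega> = J (g n s) \<omega>" if "0 < s" "s \<le> \<tau>"
      proof -
        have eq: "of_int (\<lceil>s * real (Suc n)\<rceil> - 1) / real (Suc n) = g n s" by (simp add: g_def)
        have "g n s \<in> {0..\<tau>}" using g0[OF that(1), of n] g(2)[of n s] that by auto
        then show ?thesis unfolding K_def eq by simp
      qed
      then show "(if 0 < fst z \<and> fst z \<le> \<tau> then K \<lceil>fst z * real (Suc n)\<rceil> (snd z) else 0) = (case z of (s, \<omega>) \<Rightarrow> A n s \<omega>)"
        by (simp add: z A_def)
    qed
    finally show ?thesis .
  qed
  show ?thesis
  proof (rule moment_process_by_moments)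
    show "case_prod (left_process \<tau> J) \<in> borel_measurable (borel \<Otimes>\<^sub>M M)"
      by (rule borel_measurable_LIMSEQ_real[OF _ A_meas]) (use lim in \<open>auto simp: space_pair_measure\<close>)
    show "\<exists>C. \<forall>s. \<bar>left_process \<tau> J s \<omega>\<bar> \<le> C" if w: "\<omega> \<in> space M" for \<omega>
    proof -
      obtain C where "\<forall>t\<in>{0..\<tau>}. \<bar>J t \<omega>\<bar> \<le> C" using cadlag_on_bounded[OF cad[OF w]] by blast
      then have C: "\<bar>J t \<omega>\<bar> \<le> C" if "t \<in> {0..\<tau>}" for t using that by blast
      have "\<bar>A n s \<omega>\<bar> \<le> max 0 C" for n s
        using g0[of s n] g(2)[of n s] C[of "g n s"] by (auto simp: A_def le_max_iff_disj)
      then have "\<bar>left_process \<tau> J s \<omega>\<bar> \<le> max 0 C" for s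
        by (intro LIMSEQ_le_const2[OF tendsto_rabs[OF lim[OF w, of s]]]) auto
      then show ?thesis by blast
    qed
    fix k
    obtain K :: real where "\<forall>t\<in>{0..\<tau>}. (\<integral>\<^sup>+\<omega>. ennreal (\<bar>J t \<omega>\<bar> ^ k) \<partial>M) \<le> ennreal K"
      using mom[of k] by blast
    then have K: "(\<integral>\<^sup>+\<omega>. ennreal (\<bar>J t \<omega>\<bar> ^ k) \<partial>M) \<le> ennreal K" if "t \<in> {0..\<tau>}" for t
      using that by blast
    have "(\<integral>\<^sup>+\<omega>. ennreal (\<bar>left_process \<tau> J s \<omega>\<bar> ^ k) \<partial>M) \<le> ennreal (max 0 K + 1)" for s
    proof (cases "0 < s \<and> s \<le> \<tau>")
      case True
      have [measurable]: "A n s \<in> borel_measurable M" for n using measurable_Pair2[OF A_meas, of s n] by simp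
      have "(\<integral>\<^sup>+\<omega>. ennreal (\<bar>left_process \<tau> J s \<omega>\<bar> ^ k) \<partial>M)
          = (\<integral>\<^sup>+\<omega>. liminf (\<lambda>n. ennreal (\<bar>A n s \<omega>\<bar> ^ k)) \<partial>M)"
        by (intro nn_integral_cong lim_imp_Liminf[symmetric] tendsto_ennrealI tendsto_intros lim) auto
      also have "\<dots> \<le> liminf (\<lambda>n. \<integral>\<^sup>+\<omega>. ennreal (\<bar>A n s \<omega>\<bar> ^ k) \<partial>M)"
        by (rule nn_integral_liminf) measurable
      also have "\<dots> \<le> liminf (\<lambda>n::nat. ennreal K)"
      proof (rule Liminf_mono[OF always_eventually], rule allI)
        fix n
        have "g n s \<in> {0..\<tau>}" using g0[of s n] g(2)[of n s] True by auto
        then show "(\<integral>\<^sup>+\<omega>. ennreal (\<bar>A n s \<omega>\<bar> ^ k) \<partial>M) \<le> ennreal K"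
          using K[of "g n s"] True by (simp add: A_def)
      qed
      also have "\<dots> \<le> ennreal (max 0 K)" by (simp add: Liminf_const ennreal_max_0)
      finally show ?thesis by (simp add: add_increasing2)
    next
      case False
      then have "(\<integral>\<^sup>+\<omega>. ennreal (\<bar>left_process \<tau> J s \<omega>\<bar> ^ k) \<partial>M) \<le> (\<integral>\<^sup>+\<omega>. 1 \<partial>M)"
        by (intro nn_integral_mono) (auto simp: left_process_def power_0_left)
      also have "\<dots> \<le> ennreal (max 0 K + 1)" by (simp add: emeasure_space_1 add_increasing)
      finally show ?thesis .
    qed
    then show "\<exists>C::real. \<forall>s. (\<integral>\<^sup>+\<omega>. ennreal (\<bar>left_process \<tau> J s \<omega>\<bar> ^ k) \<partial>M) \<le> ennreal C"
      by blast
  qed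
qed

context levy_libor
begin

section \<open>Downward induction over the maturities\<close>

lemma smooth_family_const: "smooth_family (\<lambda>\<epsilon> s \<omega>. C)"
  and smooth_family_moment_process: "moment_process P G \<Longrightarrow> smooth_family (\<lambda>\<epsilon>. G)"
  and smooth_family_parameter: "smooth_family (\<lambda>\<epsilon> s \<omega>. \<epsilon>)"
  and smooth_family_add: "smooth_family U \<Longrightarrow> smooth_family V \<Longrightarrow> smooth_family (\<lambda>\<epsilon> s \<omega>. U \<epsilon> s \<omega> + V \<epsilon> s \<omega>)"
  and smooth_family_mult: "smooth_family U \<Longrightarrow> smooth_family V \<Longrightarrow> smooth_family (\<lambda>\<epsilon> s \<omega>. U \<epsilon> s \<omega> * V \<epsilon> s \<omega>)"
  and smooth_family_sum: "(\<And>x. x \<in> A \<Longrightarrow> smooth_family (W x)) \<Longrightarrow> smooth_family (\<lambda>\<epsilon> s \<omega>. \<Sum>x\<in>A. W x \<epsilon> s \<omega>)"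
  and smooth_family_prod: "(\<And>x. x \<in> A \<Longrightarrow> smooth_family (W x)) \<Longrightarrow> smooth_family (\<lambda>\<epsilon> s \<omega>. \<Prod>x\<in>A. W x \<epsilon> s \<omega>)"
  and smooth_family_time_integral: "integrable lborel a \<Longrightarrow> smooth_family U \<Longrightarrow>
      smooth_family (\<lambda>\<epsilon> s \<omega>. LINT r:{0..s}|lborel. a r * U \<epsilon> r \<omega>)"
  unfolding smooth_family_def
  by (simp_all add: smooth_upto_const smooth_upto_moment_process smooth_upto_parameter smooth_upto_add
      smooth_upto_mult smooth_upto_sum smooth_upto_prod smooth_upto_time_integral)

lemma smooth_family_weight:
  "m \<le> N \<Longrightarrow> smooth_family (W m) \<Longrightarrow> smooth_family (\<lambda>\<epsilon> s \<omega>. weight T m (\<lambda>m. W m \<epsilon> s \<omega>))"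
  unfolding smooth_family_def weight_def using smooth_upto_logistic[OF accrual_pos] by blast

lemma smooth_family_locally_dominated: "smooth_family U \<Longrightarrow> locally_dominated P U"
  unfolding smooth_family_def using smooth_upto_locally_dominated by blast

lemma drift_measurable:
  assumes l: "l \<in> {1..N}"
  shows "(\<lambda>s. libor_drift s l x) \<in> borel_measurable time_space"
proof -
  note [measurable] = c_measurable
  have "(\<lambda>s. - 1 / 2 * (lam s l)\<^sup>2 * c s
    + (\<Sum>m\<in>{l+1..N}. - (c s * lam s l * lam s m) * weight T m x)
    + (\<Sum>S\<in>Pow {l+1..N}. drift_coeff l S s * (\<Prod>m\<in>S. weight T m x))) \<in> borel_measurable time_space"
    using l by (intro borel_measurable_add borel_measurable_sum borel_measurable_times borel_measurable_const
        borel_measurable_power borel_measurable_uminus vol_measurable drift_coeff_measurable c_measurable) auto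
  then show ?thesis
    by (rule measurable_cong[THEN iffD2, rotated]) (simp add: drift_expansion[OF l])
qed

lemma time_coefficient_integrable:
  assumes f: "f \<in> borel_measurable time_space" and le: "\<And>s. s \<in> {0..Tstar} \<Longrightarrow> \<bar>f s\<bar> \<le> K * activity s"
    and K: "0 \<le> K" and "\<tau> \<le> Tstar"
  shows "integrable lborel (\<lambda>s. indicator {0..\<tau>} s * (f s :: real))"
  using time_integral_activity(1)[OF f _ _ _ K, of "{0..\<tau>}"] assms by (auto simp: set_integrable_def)

lemma vol_product_le_activity:
  assumes "l \<in> {1..N}" "m \<in> {1..N}" "s \<in> {0..Tstar}"
  shows "\<bar>c s * lam s l * lam s m\<bar> \<le> M\<^sup>2 * activity s"
proof -
  have "\<bar>c s * lam s l * lam s m\<bar> = c s * (\<bar>lam s l\<bar> * \<bar>lam s m\<bar>)"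
    using c_nonneg[OF assms(3)] by (simp add: abs_mult)
  also have "\<dots> \<le> activity s * (M * M)"
    using assms c_le_activity c_nonneg activity_nonneg vol_le_M M_pos by (intro mult_mono) auto
  finally show ?thesis by (simp add: power2_eq_square mult_ac)
qed

text \<open>
  After expansion, the integrated drift consists of time integrals of integrable coefficients times
  products of weights, to all of which the closure properties of smooth families apply.
\<close>

lemma drift_integral_smooth:
  assumes l: "l \<in> {1..N}" and \<tau>: "\<tau> \<le> Tstar" and W: "\<And>m. m \<in> {l+1..N} \<Longrightarrow> smooth_family (W m)"
  shows "\<exists>D. smooth_family D \<and> (\<forall>\<epsilon>. \<forall>\<omega>\<in>space P. \<forall>s\<in>{0..\<tau>}.
      D \<epsilon> s \<omega> = (LINT r:{0..s}|lborel. libor_drift r l (\<lambda>m. W m \<epsilon> r \<omega>)))"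
proof -
  let ?A = "{l+1..N}"
  let ?w = "\<lambda>m \<epsilon> s \<omega>. weight T m (\<lambda>m. W m \<epsilon> s \<omega>)"
  define a0 where "a0 r = indicator {0..\<tau>} r * (- 1 / 2 * (c r * lam r l * lam r l))" for r
  define a1 where "a1 m r = indicator {0..\<tau>} r * (- (c r * lam r l * lam r m))" for m r
  define a2 where "a2 S r = indicator {0..\<tau>} r * drift_coeff l S r" for S r
  have mA: "m \<in> {1..N}" if "m \<in> ?A" for m using that by auto
  note [measurable] = c_measurable vol_measurable
  have a0: "integrable lborel a0" unfolding a0_def
  proof (rule time_coefficient_integrable[OF _ _ _ \<tau>])
    show "(\<lambda>r. - 1 / 2 * (c r * lam r l * lam r l)) \<in> borel_measurable time_space" using l by measurable
    show "\<bar>- 1 / 2 * (c s * lam s l * lam s l)\<bar> \<le> M\<^sup>2 * activity s" if "s \<in> {0..Tstar}" for s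
    proof -
      have "\<bar>- 1 / 2 * (c s * lam s l * lam s l)\<bar> = \<bar>c s * lam s l * lam s l\<bar> / 2" by (simp add: abs_mult)
      then show ?thesis using vol_product_le_activity[OF l l that] by linarith
    qed
  qed simp
  have a1: "integrable lborel (a1 m)" if m: "m \<in> ?A" for m unfolding a1_def
  proof (rule time_coefficient_integrable[OF _ _ _ \<tau>])
    show "(\<lambda>r. - (c r * lam r l * lam r m)) \<in> borel_measurable time_space" using l mA[OF m] by measurable
    show "\<bar>- (c s * lam s l * lam s m)\<bar> \<le> M\<^sup>2 * activity s" if "s \<in> {0..Tstar}" for s
      using vol_product_le_activity[OF l mA[OF m] that] by simp
  qed simp
  have a2: "integrable lborel (a2 S)" if S: "S \<in> Pow ?A" for S unfolding a2_def
    by (rule time_coefficient_integrable[OF drift_coeff_measurable[OF l] drift_coeff_le(2)[OF l] _ \<tau>]) (use S in auto)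
  have w: "smooth_family (?w m)" if "m \<in> ?A" for m
    using that by (intro smooth_family_weight W) auto
  have wS: "smooth_family (\<lambda>\<epsilon> s \<omega>. \<Prod>m\<in>S. ?w m \<epsilon> s \<omega>)" if "S \<in> Pow ?A" for S
    using that by (intro smooth_family_prod w) auto
  define D where "D \<epsilon> s \<omega> = (LINT r:{0..s}|lborel. a0 r * 1)
      + (\<Sum>m\<in>?A. LINT r:{0..s}|lborel. a1 m r * ?w m \<epsilon> r \<omega>)
      + (\<Sum>S\<in>Pow ?A. LINT r:{0..s}|lborel. a2 S r * (\<Prod>m\<in>S. ?w m \<epsilon> r \<omega>))" for \<epsilon> s \<omega>
  have "smooth_family D"
    unfolding D_def[abs_def]
    by (intro smooth_family_add smooth_family_sum smooth_family_time_integral smooth_family_const w wS a0 a1 a2)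
  moreover have "D \<epsilon> s \<omega> = (LINT r:{0..s}|lborel. libor_drift r l (\<lambda>m. W m \<epsilon> r \<omega>))"
    if \<omega>: "\<omega> \<in> space P" and s: "s \<in> {0..\<tau>}" for \<epsilon> s \<omega>
  proof -
    have si: "set_integrable lborel {0..s} (\<lambda>r. a r * U \<epsilon> r \<omega>)" if "integrable lborel a" "smooth_family U" for a U
      unfolding set_integrable_def
      using integrable_weighted_path[OF that(1) smooth_family_locally_dominated[OF that(2)] \<omega>]
      by (intro integrable_mult_indicator) auto
    have i0: "set_integrable lborel {0..s} (\<lambda>r. a0 r * 1)" by (rule si[OF a0 smooth_family_const])
    have i1: "set_integrable lborel {0..s} (\<lambda>r. a1 m r * ?w m \<epsilon> r \<omega>)" if "m \<in> ?A" for m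
      by (rule si[OF a1[OF that] w[OF that]])
    have i2: "set_integrable lborel {0..s} (\<lambda>r. a2 S r * (\<Prod>m\<in>S. ?w m \<epsilon> r \<omega>))" if "S \<in> Pow ?A" for S
      by (rule si[OF a2[OF that] wS[OF that]])
    have s1: "set_integrable lborel {0..s} (\<lambda>r. \<Sum>m\<in>?A. a1 m r * ?w m \<epsilon> r \<omega>)"
      using i1 unfolding set_integrable_def scaleR_sum_right by (intro Bochner_Integration.integrable_sum) auto
    have s2: "set_integrable lborel {0..s} (\<lambda>r. \<Sum>S\<in>Pow ?A. a2 S r * (\<Prod>m\<in>S. ?w m \<epsilon> r \<omega>))"
      using i2 unfolding set_integrable_def scaleR_sum_right by (intro Bochner_Integration.integrable_sum) auto
    have e1: "(\<Sum>m\<in>?A. LINT r:{0..s}|lborel. a1 m r * ?w m \<epsilon> r \<omega>)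
        = (LINT r:{0..s}|lborel. \<Sum>m\<in>?A. a1 m r * ?w m \<epsilon> r \<omega>)"
      using i1 unfolding set_integrable_def set_lebesgue_integral_def scaleR_sum_right
      by (subst Bochner_Integration.integral_sum) auto
    have e2: "(\<Sum>S\<in>Pow ?A. LINT r:{0..s}|lborel. a2 S r * (\<Prod>m\<in>S. ?w m \<epsilon> r \<omega>))
        = (LINT r:{0..s}|lborel. \<Sum>S\<in>Pow ?A. a2 S r * (\<Prod>m\<in>S. ?w m \<epsilon> r \<omega>))"
      using i2 unfolding set_integrable_def set_lebesgue_integral_def scaleR_sum_right
      by (subst Bochner_Integration.integral_sum) auto
    have "D \<epsilon> s \<omega> = (LINT r:{0..s}|lborel. a0 r * 1 + (\<Sum>m\<in>?A. a1 m r * ?w m \<epsilon> r \<omega>)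
        + (\<Sum>S\<in>Pow ?A. a2 S r * (\<Prod>m\<in>S. ?w m \<epsilon> r \<omega>)))"
      unfolding D_def e1 e2 using i0 s1 s2 by (simp only: set_integral_add)
    also have "\<dots> = (LINT r:{0..s}|lborel. libor_drift r l (\<lambda>m. W m \<epsilon> r \<omega>))"
    proof (rule set_lebesgue_integral_cong)
      show "\<forall>r. r \<in> {0..s} \<longrightarrow> a0 r * 1 + (\<Sum>m\<in>?A. a1 m r * ?w m \<epsilon> r \<omega>)
        + (\<Sum>S\<in>Pow ?A. a2 S r * (\<Prod>m\<in>S. ?w m \<epsilon> r \<omega>)) = libor_drift r l (\<lambda>m. W m \<epsilon> r \<omega>)"
      proof (intro allI impI)
        fix r assume r: "r \<in> {0..s}"
        then have r': "r \<in> {0..\<tau>}" "r \<in> {0..Tstar}" using s \<tau> by auto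
        show "a0 r * 1 + (\<Sum>m\<in>?A. a1 m r * ?w m \<epsilon> r \<omega>)
          + (\<Sum>S\<in>Pow ?A. a2 S r * (\<Prod>m\<in>S. ?w m \<epsilon> r \<omega>)) = libor_drift r l (\<lambda>m. W m \<epsilon> r \<omega>)"
          unfolding drift_expansion[OF l r'(2)] a0_def a1_def a2_def using r'(1)
          by (simp add: power2_eq_square)
      qed
    qed simp
    finally show ?thesis .
  qed
  ultimately show ?thesis by blast
qed

lemma drift_cong:
  assumes "\<And>m. m \<in> {l+1..N} \<Longrightarrow> x m = y m"
  shows "libor_drift s l x = libor_drift s l y"
proof -
  have w: "weight T m x = weight T m y" if "m \<in> {l+1..N}" for m
    using assms[OF that] by (simp add: weight_def)
  have "(\<Prod>m\<in>{l+1..N}. drift_beta T lam s z m x) = (\<Prod>m\<in>{l+1..N}. drift_beta T lam s z m y)" for z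
    unfolding drift_beta_def by (intro prod.cong refl) (simp add: w)
  moreover have "(\<Sum>m\<in>{l+1..N}. weight T m x * lam s m) = (\<Sum>m\<in>{l+1..N}. weight T m y * lam s m)"
    by (intro sum.cong refl) (simp add: w)
  ultimately show ?thesis by (simp add: drift_def)
qed

end

lemma set_lebesgue_integral_cong_except_0:
  fixes f g :: "real \<Rightarrow> 'b::{banach, second_countable_topology}"
  assumes "\<And>r. r \<in> {0<..s} \<Longrightarrow> f r = g r" "set_borel_measurable lborel {0..s} f" "set_borel_measurable lborel {0..s} g"
  shows "(LINT r:{0..s}|lborel. f r) = (LINT r:{0..s}|lborel. g r)"
  unfolding set_lebesgue_integral_def
proof (rule integral_cong_AE)
  have "AE r in lborel. r \<noteq> (0::real)" by (rule AE_lborel_singleton)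
  then show "AE r in lborel. indicator {0..s} r *\<^sub>R f r = indicator {0..s} r *\<^sub>R g r"
    by eventually_elim (use assms(1) in \<open>auto simp: indicator_def\<close>)
qed (use assms(2,3) in \<open>auto simp: set_borel_measurable_def\<close>)

lemma time_integral_at_0: "(LINT r:{0::real}|lborel. f r) = (0::real)"
  unfolding set_lebesgue_integral_def
proof (rule integral_eq_zero_AE)
  have "AE r in lborel. r \<noteq> (0::real)" by (rule AE_lborel_singleton)
  then show "AE r in lborel. indicator {0} r *\<^sub>R f r = 0"
    by eventually_elim (auto simp: indicator_def)
qed

lemma continuous_on_time_integral:
  fixes f :: "real \<Rightarrow> real"
  assumes "set_integrable lborel {0..\<tau>} f"
  shows "continuous_on {0..\<tau>} (\<lambda>t. LINT r:{0..t}|lborel. f r)"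
proof -
  have eq: "(LINT r:{0..t}|lborel. f r) = integral {0..t} f" if "t \<in> {0..\<tau>}" for t
    using set_borel_integral_eq_integral(2)[OF set_integrable_subset[OF assms, of "{0..t}"]] that by auto
  have "f integrable_on {0..\<tau>}" by (rule set_borel_integral_eq_integral(1)[OF assms])
  then have "continuous_on {0..\<tau>} (\<lambda>t. integral {0..t} f)" by (rule indefinite_integral_continuous_1)
  then show ?thesis by (rule continuous_on_eq) (simp add: eq)
qed

lemma continuous_on_imp_at_left:
  fixes f :: "real \<Rightarrow> real"
  assumes "continuous_on {0..\<tau>} f" "0 < s" "s \<le> \<tau>"
  shows "(f \<longlongrightarrow> f s) (at_left s)"
proof -
  have "(f \<longlongrightarrow> f s) (at s within {0..\<tau>})" using assms by (auto simp: continuous_on_def)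
  then have "(f \<longlongrightarrow> f s) (at s within {0..s})" by (rule tendsto_within_subset) (use assms in auto)
  then show ?thesis using assms(2) by (simp add: at_within_Icc_at_left)
qed

lemma continuous_on_imp_at_right:
  fixes f :: "real \<Rightarrow> real"
  assumes "continuous_on {0..\<tau>} f" "0 \<le> s" "s < \<tau>"
  shows "(f \<longlongrightarrow> f s) (at_right s)"
proof -
  have "(f \<longlongrightarrow> f s) (at s within {0..\<tau>})" using assms by (auto simp: continuous_on_def)
  then have "(f \<longlongrightarrow> f s) (at s within {s..\<tau>})" by (rule tendsto_within_subset) (use assms in auto)
  then show ?thesis using assms(3) by (simp add: at_within_Icc_at_right)
qed

context levy_libor
begin

definition log_libor0 :: "nat \<Rightarrow> real" where "log_libor0 l = ln (libor0 T B l)"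

text \<open>
  The statement carried through the induction. Besides the rate itself it controls its left limits,
  since these are what the drifts of the earlier maturities depend on, and it identifies the integrated
  drift at \<open>\<epsilon> = 0\<close>, which is the drift of the first variation.
\<close>

definition represents ::
  "real \<Rightarrow> nat \<Rightarrow> (real \<Rightarrow> nat \<Rightarrow> real \<Rightarrow> 'a \<Rightarrow> real) \<Rightarrow> (real \<Rightarrow> 'a \<Rightarrow> real) \<Rightarrow> (real \<Rightarrow> real \<Rightarrow> 'a \<Rightarrow> real) \<Rightarrow> bool" where
  "represents \<tau> l X J D \<longleftrightarrow> smooth_family D \<and>
     (\<forall>\<omega>\<in>space P. \<forall>s\<in>{0..\<tau>}. D 0 s \<omega> = (LINT r:{0..s}|lborel. libor_drift r l log_libor0)) \<and>
     (\<forall>\<epsilon>. AE \<omega> in P.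
        (\<forall>t\<in>{0..\<tau>}. X \<epsilon> l t \<omega> = log_libor0 l + \<epsilon> * (D \<epsilon> t \<omega> + J t \<omega>)) \<and>
        (\<forall>s\<in>{0<..\<tau>}. Lim (at_left s) (\<lambda>r. X \<epsilon> l r \<omega>) = log_libor0 l + \<epsilon> * (D \<epsilon> s \<omega> + left_process \<tau> J s \<omega>)))"

context
  fixes X :: "real \<Rightarrow> nat \<Rightarrow> real \<Rightarrow> 'a \<Rightarrow> real"
  assumes X: "\<And>\<epsilon>. perturbed_solution P F T N H c \<nu> lam B \<epsilon> (X \<epsilon>)"
begin

lemma common_vol_integral:
  assumes l: "l \<in> {1..N}"
  shows "\<exists>J. vol_integral l J \<and> (\<forall>\<epsilon>. AE \<omega> in P.
      set_integrable lborel {0..T l} (\<lambda>s. libor_drift s l (\<lambda>m. Lim (at_left s) (\<lambda>r. X \<epsilon> m r \<omega>))) \<and>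
      (\<forall>t\<in>{0..T l}. X \<epsilon> l t \<omega> = log_libor0 l +
         \<epsilon> * ((LINT s:{0..t}|lborel. libor_drift s l (\<lambda>m. Lim (at_left s) (\<lambda>r. X \<epsilon> m r \<omega>))) + J t \<omega>)))"
proof -
  define Sol where "Sol \<epsilon> J \<omega> \<longleftrightarrow>
      set_integrable lborel {0..T l} (\<lambda>s. libor_drift s l (\<lambda>m. Lim (at_left s) (\<lambda>r. X \<epsilon> m r \<omega>))) \<and>
      (\<forall>t\<in>{0..T l}. X \<epsilon> l t \<omega> = log_libor0 l +
         \<epsilon> * ((LINT s:{0..t}|lborel. libor_drift s l (\<lambda>m. Lim (at_left s) (\<lambda>r. X \<epsilon> m r \<omega>))) + J t \<omega>))"
    for \<epsilon> J \<omega>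
  have "\<exists>J. vol_integral l J \<and> (AE \<omega> in P. Sol \<epsilon> J \<omega>)" for \<epsilon>
    unfolding Sol_def vol_integral_def[OF l] log_libor0_def
    using X[of \<epsilon>, unfolded perturbed_solution_def, rule_format, OF l] by (elim conjE)
  then obtain J where J: "\<And>\<epsilon>. vol_integral l (J \<epsilon>)" and sol: "\<And>\<epsilon>. AE \<omega> in P. Sol \<epsilon> (J \<epsilon>) \<omega>"
    by metis
  have Sol_cong: "Sol \<epsilon> K \<omega> \<Longrightarrow> \<forall>t\<in>{0..T l}. K t \<omega> = K' t \<omega> \<Longrightarrow> Sol \<epsilon> K' \<omega>" for \<epsilon> K K' \<omega>
    unfolding Sol_def by simp
  have "AE \<omega> in P. Sol \<epsilon> (J 0) \<omega>" for \<epsilon>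
    using sol[of \<epsilon>] vol_integral_unique[OF l J[of \<epsilon>] J[of 0]] by eventually_elim (rule Sol_cong)
  then show ?thesis using J[of 0] unfolding Sol_def by (intro exI[of _ "J 0"] conjI allI)
qed

lemma left_limit_process_moments:
  assumes l: "l \<in> {1..N}" and \<tau>: "\<tau> \<le> T l" and J: "vol_integral l J"
  shows "moment_process P (left_process \<tau> J)"
proof (rule moment_process_left_process)
  show "J t \<in> borel_measurable P" if "t \<in> {0..\<tau>}" for t
    using vol_integralD(2)[OF l J] that \<tau> by auto
  show "cadlag_on \<tau> (\<lambda>t. J t \<omega>)" if "\<omega> \<in> space P" for \<omega>
    using vol_integralD(3)[OF l J that] \<tau> by (auto simp: cadlag_on_def)
  show "\<exists>K::real. \<forall>t\<in>{0..\<tau>}. (\<integral>\<^sup>+\<omega>. ennreal (\<bar>J t \<omega>\<bar> ^ k) \<partial>P) \<le> ennreal K" for k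
  proof -
    obtain K :: real where "\<forall>t\<in>{0..T l}. (\<integral>\<^sup>+\<omega>. ennreal (\<bar>J t \<omega>\<bar> ^ k) \<partial>P) \<le> ennreal K"
      using vol_integral_moment[OF l J, of k] by blast
    then show ?thesis using \<tau> by (intro exI[of _ K]) auto
  qed
qed

text \<open>
  Inserting the left limits of the later rates into the drift gives a smooth family \<open>D\<close>. As its paths are
  time integrals, they are continuous, so the left limits of the rate are obtained by
  replacing the integral \<open>J\<close> by its left limits.
\<close>

lemma representation_step:
  assumes l: "l \<in> {1..N}" and \<tau>: "0 \<le> \<tau>" "\<tau> \<le> T l"
    and IH: "\<And>m. m \<in> {l+1..N} \<Longrightarrow> \<exists>J D. vol_integral m J \<and> represents \<tau> m X J D"
  shows "\<exists>J D. vol_integral l J \<and> represents \<tau> l X J D"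
proof -
  have \<tau>star: "\<tau> \<le> Tstar" using \<tau> tenor_le[OF l] by simp
  have m_facts: "m \<in> {1..N}" "\<tau> \<le> T m" if "m \<in> {l+1..N}" for m
    using that \<tau> tenor_mono[of l m] by auto
  obtain Jm Dm where Jm: "\<And>m. m \<in> {l+1..N} \<Longrightarrow> vol_integral m (Jm m)"
    and Dm: "\<And>m. m \<in> {l+1..N} \<Longrightarrow> represents \<tau> m X (Jm m) (Dm m)"
    using IH by metis
  obtain J where J: "vol_integral l J" and eq: "\<And>\<epsilon>. AE \<omega> in P.
      set_integrable lborel {0..T l} (\<lambda>s. libor_drift s l (\<lambda>m. Lim (at_left s) (\<lambda>r. X \<epsilon> m r \<omega>))) \<and>
      (\<forall>t\<in>{0..T l}. X \<epsilon> l t \<omega> = log_libor0 l +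
         \<epsilon> * ((LINT s:{0..t}|lborel. libor_drift s l (\<lambda>m. Lim (at_left s) (\<lambda>r. X \<epsilon> m r \<omega>))) + J t \<omega>))"
    using common_vol_integral[OF l] by blast
  define W where "W m \<epsilon> s \<omega> = log_libor0 m + \<epsilon> * (Dm m \<epsilon> s \<omega> + left_process \<tau> (Jm m) s \<omega>)" for m \<epsilon> s \<omega>
  have W: "smooth_family (W m)" if m: "m \<in> {l+1..N}" for m
  proof -
    have "smooth_family (Dm m)" using Dm[OF m] by (simp add: represents_def)
    moreover have "moment_process P (left_process \<tau> (Jm m))"
      by (rule left_limit_process_moments[OF m_facts[OF m] Jm[OF m]])
    ultimately show ?thesis
      unfolding W_def[abs_def]
      by (intro smooth_family_add smooth_family_mult smooth_family_const smooth_family_parameter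
          smooth_family_moment_process)
  qed
  obtain D where D: "smooth_family D" and D_eq: "\<And>\<epsilon> \<omega> s. \<omega> \<in> space P \<Longrightarrow> s \<in> {0..\<tau>} \<Longrightarrow>
      D \<epsilon> s \<omega> = (LINT r:{0..s}|lborel. libor_drift r l (\<lambda>m. W m \<epsilon> r \<omega>))"
    using drift_integral_smooth[where W=W, OF l \<tau>star W] by blast
  have "represents \<tau> l X J D"
    unfolding represents_def
  proof (intro conjI allI ballI D)
    show "D 0 s \<omega> = (LINT r:{0..s}|lborel. libor_drift r l log_libor0)" if "\<omega> \<in> space P" "s \<in> {0..\<tau>}" for \<omega> s
      using D_eq[OF that, of 0] by (simp add: W_def)
    fix \<epsilon>
    have "AE \<omega> in P. \<forall>m\<in>{l+1..N}. \<forall>s\<in>{0<..\<tau>}. Lim (at_left s) (\<lambda>r. X \<epsilon> m r \<omega>) = W m \<epsilon> s \<omega>"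
    proof (rule AE_finite_allI)
      fix m assume "m \<in> {l+1..N}"
      from Dm[OF this] have "AE \<omega> in P. (\<forall>t\<in>{0..\<tau>}. X \<epsilon> m t \<omega> = log_libor0 m + \<epsilon> * (Dm m \<epsilon> t \<omega> + Jm m t \<omega>)) \<and>
        (\<forall>s\<in>{0<..\<tau>}. Lim (at_left s) (\<lambda>r. X \<epsilon> m r \<omega>) = W m \<epsilon> s \<omega>)"
        unfolding represents_def W_def by blast
      then show "AE \<omega> in P. \<forall>s\<in>{0<..\<tau>}. Lim (at_left s) (\<lambda>r. X \<epsilon> m r \<omega>) = W m \<epsilon> s \<omega>"
        by eventually_elim auto
    qed simp
    moreover have "AE \<omega> in P. \<omega> \<in> space P" by (rule AE_space)
    ultimately show "AE \<omega> in P.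
        (\<forall>t\<in>{0..\<tau>}. X \<epsilon> l t \<omega> = log_libor0 l + \<epsilon> * (D \<epsilon> t \<omega> + J t \<omega>)) \<and>
        (\<forall>s\<in>{0<..\<tau>}. Lim (at_left s) (\<lambda>r. X \<epsilon> l r \<omega>) = log_libor0 l + \<epsilon> * (D \<epsilon> s \<omega> + left_process \<tau> J s \<omega>))"
      using eq[of \<epsilon>]
    proof eventually_elim
      case (elim \<omega>)
      let ?f = "\<lambda>s. libor_drift s l (\<lambda>m. Lim (at_left s) (\<lambda>r. X \<epsilon> m r \<omega>))"
      have int: "set_integrable lborel {0..\<tau>} ?f"
        by (rule set_integrable_subset[of _ "{0..T l}"]) (use elim \<tau> in auto)
      have f_W: "?f r = libor_drift r l (\<lambda>m. W m \<epsilon> r \<omega>)" if "r \<in> {0<..\<tau>}" for r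
        by (rule drift_cong) (use elim that in auto)
      have D_int: "D \<epsilon> s \<omega> = (LINT r:{0..s}|lborel. ?f r)" if s: "s \<in> {0..\<tau>}" for s
      proof -
        have ints: "set_integrable lborel {0..s} ?f"
          by (rule set_integrable_subset[OF int]) (use s in auto)
        \<comment> \<open>At \<open>r = 0\<close> there is no left limit and \<open>Lim\<close> is a default value; one point does not affect the integral.\<close>
        have mf: "(\<lambda>r. indicator {0..s} r *\<^sub>R ?f r) \<in> borel_measurable borel"
          using ints by (auto simp: set_integrable_def)
        have "(\<lambda>r. if r = 0 then indicator {0..s} 0 *\<^sub>R libor_drift 0 l (\<lambda>m. W m \<epsilon> 0 \<omega>)
            else indicator {0..s} r *\<^sub>R ?f r) \<in> borel_measurable borel"
          using mf by measurable
        also have "(\<lambda>r. if r = 0 then indicator {0..s} 0 *\<^sub>R libor_drift 0 l (\<lambda>m. W m \<epsilon> 0 \<omega>)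
            else indicator {0..s} r *\<^sub>R ?f r)
          = (\<lambda>r. indicator {0..s} r *\<^sub>R libor_drift r l (\<lambda>m. W m \<epsilon> r \<omega>))"
          using f_W s by (auto simp: indicator_def fun_eq_iff)
        finally have mW: "set_borel_measurable lborel {0..s} (\<lambda>r. libor_drift r l (\<lambda>m. W m \<epsilon> r \<omega>))"
          by (simp add: set_borel_measurable_def)
        have "D \<epsilon> s \<omega> = (LINT r:{0..s}|lborel. libor_drift r l (\<lambda>m. W m \<epsilon> r \<omega>))"
          using D_eq elim s by simp
        also have "\<dots> = (LINT r:{0..s}|lborel. ?f r)"
          by (rule set_lebesgue_integral_cong_except_0[OF _ mW])
            (use f_W s mf in \<open>auto simp: set_borel_measurable_def\<close>)
        finally show ?thesis .
      qed
      have X_eq: "X \<epsilon> l t \<omega> = log_libor0 l + \<epsilon> * (D \<epsilon> t \<omega> + J t \<omega>)" if "t \<in> {0..\<tau>}" for t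
        using elim D_int[OF that] that \<tau> by auto
      moreover have "Lim (at_left s) (\<lambda>r. X \<epsilon> l r \<omega>) = log_libor0 l + \<epsilon> * (D \<epsilon> s \<omega> + left_process \<tau> J s \<omega>)"
        if s: "s \<in> {0<..\<tau>}" for s
      proof (rule tendsto_Lim)
        have "((\<lambda>t. LINT r:{0..t}|lborel. ?f r) \<longlongrightarrow> (LINT r:{0..s}|lborel. ?f r)) (at_left s)"
          by (rule continuous_on_imp_at_left[OF continuous_on_time_integral[OF int]]) (use s in auto)
        moreover have "((\<lambda>t. J t \<omega>) \<longlongrightarrow> left_process \<tau> J s \<omega>) (at_left s)"
          using cadlag_on_left_limit[OF vol_integralD(3)[OF l J], of \<omega> s] elim s \<tau> by (simp add: left_process_def)
        ultimately have "((\<lambda>t. log_libor0 l + \<epsilon> * ((LINT r:{0..t}|lborel. ?f r) + J t \<omega>)) \<longlongrightarrow>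
            log_libor0 l + \<epsilon> * ((LINT r:{0..s}|lborel. ?f r) + left_process \<tau> J s \<omega>)) (at_left s)"
          by (intro tendsto_intros)
        moreover have "\<forall>\<^sub>F t in at_left s. log_libor0 l + \<epsilon> * ((LINT r:{0..t}|lborel. ?f r) + J t \<omega>) = X \<epsilon> l t \<omega>"
          unfolding eventually_at_left_field using s X_eq D_int by (intro exI[of _ 0]) auto
        ultimately have "((\<lambda>t. X \<epsilon> l t \<omega>) \<longlongrightarrow>
            log_libor0 l + \<epsilon> * ((LINT r:{0..s}|lborel. ?f r) + left_process \<tau> J s \<omega>)) (at_left s)"
          by (rule Lim_transform_eventually)
        then show "((\<lambda>t. X \<epsilon> l t \<omega>) \<longlongrightarrow> log_libor0 l + \<epsilon> * (D \<epsilon> s \<omega> + left_process \<tau> J s \<omega>)) (at_left s)"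
          using D_int[of s] s by simp
      qed simp
      ultimately show ?case by blast
    qed
  qed
  then show ?thesis using J by blast
qed

lemma representation:
  assumes i: "i \<in> {1..N}"
  shows "l \<in> {i..N} \<Longrightarrow> \<exists>J D. vol_integral l J \<and> represents (T i) l X J D"
proof (induction "N - l" arbitrary: l rule: less_induct)
  case less
  show ?case
  proof (rule representation_step)
    show "l \<in> {1..N}" using less.prems i by auto
    show "0 \<le> T i" using tenor_nonneg[of i] i by simp
    show "T i \<le> T l" using tenor_mono[of i l] less.prems by simp
    show "\<exists>J D. vol_integral m J \<and> represents (T i) m X J D" if "m \<in> {l+1..N}" for m
      using less.hyps[of m] that less.prems by auto
  qed
qed

end

end

section \<open>The first variation as a Levy process\<close>

lemma set_integral_Ioc_eq_Icc:
  fixes f :: "real \<Rightarrow> 'b::{banach, second_countable_topology}"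
  assumes "set_integrable lborel {0..t} f"
  shows "(LINT r:{0<..t}|lborel. f r) = (LINT r:{0..t}|lborel. f r)"
  unfolding set_lebesgue_integral_def
proof (rule integral_cong_AE)
  have "set_integrable lborel {0<..t} f" by (rule set_integrable_subset[OF assms]) auto
  then show "(\<lambda>r. indicator {0<..t} r *\<^sub>R f r) \<in> borel_measurable lborel"
    unfolding set_integrable_def by (rule borel_measurable_integrable)
  show "(\<lambda>r. indicator {0..t} r *\<^sub>R f r) \<in> borel_measurable lborel"
    using assms unfolding set_integrable_def by (rule borel_measurable_integrable)
  have "AE r in lborel. r \<noteq> (0::real)" by (rule AE_lborel_singleton)
  then show "AE r in lborel. indicator {0<..t} r *\<^sub>R f r = indicator {0..t} r *\<^sub>R f r"
    by eventually_elim (auto simp: indicator_def)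
qed

context levy_libor
begin

lemma drift_set_integrable:
  assumes l: "l \<in> {1..N}" and A: "A \<in> sets borel" "A \<subseteq> {0..Tstar}"
  shows "set_integrable lborel A (\<lambda>s. libor_drift s l x)"
proof -
  note [measurable] = c_measurable vol_measurable
  have 0: "set_integrable lborel A (\<lambda>s. c s * lam s l * lam s m)" if m: "m \<in> {1..N}" for m
  proof (rule time_integral_activity(1)[OF _ A, where K="M\<^sup>2"])
    show "(\<lambda>s. c s * lam s l * lam s m) \<in> borel_measurable time_space" using l m by measurable
    show "norm (c s * lam s l * lam s m) \<le> M\<^sup>2 * activity s" if "s \<in> {0..Tstar}" for s
      using vol_product_le_activity[OF l m that] by simp
  qed simp
  have 2: "set_integrable lborel A (drift_coeff l S)" if "S \<in> Pow {l+1..N}" for S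
    by (rule time_integral_activity(1)[OF drift_coeff_measurable[OF l] A, where K="1 + M\<^sup>2"])
      (use that drift_coeff_le(2)[OF l] in auto)
  let ?g = "\<lambda>s. (- 1 / 2) * (c s * lam s l * lam s l)
      + (\<Sum>m\<in>{l+1..N}. (- weight T m x) * (c s * lam s l * lam s m))
      + (\<Sum>S\<in>Pow {l+1..N}. (\<Prod>m\<in>S. weight T m x) * drift_coeff l S s)"
  have "set_integrable lborel A (\<lambda>s. (- weight T m x) * (c s * lam s l * lam s m))" if "m \<in> {l+1..N}" for m
    using that by (intro set_integrable_mult_right 0) auto
  then have s1: "set_integrable lborel A (\<lambda>s. \<Sum>m\<in>{l+1..N}. (- weight T m x) * (c s * lam s l * lam s m))"
    unfolding set_integrable_def scaleR_sum_right by (intro Bochner_Integration.integrable_sum) auto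
  have "set_integrable lborel A (\<lambda>s. (\<Prod>m\<in>S. weight T m x) * drift_coeff l S s)" if "S \<in> Pow {l+1..N}" for S
    using that by (intro set_integrable_mult_right 2)
  then have s2: "set_integrable lborel A (\<lambda>s. \<Sum>S\<in>Pow {l+1..N}. (\<Prod>m\<in>S. weight T m x) * drift_coeff l S s)"
    unfolding set_integrable_def scaleR_sum_right by (intro Bochner_Integration.integrable_sum) auto
  have "set_integrable lborel A ?g"
    by (intro set_integral_add(1) s1 s2 set_integrable_mult_right 0 l)
  also have "?this \<longleftrightarrow> ?thesis"
  proof (rule set_integrable_cong[OF refl refl])
    show "?g s = libor_drift s l x" if "s \<in> A" for s
      using drift_expansion[OF l, of s x] that A(2) by (auto simp: power2_eq_square mult_ac)
  qed
  finally show ?thesis .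
qed

text \<open>
  The atom of the image at \<open>0\<close> is removed: where the volatility vanishes the image sits entirely at \<open>0\<close>,
  and a Levy measure has no mass there.
\<close>

definition vol_jump_measure :: "nat \<Rightarrow> real \<Rightarrow> real measure" where
  "vol_jump_measure l s = density (distr (\<nu> s) borel ((*) (lam s l))) (\<lambda>x. ennreal (indicator (- {0}) x))"

lemma sets_vol_jump_measure [simp]: "sets (vol_jump_measure l s) = sets borel"
  by (simp add: vol_jump_measure_def)

lemma scale_measurable_nu:
  assumes "s \<in> {0..Tstar}"
  shows "(*) (lam s l) \<in> measurable (\<nu> s) borel"
  by (rule measurable_nu[OF assms]) measurable

lemma nn_integral_vol_jump_measure:
  assumes s: "s \<in> {0..Tstar}" and f [measurable]: "f \<in> borel_measurable borel"
  shows "(\<integral>\<^sup>+x. f x \<partial>vol_jump_measure l s) = (\<integral>\<^sup>+y. ennreal (indicator (- {0}) (lam s l * y)) * f (lam s l * y) \<partial>\<nu> s)"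
  unfolding vol_jump_measure_def
  by (subst nn_integral_density, measurable, subst nn_integral_distr[OF scale_measurable_nu[OF s]]) auto

lemma integral_vol_jump_measure:
  fixes f :: "real \<Rightarrow> 'b::{banach, second_countable_topology}"
  assumes s: "s \<in> {0..Tstar}" and f [measurable]: "f \<in> borel_measurable borel" and f0: "f 0 = 0"
  shows "integrable (vol_jump_measure l s) f \<longleftrightarrow> integrable (\<nu> s) (\<lambda>y. f (lam s l * y))"
    and "integral\<^sup>L (vol_jump_measure l s) f = (LINT y|\<nu> s. f (lam s l * y))"
proof -
  have ind: "(\<lambda>x. indicator (- {0}) x *\<^sub>R f x) = f" using f0 by (auto simp: indicator_def fun_eq_iff)
  have fd: "f \<in> borel_measurable (distr (\<nu> s) borel ((*) (lam s l)))" by simp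
  have "integrable (vol_jump_measure l s) f \<longleftrightarrow> integrable (distr (\<nu> s) borel ((*) (lam s l))) f"
    unfolding vol_jump_measure_def using integrable_density[OF fd, of "indicator (- {0})"] by (simp add: ind)
  also have "\<dots> \<longleftrightarrow> integrable (\<nu> s) (\<lambda>y. f (lam s l * y))"
    by (rule integrable_distr_eq[OF scale_measurable_nu[OF s] f])
  finally show "integrable (vol_jump_measure l s) f \<longleftrightarrow> integrable (\<nu> s) (\<lambda>y. f (lam s l * y))" .
  have "integral\<^sup>L (vol_jump_measure l s) f = integral\<^sup>L (distr (\<nu> s) borel ((*) (lam s l))) f"
    unfolding vol_jump_measure_def using integral_density[OF fd, of "indicator (- {0})"] by (simp add: ind)
  also have "\<dots> = (LINT y|\<nu> s. f (lam s l * y))"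
    by (rule integral_distr[OF scale_measurable_nu[OF s] f])
  finally show "integral\<^sup>L (vol_jump_measure l s) f = (LINT y|\<nu> s. f (lam s l * y))" .
qed

lemma vol_jump_measure_levy:
  assumes l: "l \<in> {1..N}" and s: "s \<in> {0..Tstar}"
  shows "levy_measure (vol_jump_measure l s)"
proof -
  have "emeasure (vol_jump_measure l s) {0} = (\<integral>\<^sup>+x. indicator {0} x \<partial>vol_jump_measure l s)" by simp
  also have "\<dots> = (\<integral>\<^sup>+y. ennreal (indicator (- {0}) (lam s l * y)) * indicator {0} (lam s l * y) \<partial>\<nu> s)"
    by (rule nn_integral_vol_jump_measure[OF s]) simp
  also have "\<dots> = (\<integral>\<^sup>+y. 0 \<partial>\<nu> s)"
    by (intro nn_integral_cong) (auto simp: indicator_def)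
  finally have z: "emeasure (vol_jump_measure l s) {0} = 0" by simp
  have v: "(lam s l)\<^sup>2 \<le> M\<^sup>2" using vol_le_M[OF l s] power_mono[of "\<bar>lam s l\<bar>" M 2] by simp
  have "(\<integral>\<^sup>+x. ennreal (min 1 (x\<^sup>2)) \<partial>vol_jump_measure l s)
      = (\<integral>\<^sup>+y. ennreal (indicator (- {0}) (lam s l * y)) * ennreal (min 1 ((lam s l * y)\<^sup>2)) \<partial>\<nu> s)"
    by (rule nn_integral_vol_jump_measure[OF s]) measurable
  also have "\<dots> \<le> (\<integral>\<^sup>+y. ennreal (1 + M\<^sup>2) * ennreal (min 1 (y\<^sup>2)) \<partial>\<nu> s)"
  proof (rule nn_integral_mono)
    fix y
    have "min 1 ((lam s l * y)\<^sup>2) \<le> (1 + M\<^sup>2) * min 1 (y\<^sup>2)"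
    proof (cases "y\<^sup>2 \<le> 1")
      case True
      have "(lam s l * y)\<^sup>2 \<le> (1 + M\<^sup>2) * y\<^sup>2"
        unfolding power_mult_distrib using v by (intro mult_right_mono) auto
      then show ?thesis using True by (simp add: min_def)
    next
      case False
      then show ?thesis by (simp add: min_le_iff_disj)
    qed
    then have "ennreal (min 1 ((lam s l * y)\<^sup>2)) \<le> ennreal (1 + M\<^sup>2) * ennreal (min 1 (y\<^sup>2))"
      by (subst ennreal_mult[symmetric]) (auto intro: ennreal_leI)
    then show "ennreal (indicator (- {0}) (lam s l * y)) * ennreal (min 1 ((lam s l * y)\<^sup>2))
        \<le> ennreal (1 + M\<^sup>2) * ennreal (min 1 (y\<^sup>2))" by (auto simp: indicator_def)
  qed
  also have "\<dots> = ennreal (1 + M\<^sup>2) * (\<integral>\<^sup>+y. ennreal (min 1 (y\<^sup>2)) \<partial>\<nu> s)"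
    by (rule nn_integral_cmult) (rule measurable_nu[OF s], measurable)
  also have "\<dots> < \<infinity>" using nu_truncated[OF s] by (simp add: ennreal_mult_less_top)
  finally show ?thesis using z by (simp add: levy_measure_def)
qed

text \<open>
  The jump integrand vanishes at \<open>0\<close>, so removing the atom does not change the integral.
\<close>

lemma levy_exponent_vol:
  assumes s: "s \<in> {0..Tstar}"
  shows "integrable (vol_jump_measure l s) (\<lambda>x. iexp (u * x) - 1 - \<i> * of_real (u * x))"
    and "levy_exponent b ((lam s l)\<^sup>2 * c s) (vol_jump_measure l s) u = \<i> * of_real (u * b) + psi s (u * lam s l)"
proof -
  have m: "(\<lambda>x. iexp (u * x) - 1 - \<i> * of_real (u * x)) \<in> borel_measurable borel" by measurable
  show "integrable (vol_jump_measure l s) (\<lambda>x. iexp (u * x) - 1 - \<i> * of_real (u * x))"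
    using psi_jump_part(1)[OF s, of "u * lam s l"]
    by (subst integral_vol_jump_measure(1)[OF s m]) (simp_all add: mult.assoc)
  have "(CLINT x|vol_jump_measure l s. iexp (u * x) - 1 - \<i> * of_real (u * x))
      = (CLINT y|\<nu> s. iexp (u * lam s l * y) - 1 - \<i> * of_real (u * lam s l * y))"
    by (subst integral_vol_jump_measure(2)[OF s m]) (simp_all add: mult.assoc)
  then show "levy_exponent b ((lam s l)\<^sup>2 * c s) (vol_jump_measure l s) u = \<i> * of_real (u * b) + psi s (u * lam s l)"
    unfolding levy_exponent_def psi_eq by (simp add: power_mult_distrib mult_ac)
qed

lemma vol_jump_measure_kernel:
  assumes l: "l \<in> {1..N}" and A [measurable]: "A \<in> sets borel"
  shows "(\<lambda>s. emeasure (vol_jump_measure l s) A) \<in> borel_measurable time_space"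
proof -
  note [measurable] = vol_jump_pair_measurable[OF l]
  have "(\<lambda>(s, y). ennreal (indicator (- {0}) (lam s l * y)) * indicator A (lam s l * y)) \<in> borel_measurable (time_space \<Otimes>\<^sub>M borel)"
    unfolding case_prod_beta' by measurable
  then have "(\<lambda>s. \<integral>\<^sup>+y. ennreal (indicator (- {0}) (lam s l * y)) * indicator A (lam s l * y) \<partial>\<nu> s) \<in> borel_measurable time_space"
    by (rule nn_integral_nu_measurable) simp
  then show ?thesis
  proof (rule measurable_cong[THEN iffD2, rotated])
    fix s assume "s \<in> space time_space"
    then have s: "s \<in> {0..Tstar}" by simp
    show "emeasure (vol_jump_measure l s) A
        = (\<integral>\<^sup>+y. ennreal (indicator (- {0}) (lam s l * y)) * indicator A (lam s l * y) \<partial>\<nu> s)"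
      using nn_integral_vol_jump_measure[OF s borel_measurable_indicator[of A borel], of l] by simp
  qed
qed

text \<open>
  A Levy process starts at \<open>0\<close> for every outcome, whereas \<open>J 0 = 0\<close> holds only almost surely. The
  exceptional outcomes are known at time \<open>0\<close>, so discarding them keeps the process adapted.
\<close>

definition first_variation :: "nat \<Rightarrow> (real \<Rightarrow> 'a \<Rightarrow> real) \<Rightarrow> real \<Rightarrow> 'a \<Rightarrow> real" where
  "first_variation l J t \<omega> =
     (LINT s:{0..t}|lborel. libor_drift s l log_libor0) + (if J 0 \<omega> = 0 then J t \<omega> else 0)"

context
  fixes l :: nat and J :: "real \<Rightarrow> 'a \<Rightarrow> real"
  assumes l: "l \<in> {1..N}" and J: "vol_integral l J"
begin

lemma first_variation_adapted:
  assumes t: "t \<in> {0..T l}"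
  shows "first_variation l J t \<in> borel_measurable (F t)"
proof -
  have z: "(0::real) \<in> {0..T l}" using t by simp
  have [measurable]: "J 0 \<in> borel_measurable (F t)" "J t \<in> borel_measurable (F t)"
    using vol_integralD(1)[OF l J z] vol_integralD(1)[OF l J t] t by (auto intro: F_mono_measurable[of 0 t])
  show ?thesis unfolding first_variation_def by measurable
qed

lemma first_variation_measurable: "t \<in> {0..T l} \<Longrightarrow> first_variation l J t \<in> borel_measurable P"
  using first_variation_adapted[of t] tenor_le[OF l] by (intro F_measurable[of t]) auto

lemma first_variation_cadlag:
  assumes w: "\<omega> \<in> space P"
  shows "cadlag_on (T l) (\<lambda>t. first_variation l J t \<omega>)"
proof -
  let ?b = "\<lambda>t. LINT s:{0..t}|lborel. libor_drift s l log_libor0"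
  have cont: "continuous_on {0..T l} ?b"
    by (rule continuous_on_time_integral[OF drift_set_integrable[OF l]]) (use tenor_le[OF l] in auto)
  have cad: "cadlag_on (T l) (\<lambda>t. J t \<omega>)" by (rule vol_integralD(3)[OF l J w])
  show ?thesis
    unfolding cadlag_on_def first_variation_def
  proof (intro conjI ballI)
    fix t assume t: "t \<in> {0..<T l}"
    then have "((\<lambda>t. J t \<omega>) \<longlongrightarrow> J t \<omega>) (at_right t)" using cad by (simp add: cadlag_on_def)
    moreover have "(?b \<longlongrightarrow> ?b t) (at_right t)" using continuous_on_imp_at_right[OF cont] t by simp
    ultimately show "((\<lambda>t. ?b t + (if J 0 \<omega> = 0 then J t \<omega> else 0)) \<longlongrightarrow> ?b t + (if J 0 \<omega> = 0 then J t \<omega> else 0)) (at_right t)"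
      by (cases "J 0 \<omega> = 0") (auto intro!: tendsto_intros)
  next
    fix t assume t: "t \<in> {0<..T l}"
    then obtain L where "((\<lambda>t. J t \<omega>) \<longlongrightarrow> L) (at_left t)" using cad unfolding cadlag_on_def by blast
    moreover have "(?b \<longlongrightarrow> ?b t) (at_left t)" using continuous_on_imp_at_left[OF cont] t by simp
    ultimately have "((\<lambda>t. ?b t + (if J 0 \<omega> = 0 then J t \<omega> else 0)) \<longlongrightarrow> ?b t + (if J 0 \<omega> = 0 then L else 0)) (at_left t)"
      by (cases "J 0 \<omega> = 0") (auto intro!: tendsto_intros)
    then show "\<exists>L. ((\<lambda>t. ?b t + (if J 0 \<omega> = 0 then J t \<omega> else 0)) \<longlongrightarrow> L) (at_left t)" by blast
  qed
qed

lemma first_variation_0: "first_variation l J 0 \<omega> = 0"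
  by (simp add: first_variation_def time_integral_at_0)

lemma first_variation_increment_char:
  assumes st: "0 \<le> s" "s \<le> t" "t \<le> T l" and A: "A \<in> sets (F s)"
  shows "(CLINT \<omega>|P. indicator A \<omega> * iexp (u * (first_variation l J t \<omega> - first_variation l J s \<omega>)))
    = prob A * (iexp (u * ((LINT r:{0..t}|lborel. libor_drift r l log_libor0)
          - (LINT r:{0..s}|lborel. libor_drift r l log_libor0)))
        * exp (CLINT r:{s<..t}|lborel. psi r (u * lam r l)))"
proof -
  define \<beta> where "\<beta> = (LINT r:{0..t}|lborel. libor_drift r l log_libor0)
    - (LINT r:{0..s}|lborel. libor_drift r l log_libor0)"
  have mem: "s \<in> {0..T l}" "t \<in> {0..T l}" using st by auto
  have [measurable]: "A \<in> events" using A F_sub[of s] st tenor_le[OF l] by auto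
  note [measurable] = vol_integralD(2)[OF l J mem(1)] vol_integralD(2)[OF l J mem(2)]
    first_variation_measurable[OF mem(1)] first_variation_measurable[OF mem(2)]
  have "(CLINT \<omega>|P. indicator A \<omega> * iexp (u * (first_variation l J t \<omega> - first_variation l J s \<omega>)))
      = (CLINT \<omega>|P. iexp (u * \<beta>) * (indicator A \<omega> * iexp (u * (J t \<omega> - J s \<omega>))))"
  proof (rule integral_cong_AE)
    show "AE \<omega> in P. indicator A \<omega> * iexp (u * (first_variation l J t \<omega> - first_variation l J s \<omega>))
        = iexp (u * \<beta>) * (indicator A \<omega> * iexp (u * (J t \<omega> - J s \<omega>)))"
      using vol_integral_0[OF l J]
    proof eventually_elim
      case (elim \<omega>)
      have "u * (first_variation l J t \<omega> - first_variation l J s \<omega>) = u * \<beta> + u * (J t \<omega> - J s \<omega>)"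
        using elim by (simp add: first_variation_def \<beta>_def algebra_simps)
      then show ?case by (simp add: exp_add distrib_left)
    qed
  qed measurable
  also have "\<dots> = iexp (u * \<beta>) * (prob A * exp (CLINT r:{s<..t}|lborel. psi r (u * lam r l)))"
    unfolding integral_mult_right_zero vol_integral_increment_char[OF l J st A] ..
  finally show ?thesis by (simp add: \<beta>_def mult_ac)
qed

lemma first_variation_increment_char_full:
  assumes st: "0 \<le> s" "s \<le> t" "t \<le> T l"
  shows "(CLINT \<omega>|P. iexp (u * (first_variation l J t \<omega> - first_variation l J s \<omega>)))
    = iexp (u * ((LINT r:{0..t}|lborel. libor_drift r l log_libor0)
          - (LINT r:{0..s}|lborel. libor_drift r l log_libor0)))
        * exp (CLINT r:{s<..t}|lborel. psi r (u * lam r l))"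
proof -
  have "space P \<in> sets (F s)" using sets.top[of "F s"] space_F[of s] by simp
  note full = first_variation_increment_char[OF st this, of u]
  have "(CLINT \<omega>|P. iexp (u * (first_variation l J t \<omega> - first_variation l J s \<omega>)))
      = (CLINT \<omega>|P. indicator (space P) \<omega> * iexp (u * (first_variation l J t \<omega> - first_variation l J s \<omega>)))"
    by (intro Bochner_Integration.integral_cong) auto
  then show ?thesis unfolding full by (simp add: prob_space)
qed

lemma vol_exponent_integrable:
  assumes t: "t \<in> {0..T l}"
  shows "set_integrable lborel {0..t} (\<lambda>s. psi s (u * lam s l))"
    and "set_integrable lborel {0..t} (\<lambda>s. \<i> * of_real (u * libor_drift s l log_libor0))"
proof -
  have sub: "{0..t} \<in> sets borel" "{0..t} \<subseteq> {0..Tstar}" using t tenor_le[OF l] by auto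
  have mu: "(\<lambda>r. u * lam r l) \<in> borel_measurable time_space" using vol_measurable[OF l] by measurable
  show "set_integrable lborel {0..t} (\<lambda>s. psi s (u * lam s l))"
  proof (rule psi_time_integral[OF mu _ sub, of "\<bar>u\<bar> * M"])
    show "\<bar>u * lam r l\<bar> \<le> \<bar>u\<bar> * M" if "r \<in> {0..Tstar}" for r
      using vol_le_M[OF l that] by (auto simp: abs_mult intro!: mult_left_mono)
  qed
  have "set_integrable lborel {0..t} (\<lambda>s. complex_of_real (libor_drift s l log_libor0))"
    using integrable_of_real[OF drift_set_integrable[OF l sub, unfolded set_integrable_def], where 'a=complex]
    by (simp add: set_integrable_def scaleR_conv_of_real)
  then have "set_integrable lborel {0..t} (\<lambda>s. (\<i> * of_real u) * complex_of_real (libor_drift s l log_libor0))"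
    by (intro set_integrable_mult_right) simp
  then show "set_integrable lborel {0..t} (\<lambda>s. \<i> * of_real (u * libor_drift s l log_libor0))"
    by (simp add: mult.assoc)
qed

lemma first_variation_levy:
  "time_inhom_levy P F (T l) (\<lambda>s. libor_drift s l log_libor0) (\<lambda>s. (lam s l)\<^sup>2 * c s)
     (vol_jump_measure l) (first_variation l J)"
  unfolding time_inhom_levy_def
proof (intro conjI allI ballI impI)
  have Tl: "0 < T l" "T l \<le> Tstar" using tenor_pos[OF l] tenor_le[OF l] by auto
  have sub: "{0..T l} \<subseteq> {0..Tstar}" using Tl by auto
  let ?b = "\<lambda>s. libor_drift s l log_libor0"
  show "?b \<in> borel_measurable (restrict_space borel {0..T l})"
    by (rule measurable_restrict_mono[OF drift_measurable[OF l] sub])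
  note [measurable] = c_measurable vol_measurable[OF l]
  have "(\<lambda>s. (lam s l)\<^sup>2 * c s) \<in> borel_measurable time_space" by measurable
  then show "(\<lambda>s. (lam s l)\<^sup>2 * c s) \<in> borel_measurable (restrict_space borel {0..T l})"
    by (rule measurable_restrict_mono[OF _ sub])
  show "(\<lambda>s. emeasure (vol_jump_measure l s) A) \<in> borel_measurable (restrict_space borel {0..T l})"
    if "A \<in> sets borel" for A
    by (rule measurable_restrict_mono[OF vol_jump_measure_kernel[OF l that] sub])
  show "0 \<le> (lam s l)\<^sup>2 * c s" "levy_measure (vol_jump_measure l s)"
    and "integrable (vol_jump_measure l s) (\<lambda>x. iexp (u * x) - 1 - \<i> * of_real (u * x))"
    if "s \<in> {0..T l}" for s u
  proof -
    have s: "s \<in> {0..Tstar}" using that sub by auto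
    show "0 \<le> (lam s l)\<^sup>2 * c s" using c_nonneg[OF s] by simp
    show "levy_measure (vol_jump_measure l s)" by (rule vol_jump_measure_levy[OF l s])
    show "integrable (vol_jump_measure l s) (\<lambda>x. iexp (u * x) - 1 - \<i> * of_real (u * x))"
      by (rule levy_exponent_vol(1)[OF s])
  qed
  have exponent: "levy_exponent (?b s) ((lam s l)\<^sup>2 * c s) (vol_jump_measure l s) u
      = \<i> * of_real (u * ?b s) + psi s (u * lam s l)" if "s \<in> {0..T l}" for s u
    by (rule levy_exponent_vol(2)) (use that sub in auto)
  have expo_int: "set_integrable lborel {0..t} (\<lambda>s. levy_exponent (?b s) ((lam s l)\<^sup>2 * c s) (vol_jump_measure l s) u)"
    and expo_eq: "(CLINT s:{0..t}|lborel. levy_exponent (?b s) ((lam s l)\<^sup>2 * c s) (vol_jump_measure l s) u)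
      = \<i> * of_real (u * (LINT s:{0..t}|lborel. ?b s)) + (CLINT s:{0<..t}|lborel. psi s (u * lam s l))"
    if t: "t \<in> {0..T l}" for t u
  proof -
    note i = vol_exponent_integrable[OF t, of u]
    have eqs: "levy_exponent (?b s) ((lam s l)\<^sup>2 * c s) (vol_jump_measure l s) u
      = \<i> * of_real (u * ?b s) + psi s (u * lam s l)" if "s \<in> {0..t}" for s
      using exponent[of s u] that t by simp
    show "set_integrable lborel {0..t} (\<lambda>s. levy_exponent (?b s) ((lam s l)\<^sup>2 * c s) (vol_jump_measure l s) u)"
      using set_integral_add(1)[OF i(2) i(1)]
      by (rule set_integrable_cong[THEN iffD1, rotated -1]) (auto simp: eqs)
    have "(CLINT s:{0..t}|lborel. levy_exponent (?b s) ((lam s l)\<^sup>2 * c s) (vol_jump_measure l s) u)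
        = (CLINT s:{0..t}|lborel. \<i> * of_real (u * ?b s) + psi s (u * lam s l))"
      by (rule set_lebesgue_integral_cong) (auto simp: eqs)
    also have "\<dots> = (CLINT s:{0..t}|lborel. \<i> * of_real (u * ?b s)) + (CLINT s:{0..t}|lborel. psi s (u * lam s l))"
      by (rule set_integral_add(2)[OF i(2) i(1)])
    also have "(CLINT s:{0..t}|lborel. \<i> * of_real (u * ?b s)) = \<i> * of_real (u * (LINT s:{0..t}|lborel. ?b s))"
    proof -
      have "(CLINT s:{0..t}|lborel. \<i> * of_real (u * ?b s))
          = (CLINT s|lborel. \<i> * (of_real u * complex_of_real (indicator {0..t} s *\<^sub>R ?b s)))"
        unfolding set_lebesgue_integral_def
        by (intro Bochner_Integration.integral_cong) (auto simp: indicator_def)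
      also have "\<dots> = \<i> * (of_real u * complex_of_real (LINT s|lborel. indicator {0..t} s *\<^sub>R ?b s))"
        by (simp only: integral_mult_right_zero integral_complex_of_real)
      finally show ?thesis by (simp add: set_lebesgue_integral_def)
    qed
    also have "(CLINT s:{0..t}|lborel. psi s (u * lam s l)) = (CLINT s:{0<..t}|lborel. psi s (u * lam s l))"
      by (rule set_integral_Ioc_eq_Icc[OF i(1), symmetric])
    finally show "(CLINT s:{0..t}|lborel. levy_exponent (?b s) ((lam s l)\<^sup>2 * c s) (vol_jump_measure l s) u)
      = \<i> * of_real (u * (LINT s:{0..t}|lborel. ?b s)) + (CLINT s:{0<..t}|lborel. psi s (u * lam s l))" .
  qed
  show "set_integrable lborel {0..T l} (\<lambda>s. levy_exponent (?b s) ((lam s l)\<^sup>2 * c s) (vol_jump_measure l s) u)" for u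
    by (rule expo_int) (use Tl in auto)
  show "adapted_on F (T l) (first_variation l J)"
    using first_variation_adapted by (simp add: adapted_on_def)
  show "cadlag_on (T l) (\<lambda>t. first_variation l J t \<omega>)" if "\<omega> \<in> space P" for \<omega>
    by (rule first_variation_cadlag[OF that])
  show "first_variation l J 0 \<omega> = 0" for \<omega> by (rule first_variation_0)
  show "indep_set (sets (F s))
      (sets (vimage_algebra (space P) (\<lambda>\<omega>. first_variation l J t \<omega> - first_variation l J s \<omega>) borel))"
    if "0 \<le> s \<and> s < t \<and> t \<le> T l" for s t
  proof (rule indep_set_of_char)
    have st: "0 \<le> s" "s \<le> t" "t \<le> T l" using that by auto
    show "sets (F s) \<subseteq> events" using st Tl by (intro F_sub) auto
    show "(\<lambda>\<omega>. first_variation l J t \<omega> - first_variation l J s \<omega>) \<in> borel_measurable P"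
      using first_variation_measurable[of s] first_variation_measurable[of t] st by auto
    show "(CLINT \<omega>|P. indicator A \<omega> * iexp (u * (first_variation l J t \<omega> - first_variation l J s \<omega>)))
        = prob A * (CLINT \<omega>|P. iexp (u * (first_variation l J t \<omega> - first_variation l J s \<omega>)))"
      if "A \<in> sets (F s)" for A u
      unfolding first_variation_increment_char[OF st that] first_variation_increment_char_full[OF st] ..
  qed
  show "(CLINT \<omega>|P. iexp (u * first_variation l J t \<omega>))
      = exp (CLINT s:{0..t}|lborel. levy_exponent (?b s) ((lam s l)\<^sup>2 * c s) (vol_jump_measure l s) u)"
    if t: "t \<in> {0..T l}" for t u
    using first_variation_increment_char_full[of 0 t u] t
    by (simp add: expo_eq first_variation_0 time_integral_at_0 exp_add)
qed

end

section \<open>The Taylor approximation\<close>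

text \<open>
  For fixed \<open>t\<close> the rate is almost surely \<open>log L(0) + \<epsilon> (D \<epsilon> t + J t)\<close>, a smooth family in \<open>\<epsilon>\<close>. Its
  derivative at \<open>0\<close> is \<open>D 0 t + J t\<close>, where \<open>D 0 t\<close> is the drift at the frozen initial rates.
\<close>

lemma first_variation_expansion:
  assumes X: "\<And>\<epsilon>. perturbed_solution P F T N H c \<nu> lam B \<epsilon> (X \<epsilon>)" and i: "i \<in> {1..N}"
    and J: "vol_integral i J" and D: "represents (T i) i X J D" and t: "t \<in> {0..T i}"
  shows "has_L2_derivative P (\<lambda>\<epsilon>. X \<epsilon> i t) (first_variation i J t) 0"
    and "strong_Taylor_approximation P 1 (\<lambda>\<epsilon>. X \<epsilon> i t) (\<lambda>\<epsilon> \<omega>. log_libor0 i + \<epsilon> * first_variation i J t \<omega>)"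
proof -
  have Xm: "X \<epsilon> i t \<in> borel_measurable P" for \<epsilon>
    using X[of \<epsilon>] i t tenor_le[OF i] unfolding perturbed_solution_def adapted_on_def
    by (intro F_measurable[of t]) auto
  have Ym: "first_variation i J t \<in> borel_measurable P" by (rule first_variation_measurable[OF i J t])
  have Dsmooth: "smooth_family D"
    and D0: "\<And>\<omega>. \<omega> \<in> space P \<Longrightarrow> D 0 t \<omega> = (LINT r:{0..t}|lborel. libor_drift r i log_libor0)"
    using D t by (auto simp: represents_def)
  have X_eq: "AE \<omega> in P. X \<epsilon> i t \<omega> = log_libor0 i + \<epsilon> * (D \<epsilon> t \<omega> + J t \<omega>)" for \<epsilon>
  proof -
    have "AE \<omega> in P. (\<forall>t\<in>{0..T i}. X \<epsilon> i t \<omega> = log_libor0 i + \<epsilon> * (D \<epsilon> t \<omega> + J t \<omega>)) \<and>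
        (\<forall>s\<in>{0<..T i}. Lim (at_left s) (\<lambda>r. X \<epsilon> i r \<omega>) = log_libor0 i + \<epsilon> * (D \<epsilon> s \<omega> + left_process (T i) J s \<omega>))"
      using D unfolding represents_def by blast
    then show ?thesis by eventually_elim (use t in auto)
  qed
  have [measurable]: "J t \<in> borel_measurable P" by (rule vol_integralD(2)[OF i J t])
  have "moment_process P (\<lambda>s. J t)"
  proof (rule moment_process_by_moments)
    show "(\<lambda>(s::real, \<omega>). J t \<omega>) \<in> borel_measurable (borel \<Otimes>\<^sub>M P)" by measurable
    show "\<exists>C::real. \<forall>s::real. (\<integral>\<^sup>+\<omega>. ennreal (\<bar>J t \<omega>\<bar> ^ k) \<partial>P) \<le> ennreal C" for k
      using vol_integral_moment[OF i J, of k] t by blast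
  qed auto
  then have U: "smooth_family (\<lambda>\<epsilon> s \<omega>. log_libor0 i + \<epsilon> * (D \<epsilon> s \<omega> + J t \<omega>))"
    by (intro smooth_family_add smooth_family_mult smooth_family_const smooth_family_parameter
        smooth_family_moment_process Dsmooth)
  then obtain E where E0: "E 0 = (\<lambda>\<epsilon> s \<omega>. log_libor0 i + \<epsilon> * (D \<epsilon> s \<omega> + J t \<omega>))"
    and E: "\<forall>k. smooth_family (E k)"
    and E_deriv: "\<forall>k \<epsilon> s. \<forall>\<omega>\<in>space P. ((\<lambda>\<epsilon>. E k \<epsilon> s \<omega>) has_real_derivative E (Suc k) \<epsilon> s \<omega>) (at \<epsilon>)"
    using smooth_family_iterated_derivatives by blast
  have E_L2: "has_L2_derivative P (\<lambda>\<epsilon>. E k \<epsilon> t) (E (Suc k) \<epsilon> t) \<epsilon>" for k \<epsilon>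
    by (rule has_L2_derivative_pathwise) (use E E_deriv smooth_family_locally_dominated in auto)
  have E_meas: "E k \<epsilon> t \<in> borel_measurable P" for k \<epsilon>
    using E_L2[of k \<epsilon>] by (auto simp: has_L2_derivative_def square_integrable_def)
  have X_L2: "has_L2_derivative P (\<lambda>\<epsilon>. X \<epsilon> i t) (E 1 \<epsilon> t) \<epsilon>" for \<epsilon>
  proof (rule has_L2_derivative_cong_AE[OF E_L2[of 0 \<epsilon>] Xm])
    show "AE \<omega> in P. E 0 \<eta> t \<omega> = X \<eta> i t \<omega>" for \<eta>
      using X_eq[of \<eta>] by eventually_elim (simp add: E0)
  qed (use E_meas in auto)
  have Y_eq: "AE \<omega> in P. E 1 0 t \<omega> = first_variation i J t \<omega>"
    using vol_integral_0[OF i J] AE_space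
  proof eventually_elim
    case (elim \<omega>)
    obtain V where "\<forall>\<epsilon> s. \<forall>\<omega>\<in>space P. ((\<lambda>\<epsilon>. D \<epsilon> s \<omega>) has_real_derivative V \<epsilon> s \<omega>) (at \<epsilon>)"
      using smooth_family_derivative[OF Dsmooth] by blast
    then have "((\<lambda>\<epsilon>. D \<epsilon> t \<omega>) has_real_derivative V 0 t \<omega>) (at 0)" using elim(2) by simp
    then have "((\<lambda>\<epsilon>. log_libor0 i + \<epsilon> * (D \<epsilon> t \<omega> + J t \<omega>)) has_real_derivative D 0 t \<omega> + J t \<omega>) (at 0)"
      by (auto intro!: derivative_eq_intros)
    moreover have "((\<lambda>\<epsilon>. E 0 \<epsilon> t \<omega>) has_real_derivative E 1 0 t \<omega>) (at 0)"
      using E_deriv elim(2) by (metis One_nat_def)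
    ultimately have "E 1 0 t \<omega> = D 0 t \<omega> + J t \<omega>" unfolding E0 by (rule DERIV_unique[symmetric])
    then show ?case using elim D0[OF elim(2)] by (simp add: first_variation_def)
  qed
  show L: "has_L2_derivative P (\<lambda>\<epsilon>. X \<epsilon> i t) (first_variation i J t) 0"
    by (rule has_L2_derivative_cong_AE[OF X_L2 Xm _ Ym Y_eq]) auto
  have X0: "AE \<omega> in P. X 0 i t \<omega> = log_libor0 i" using X_eq[of 0] by eventually_elim simp
  \<comment> \<open>\<open>X\<close> and \<open>E 0\<close> agree only almost surely for each \<open>\<epsilon>\<close>, but the curve itself has to be its derivative of order \<open>0\<close>.\<close>
  define E' where "E' k \<epsilon> = (if k = 0 then X \<epsilon> i t else E k \<epsilon> t)" for k :: nat and \<epsilon>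
  have "smooth_L2_curve P (\<lambda>\<epsilon>. X \<epsilon> i t) E'"
    unfolding smooth_L2_curve_def
  proof (intro conjI allI)
    show "E' 0 = (\<lambda>\<epsilon>. X \<epsilon> i t)" by (simp add: E'_def fun_eq_iff)
    show "has_L2_derivative P (E' k) (E' (Suc k) \<epsilon>) \<epsilon>" for k \<epsilon>
    proof (cases "k = 0")
      case True
      then have "E' k = (\<lambda>\<epsilon>. X \<epsilon> i t)" "E' (Suc k) \<epsilon> = E 1 \<epsilon> t" by (simp_all add: E'_def fun_eq_iff)
      then show ?thesis using X_L2 by simp
    next
      case False
      then have "E' k = (\<lambda>\<epsilon>. E k \<epsilon> t)" "E' (Suc k) \<epsilon> = E (Suc k) \<epsilon> t" by (simp_all add: E'_def fun_eq_iff)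
      then show ?thesis using E_L2 by simp
    qed
  qed
  moreover have "AE \<omega> in P. log_libor0 i + \<epsilon> * first_variation i J t \<omega> = (\<Sum>k\<le>1. \<epsilon> ^ k / fact k * E' k 0 \<omega>)" for \<epsilon>
    using X0 Y_eq by eventually_elim (simp add: E'_def)
  moreover have "(\<lambda>\<omega>. log_libor0 i + \<epsilon> * first_variation i J t \<omega>) \<in> borel_measurable P" for \<epsilon>
    using Ym by measurable
  moreover have "(\<lambda>\<epsilon>. LINT \<omega>|P. \<bar>X \<epsilon> i t \<omega> - (log_libor0 i + \<epsilon> * first_variation i J t \<omega>)\<bar>) \<in> o[at 0](\<lambda>\<epsilon>. \<epsilon> ^ 1)"
  proof -
    note [measurable] = Xm Ym
    have "(LINT \<omega>|P. \<bar>X \<epsilon> i t \<omega> - (log_libor0 i + \<epsilon> * first_variation i J t \<omega>)\<bar>)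
        = (LINT \<omega>|P. \<bar>X \<epsilon> i t \<omega> - (X 0 i t \<omega> + \<epsilon> * first_variation i J t \<omega>)\<bar>)" for \<epsilon>
      by (rule integral_cong_AE) (measurable, use X0 in auto)
    then show ?thesis using first_order_remainder_smallo[OF L] by simp
  qed
  ultimately show "strong_Taylor_approximation P 1 (\<lambda>\<epsilon>. X \<epsilon> i t) (\<lambda>\<epsilon> \<omega>. log_libor0 i + \<epsilon> * first_variation i J t \<omega>)"
    unfolding strong_Taylor_approximation_def by blast
qed

lemma vol_jump_measure_image:
  assumes "s \<in> {0..Tstar}" "A \<in> sets borel" "0 \<notin> A"
  shows "(\<integral>\<^sup>+x. indicator A x \<partial>vol_jump_measure l s) = (\<integral>\<^sup>+x. indicator A (lam s l * x) \<partial>\<nu> s)"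
  unfolding nn_integral_vol_jump_measure[OF assms(1) borel_measurable_indicator[OF assms(2)]]
  using assms(3) by (intro nn_integral_cong) (auto simp: indicator_def)

end

theorem lemma5p4:
  fixes P :: "'a measure" and F :: "real \<Rightarrow> 'a measure" and T :: "nat \<Rightarrow> real" and N :: nat
    and H :: "real \<Rightarrow> 'a \<Rightarrow> real" and c :: "real \<Rightarrow> real" and \<nu> :: "real \<Rightarrow> real measure"
    and M e :: real and lam :: "real \<Rightarrow> nat \<Rightarrow> real" and B :: "nat \<Rightarrow> real"
    and X :: "real \<Rightarrow> nat \<Rightarrow> real \<Rightarrow> 'a \<Rightarrow> real" and i :: nat
  assumes "levy_libor P F T N H c \<nu> M e lam B"
    and "\<And>\<epsilon>. perturbed_solution P F T N H c \<nu> lam B \<epsilon> (X \<epsilon>)"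
    and "i \<in> {1..N}"
  shows "\<exists>Y \<nu>Y.
    (\<forall>t\<in>{0..T i}. has_L2_derivative P (\<lambda>\<epsilon>. X \<epsilon> i t) (Y t) 0) \<and>
    (\<forall>t\<in>{0..T i}. strong_Taylor_approximation P 1 (\<lambda>\<epsilon>. X \<epsilon> i t)
       (\<lambda>\<epsilon> \<omega>. ln (libor0 T B i) + \<epsilon> * Y t \<omega>)) \<and>
    time_inhom_levy P F (T i)
      (\<lambda>s. drift N T lam c \<nu> s i (\<lambda>l. ln (libor0 T B l))) (\<lambda>s. (lam s i)\<^sup>2 * c s) \<nu>Y Y \<and>
    (\<forall>s\<in>{0..T i}. \<forall>A\<in>sets borel. 0 \<notin> A \<longrightarrow>
       (\<integral>\<^sup>+x. indicator A x \<partial>\<nu>Y s) = (\<integral>\<^sup>+x. indicator A (lam s i * x) \<partial>\<nu> s))"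
proof -
  interpret levy_libor P F T N H c \<nu> M e lam B by fact
  note X = assms(2) and i = assms(3)
  obtain J D where J: "vol_integral i J" and D: "represents (T i) i X J D"
    using representation[OF X i, of i] i by auto
  have log_eq: "log_libor0 = (\<lambda>l. ln (libor0 T B l))" by (simp add: log_libor0_def fun_eq_iff)
  show ?thesis
  proof (intro exI[of _ "first_variation i J"] exI[of _ "vol_jump_measure i"] conjI ballI impI)
    fix t assume t: "t \<in> {0..T i}"
    show "has_L2_derivative P (\<lambda>\<epsilon>. X \<epsilon> i t) (first_variation i J t) 0"
      by (rule first_variation_expansion(1)[OF X i J D t])
    show "strong_Taylor_approximation P 1 (\<lambda>\<epsilon>. X \<epsilon> i t)
        (\<lambda>\<epsilon> \<omega>. ln (libor0 T B i) + \<epsilon> * first_variation i J t \<omega>)"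
      using first_variation_expansion(2)[OF X i J D t] by (simp add: log_eq)
  next
    show "time_inhom_levy P F (T i)
      (\<lambda>s. drift N T lam c \<nu> s i (\<lambda>l. ln (libor0 T B l))) (\<lambda>s. (lam s i)\<^sup>2 * c s)
      (vol_jump_measure i) (first_variation i J)"
      using first_variation_levy[OF i J] by (simp add: log_eq)
  next
    fix s and A :: "real set" assume "s \<in> {0..T i}" "A \<in> sets borel" "0 \<notin> A"
    then show "(\<integral>\<^sup>+x. indicator A x \<partial>vol_jump_measure i s) = (\<integral>\<^sup>+x. indicator A (lam s i * x) \<partial>\<nu> s)"
      using tenor_le[OF i] by (intro vol_jump_measure_image) auto
  qed
qed

end
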